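(* Let $V$ be a finite-dimensional vector space over a field $\mathbb k$, $X$ a closed subscheme of $V$, and $L$ a $1$-dimensional subspace of $V$. Let $\Pi$ be the scheme-theoretic closure of the image of $X$ in $V/L$, let $\overline X$ be the closure of $X$ in $\mathrm{Bl}_L\overline V$, and set $\Lambda=\overline X\cap V/L$, the intersection of schemes taking place in $\mathrm{Bl}_L\overline V$. (a) If $H$ is a hyperplane complementary to $L$ in $V$, and $H$ is identified with $V/L$, then the flat limit $X':=\lim_{t\to0}t\cdot X$ under scaling $L$ and fixing $H$ satisfies $$X'\supseteq(\Pi\times\{0\})\cup_{\Lambda\times\{0\}}(\Lambda\times L).$$ (b) The scheme-theoretic containment in (a) is an equality as sets. (c) If (the ideal of) $X$ is homogeneous, then so are $\Pi$ and $\Lambda$, and the Hilbert series of subschemes of $V$ satisfy $$h_X(s)\ge(1-s)\,h_{\Pi\times L}(s)+s\,h_{\Lambda\times L}(s).$$ (d) Parts (a) and (c) both become equalities if the flat limit $X'$ is reduced.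
   Context: View $V$ as an affine scheme over $\mathbb k$, with projective completion $\overline V=\mathbb P(V\oplus\mathbb k)=V\cup\mathbb PV$, which contains the point $\mathbb PL\in\mathbb PV$. $\mathrm{Bl}_L\overline V$ denotes the blow-up of $\mathbb P(V\oplus\mathbb k)$ at the point $\mathbb PL$; its exceptional divisor is naturally identified with the projective completion $\mathbb P((V/L)\oplus\mathbb k)$ of the quotient vector space $V/L$, and in particular contains a copy of $V/L$. For a codimension-$1$ subspace $H$ complementary to $L$, the action of $\mathbb k^\times$ on $V=H\times L$ by $t\cdot(\vec h,l)=(\vec h,tl)$ is called scaling $L$ and fixing $H$. The union in (a) is the scheme-theoretic union in $H\times L=V$ (defined by the intersection of the ideals of $\Pi\times\{0\}$ and $\Lambda\times L$). For a closed subscheme $Y\subseteq V$ with homogeneous ideal (standard grading), $h_Y(s)$ is the Hilbert series of its coordinate ring; inequality of power series is coefficientwise. *)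

theory Defs
  imports
    "HOL-Library.Poly_Mapping"
    "HOL-Computational_Algebra.Formal_Power_Series"
    "HOL-Algebra.QuotRing"
    "HOL-Algebra.Generated_Rings"
    "HOL-Algebra.Embedded_Algebras"
begin

section \<open>Polynomials in the indeterminates of a set\<close>

type_synonym ('x, 'k) mpoly = "('x \<Rightarrow>\<^sub>0 nat) \<Rightarrow>\<^sub>0 'k"

definition const :: "'k::comm_ring_1 \<Rightarrow> ('x, 'k) mpoly" where
  "const c = Poly_Mapping.single 0 c"

definition var :: "'x \<Rightarrow> ('x, 'k::comm_ring_1) mpoly" where
  "var x = Poly_Mapping.single (Poly_Mapping.single x 1) 1"

definition indets :: "('x, 'k::zero) mpoly \<Rightarrow> 'x set" where
  "indets p = (\<Union>m \<in> Poly_Mapping.keys p. Poly_Mapping.keys m)"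

definition mpoly_subst ::
  "('x \<Rightarrow> ('y, 'k) mpoly) \<Rightarrow> ('x, 'k::comm_ring_1) mpoly \<Rightarrow> ('y, 'k) mpoly" where
  "mpoly_subst \<sigma> p =
     (\<Sum>m \<in> Poly_Mapping.keys p. const (Poly_Mapping.lookup p m) *
        (\<Prod>x \<in> Poly_Mapping.keys m. \<sigma> x ^ Poly_Mapping.lookup m x))"

definition poly_ring :: "'x set \<Rightarrow> ('x, 'k::comm_ring_1) mpoly ring" where
  "poly_ring B = \<lparr>carrier = {p. indets p \<subseteq> B}, mult = (*), one = 1, zero = 0, add = (+)\<rparr>"

text \<open>
  A finite-dimensional space \<open>V\<close> is given by a scalar multiplication and a basis \<open>B\<close>. Its
  coordinate ring \<open>k[V] = Sym(V*)\<close> is \<^term>\<open>poly_ring B\<close>, where \<^term>\<open>var b\<close> stands for the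
  coordinate functional dual to \<open>b \<in> B\<close>. (Functions on \<open>V\<close> would not do: \<open>k\<close> may be finite.)
  Closed subschemes of \<open>V\<close> are the ideals of this ring, with inclusions reversed.

  An extra coordinate is added by passing to the type \<open>'v option\<close>, with \<^term>\<open>None\<close> as the
  new indeterminate.
\<close>

abbreviation lift :: "('x, 'k::comm_ring_1) mpoly \<Rightarrow> ('x option, 'k) mpoly" where
  "lift \<equiv> mpoly_subst (\<lambda>x. var (Some x))"

abbreviation ext_vars :: "'x set \<Rightarrow> 'x option set" where
  "ext_vars B \<equiv> insert None (Some ` B)"

definition weight :: "('x \<Rightarrow> nat) \<Rightarrow> ('x \<Rightarrow>\<^sub>0 nat) \<Rightarrow> nat" where
  "weight w m = (\<Sum>x \<in> Poly_Mapping.keys m. w x * Poly_Mapping.lookup m x)"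

definition graded_part :: "('x \<Rightarrow> nat) \<Rightarrow> nat \<Rightarrow> ('x, 'k::comm_ring_1) mpoly \<Rightarrow> ('x, 'k) mpoly" where
  "graded_part w d p =
     (\<Sum>m | m \<in> Poly_Mapping.keys p \<and> weight w m = d.
        Poly_Mapping.single m (Poly_Mapping.lookup p m))"

abbreviation hom_part :: "nat \<Rightarrow> ('x, 'k::comm_ring_1) mpoly \<Rightarrow> ('x, 'k) mpoly" where
  "hom_part \<equiv> graded_part (\<lambda>_. 1)"

definition homogeneous_ideal :: "('x, 'k::comm_ring_1) mpoly set \<Rightarrow> bool" where
  "homogeneous_ideal I \<longleftrightarrow> (\<forall>f \<in> I. \<forall>d. hom_part d f \<in> I)"

definition reduced_ring :: "('a, 'b) ring_scheme \<Rightarrow> bool" where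
  "reduced_ring R \<longleftrightarrow>
     (\<forall>x \<in> carrier R. \<forall>n::nat. x [^]\<^bsub>R\<^esub> n = \<zero>\<^bsub>R\<^esub> \<longrightarrow> x = \<zero>\<^bsub>R\<^esub>)"

text \<open>The underlying set of the closed subscheme of \<open>Spec R\<close> defined by \<open>I\<close>.\<close>

definition points :: "('a, 'b) ring_scheme \<Rightarrow> 'a set \<Rightarrow> 'a set set" where
  "points R I = {P. primeideal P R \<and> I \<subseteq> P}"

definition coord_quot :: "'v set \<Rightarrow> ('v, 'k::field) mpoly set \<Rightarrow> ('v, 'k) mpoly set ring" where
  "coord_quot B I = poly_ring B Quot I"

text \<open>
  For homogeneous \<open>I\<close>, the degree \<open>d\<close> piece of \<open>k[V]/I\<close> consists of the classes of the forms of
  degree \<open>d\<close>; its dimension is taken over the image of \<open>k\<close> in \<open>k[V]/I\<close>. Integer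
  coefficients, because \<open>1 - s\<close> occurs as a multiplier.
\<close>

definition hilbert_series :: "'v set \<Rightarrow> ('v, 'k::field) mpoly set \<Rightarrow> int fps" where
  "hilbert_series B I = Abs_fps (\<lambda>d. int (THE n.
     ring.dimension (coord_quot B I) n
       ((\<lambda>c. I +>\<^bsub>poly_ring B\<^esub> const c) ` UNIV)
       ((\<lambda>f. I +>\<^bsub>poly_ring B\<^esub> f) ` {f \<in> carrier (poly_ring B). hom_part d f = f})))"


section \<open>Linear forms and the quotient \<open>V/L\<close>\<close>

definition lin_form :: "'v set \<Rightarrow> ('v \<Rightarrow> 'k::field) \<Rightarrow> ('v, 'k) mpoly" where
  "lin_form B \<phi> = (\<Sum>b \<in> B. const (\<phi> b) * var b)"

definition annihilator_forms ::
  "('k::field \<Rightarrow> 'v::ab_group_add \<Rightarrow> 'v) \<Rightarrow> 'v set \<Rightarrow> 'v set \<Rightarrow> ('v, 'k) mpoly set" where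
  "annihilator_forms scale B W =
     {lin_form B \<phi> | \<phi>. Vector_Spaces.linear scale (*) \<phi> \<and> (\<forall>v \<in> W. \<phi> v = 0)}"

text \<open>
  Since \<open>(V/L)*\<close> is the space of functionals on \<open>V\<close> that vanish on \<open>L\<close>, the ring
  \<open>k[V/L] = Sym((V/L)*)\<close> is the subalgebra of \<open>k[V]\<close> generated by these linear forms, and
  the inclusion is the pullback along \<open>V \<rightarrow> V/L\<close>.
\<close>

definition quot_coord_ring ::
  "('k::field \<Rightarrow> 'v::ab_group_add \<Rightarrow> 'v) \<Rightarrow> 'v set \<Rightarrow> 'v set \<Rightarrow> ('v, 'k) mpoly ring" where
  "quot_coord_ring scale B L =
     (poly_ring B)\<lparr>carrier := generate_ring (poly_ring B)
        (range const \<union> annihilator_forms scale B L)\<rparr>"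

text \<open>\<open>\<Pi>\<close>: the kernel of \<open>k[V/L] \<rightarrow> k[V]/I\<close>.\<close>

definition Pi_ideal ::
  "('k::field \<Rightarrow> 'v::ab_group_add \<Rightarrow> 'v) \<Rightarrow> 'v set \<Rightarrow> 'v set \<Rightarrow>
   ('v, 'k) mpoly set \<Rightarrow> ('v, 'k) mpoly set" where
  "Pi_ideal scale B L I = {f \<in> carrier (quot_coord_ring scale B L). f \<in> I}"


section \<open>The blow-up of \<open>P(V \<oplus> k)\<close> at the point \<open>PL\<close>\<close>

text \<open>
  Let \<open>S = k[V \<oplus> k] =\<close> \<^term>\<open>poly_ring (ext_vars B)\<close>, with homogenizing coordinate
  \<open>z =\<close> \<^term>\<open>var None\<close>; \<open>V\<close> is the open set \<open>z \<noteq> 0\<close> of \<open>Proj S\<close>. The point \<open>PL\<close> is defined by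
  the ideal \<open>P\<close> generated by \<open>z\<close> and the linear forms on \<open>V\<close> vanishing on \<open>L\<close>.
\<close>

definition point_ideal ::
  "('k::field \<Rightarrow> 'v::ab_group_add \<Rightarrow> 'v) \<Rightarrow> 'v set \<Rightarrow> 'v set \<Rightarrow> ('v option, 'k) mpoly set" where
  "point_ideal scale B L =
     genideal (poly_ring (ext_vars B)) (insert (var None) (lift ` annihilator_forms scale B L))"

text \<open>
  The blow-up is the relative \<open>Proj\<close> over \<open>Proj S\<close> of the sheaf of algebras associated with the
  Rees algebra \<open>S[PT] = \<Oplus>\<^sub>d P\<^sup>d T\<^sup>d \<subseteq> S[T]\<close>. Here \<open>T\<close> is the indeterminate \<^term>\<open>None\<close>
  of type \<open>'v option option\<close>.
  The Rees algebra is bigraded by the degree in \<open>S\<close> and the degree in \<open>T\<close>, and closed subschemes of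
  the blow-up are given by bihomogeneous ideals: on the open set on which \<open>s \<in> S\<close> and
  \<open>qT\<close> (\<open>s\<close>, \<open>q \<in> P\<close> homogeneous) are invertible, the coordinate ring is the part of bidegree
  \<open>(0, 0)\<close> of the localization of the Rees algebra at \<open>s\<close> and \<open>qT\<close>.
\<close>

definition rees_ring ::
  "('k::field \<Rightarrow> 'v::ab_group_add \<Rightarrow> 'v) \<Rightarrow> 'v set \<Rightarrow> 'v set \<Rightarrow> ('v option option, 'k) mpoly ring"
  where
  "rees_ring scale B L =
     (poly_ring (ext_vars (ext_vars B)))\<lparr>carrier :=
        generate_ring (poly_ring (ext_vars (ext_vars B)))
          (lift ` carrier (poly_ring (ext_vars B)) \<union>
           (\<lambda>p. lift p * var None) ` point_ideal scale B L)\<rparr>"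

text \<open>The exceptional divisor: the inverse image of the point, i.e. the extension of \<open>P\<close>.\<close>

definition exceptional_ideal ::
  "('k::field \<Rightarrow> 'v::ab_group_add \<Rightarrow> 'v) \<Rightarrow> 'v set \<Rightarrow> 'v set \<Rightarrow> ('v option option, 'k) mpoly set"
  where
  "exceptional_ideal scale B L = genideal (rees_ring scale B L) (lift ` point_ideal scale B L)"

definition bihom_part ::
  "nat \<Rightarrow> nat \<Rightarrow> ('x option, 'k::comm_ring_1) mpoly \<Rightarrow> ('x option, 'k) mpoly" where
  "bihom_part e d G =
     graded_part (case_option 0 (\<lambda>_. 1)) e (graded_part (case_option 1 (\<lambda>_. 0)) d G)"

text \<open>
  \<open>V\<close> does not contain \<open>PL\<close>, so it is also an open subset of the blow-up, namely the one on which
  \<open>z\<close> and \<open>zT\<close> are invertible. A bihomogeneous element \<open>F T\<^sup>d\<close> is restricted to \<open>V\<close> by dividing by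
  powers of \<open>z\<close> and \<open>zT\<close>, which amounts to setting \<open>z = T = 1\<close>.
\<close>

definition restrict_to_V :: "('v option option, 'k::field) mpoly \<Rightarrow> ('v, 'k) mpoly" where
  "restrict_to_V =
     mpoly_subst (\<lambda>x. case x of None \<Rightarrow> 1 | Some None \<Rightarrow> 1 | Some (Some b) \<Rightarrow> var b)"

text \<open>
  The closure of \<open>X\<close> in the blow-up: the ideal consisting of the sums of bihomogeneous elements
  that vanish on \<open>X\<close>.
\<close>

definition closure_ideal ::
  "('k::field \<Rightarrow> 'v::ab_group_add \<Rightarrow> 'v) \<Rightarrow> 'v set \<Rightarrow> 'v set \<Rightarrow>
   ('v, 'k) mpoly set \<Rightarrow> ('v option option, 'k) mpoly set" where
  "closure_ideal scale B L I =
     {G \<in> carrier (rees_ring scale B L). \<forall>e d. restrict_to_V (bihom_part e d G) \<in> I}"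

text \<open>
  The exceptional divisor is \<open>P((V/L) \<oplus> k)\<close> with homogeneous coordinates \<open>\<ell>T\<close>
  (for \<open>\<ell> \<in> (V/L)*\<close>) and \<open>zT\<close>, and \<open>V/L\<close> is the locus \<open>zT \<noteq> 0\<close> in it. So the function
  \<open>f \<in> k[V/L]\<close> becomes the fraction \<open>form_on_E d f / (zT)\<^sup>d\<close>, for any \<open>d\<close> at least the degree
  of \<open>f\<close>.
\<close>

definition form_on_E :: "nat \<Rightarrow> ('v, 'k::field) mpoly \<Rightarrow> ('v option option, 'k) mpoly" where
  "form_on_E d f =
     (\<Sum>j\<le>d. (lift (var None) * var None) ^ (d - j) * (lift (lift (hom_part j f)) * var None ^ j))"

text \<open>
  \<open>\<Lambda> = closure(X) \<inter> V/L\<close>, the ideal of the intersection being the sum of the ideals. Let \<open>y\<close> be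
  a linear form on \<open>V\<close> that does not vanish on \<open>L\<close>. Then \<open>V/L\<close> is closed in the open set
  of the blow-up on which \<open>y\<close> and \<open>zT\<close> are invertible, so \<open>f\<close> vanishes on \<open>\<Lambda>\<close> iff
  \<open>form_on_E d f / (zT)\<^sup>d\<close> lies in the localization of the sum of the two ideals at \<open>y\<close>
  and \<open>zT\<close>. Multiplication by a power of \<open>zT\<close> only increases \<open>d\<close>. The choice of \<open>y\<close> does not
  matter, because modulo the ideal of the exceptional divisor any two differ by a nonzero scalar.
\<close>

definition Lambda_ideal ::
  "('k::field \<Rightarrow> 'v::ab_group_add \<Rightarrow> 'v) \<Rightarrow> 'v set \<Rightarrow> 'v set \<Rightarrow>
   ('v, 'k) mpoly set \<Rightarrow> ('v, 'k) mpoly set" where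
  "Lambda_ideal scale B L I =
     {f \<in> carrier (quot_coord_ring scale B L).
        \<exists>\<phi> N d. Vector_Spaces.linear scale (*) \<phi> \<and> (\<exists>v \<in> L. \<phi> v \<noteq> 0) \<and>
          (\<forall>j>d. hom_part j f = 0) \<and>
          lift (lift (lin_form B \<phi>)) ^ N * form_on_E d f
            \<in> closure_ideal scale B L I <+>\<^bsub>rees_ring scale B L\<^esub> exceptional_ideal scale B L}"


section \<open>Complements of \<open>L\<close> and the flat limit\<close>

text \<open>A complement of a line is automatically a subspace of codimension \<open>1\<close>.\<close>

definition complementary ::
  "('k::field \<Rightarrow> 'v::ab_group_add \<Rightarrow> 'v) \<Rightarrow> 'v set \<Rightarrow> 'v set \<Rightarrow> bool" where
  "complementary scale H L \<longleftrightarrow>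
     module.subspace scale H \<and> module.subspace scale L \<and> H \<inter> L = {0} \<and>
     {h + l | h l. h \<in> H \<and> l \<in> L} = UNIV"

definition proj :: "'v::ab_group_add set \<Rightarrow> 'v set \<Rightarrow> 'v \<Rightarrow> 'v" where
  "proj H L v = (THE h. h \<in> H \<and> v - h \<in> L)"

text \<open>
  Pullback along \<open>A\<^sup>1 \<times> V \<rightarrow> A\<^sup>1 \<times> V\<close>, \<open>(t, h + l) \<mapsto> (t, h + t l)\<close>; here \<open>t\<close> is
  \<^term>\<open>var None\<close>.
\<close>

definition scaling_pullback ::
  "('k::field \<Rightarrow> 'v::ab_group_add \<Rightarrow> 'v) \<Rightarrow> 'v set \<Rightarrow> 'v set \<Rightarrow> 'v set \<Rightarrow>
   ('v option, 'k) mpoly \<Rightarrow> ('v option, 'k) mpoly" where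
  "scaling_pullback scale B H L =
     mpoly_subst (\<lambda>x. case x of
        None \<Rightarrow> var None
      | Some b \<Rightarrow>
          lift (lin_form B (\<lambda>v. module.representation scale B (proj H L v) b)) +
          var None * lift (lin_form B (\<lambda>v. module.representation scale B (proj L H v) b)))"

text \<open>
  The closure in \<open>A\<^sup>1 \<times> V\<close> of the family with fibre \<open>t \<cdot> X\<close> over \<open>t \<noteq> 0\<close>, that is, of the image
  of \<open>(A\<^sup>1 - {0}) \<times> X\<close> under \<open>(t, x) \<mapsto> (t, t \<cdot> x)\<close>. The factor \<open>t\<^sup>N\<close> expresses vanishing after
  inverting \<open>t\<close>.
\<close>

definition family_ideal ::
  "('k::field \<Rightarrow> 'v::ab_group_add \<Rightarrow> 'v) \<Rightarrow> 'v set \<Rightarrow> 'v set \<Rightarrow> 'v set \<Rightarrow>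
   ('v, 'k) mpoly set \<Rightarrow> ('v option, 'k) mpoly set" where
  "family_ideal scale B H L I =
     {F \<in> carrier (poly_ring (ext_vars B)).
        \<exists>N. var None ^ N * scaling_pullback scale B H L F
              \<in> genideal (poly_ring (ext_vars B)) (lift ` I)}"

text \<open>The flat limit is the fibre of this closure at \<open>t = 0\<close>.\<close>

definition flat_limit_ideal ::
  "('k::field \<Rightarrow> 'v::ab_group_add \<Rightarrow> 'v) \<Rightarrow> 'v set \<Rightarrow> 'v set \<Rightarrow> 'v set \<Rightarrow>
   ('v, 'k) mpoly set \<Rightarrow> ('v, 'k) mpoly set" where
  "flat_limit_ideal scale B H L I =
     mpoly_subst (case_option 0 var) ` family_ideal scale B H L I"


section \<open>Products inside \<open>V = H \<times> L\<close>\<close>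

text \<open>
  For an ideal \<open>J\<close> of \<open>k[V/L] = k[H]\<close> with closed subscheme \<open>Z\<close>: the ideals of \<open>Z \<times> L\<close> (the
  inverse image of \<open>Z\<close> in \<open>V\<close>, independent of \<open>H\<close>) and of \<open>Z \<times> {0}\<close>.
\<close>

definition times_L_ideal :: "'v set \<Rightarrow> ('v, 'k::field) mpoly set \<Rightarrow> ('v, 'k) mpoly set" where
  "times_L_ideal B J = genideal (poly_ring B) J"

definition times_zero_ideal ::
  "('k::field \<Rightarrow> 'v::ab_group_add \<Rightarrow> 'v) \<Rightarrow> 'v set \<Rightarrow> 'v set \<Rightarrow>
   ('v, 'k) mpoly set \<Rightarrow> ('v, 'k) mpoly set" where
  "times_zero_ideal scale B H J = genideal (poly_ring B) (J \<union> annihilator_forms scale B H)"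

text \<open>The scheme-theoretic union of \<open>\<Pi> \<times> {0}\<close> and \<open>\<Lambda> \<times> L\<close>.\<close>

definition union_ideal ::
  "('k::field \<Rightarrow> 'v::ab_group_add \<Rightarrow> 'v) \<Rightarrow> 'v set \<Rightarrow> 'v set \<Rightarrow> 'v set \<Rightarrow>
   ('v, 'k) mpoly set \<Rightarrow> ('v, 'k) mpoly set" where
  "union_ideal scale B H L I =
     times_zero_ideal scale B H (Pi_ideal scale B L I) \<inter>
     times_L_ideal B (Lambda_ideal scale B L I)"

end

(*
  Let y be a linear form that does not vanish on L, so that k[V] = k[V/L][y], and let J_c be the
  ideal of k[V/L] formed by the coefficients of y^c in those elements of I whose degree in y is at
  most c. These ideals increase with c. Scaling L multiplies y by t, and the flat limit is
  the sum of the J_c y^c. Moreover J_0 is the ideal of Pi, and the union of the J_c is the ideal of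
  Lambda: in the Rees algebra, a bihomogeneous element of bidegree (e, d) of the ideal of the
  exceptional divisor has degree less than e - d in y, so working modulo that ideal isolates the leading
  coefficient. The ideal of the union in (a) is therefore J_0 plus the sum over c > 0 of (union of
  all J_m) y^c. It contains the flat limit, and if f is in J_m with m > 0 then (f y)^m is in the flat limit,
  whence (b) and the first half of (d). Filtering I by the degree in y gives
  h_X = sum_c s^c h(k[V/L]/J_c); comparison of J_c with J_0 and with the union gives (c).
*)
theory Submission
  imports Defs "HOL-Computational_Algebra.Polynomial"
begin

section \<open>Evaluation homomorphisms\<close>

text \<open>The ring k[V/L] is no type of its own but a subset \<open>R\<close> of k[V]. So the
  expansion in powers of y is a homomorphism \<open>\<tau>\<close> with coefficients in k[V], and a
  separate argument places these coefficients in \<open>R\<close>. The flat limit, the ideals of the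
  two products and the ideal of the union are all brought to the form \<open>layered K\<close>, the
  direct sum of the K_i y^i, and are compared layer by layer. For a given complement H, y is the
  linear form with kernel H; for (c) it may be any form that does not vanish on L. The obstacle is
  Lambda, which is defined in a localization of a bigraded algebra. A single bidegree carries all
  the information, and setting z = T = 1 in it leads back to k[V]. Membership in the ideal of the
  exceptional divisor does not survive this, but a bound on the degree in y does, and that is enough
  for leading coefficients. The multipliers in (c) come from the series of Z \<times> L, which is
  that of Z divided by 1 - s: the Pi term is the layer c = 0, and s times the series of Lambda
  \<times> L collects s^c times the series of Lambda over all c > 0.\<close>

locale unital_hom =
  fixes f :: "'a::comm_ring_1 \<Rightarrow> 'b::comm_ring_1"
  assumes hom_one: "f 1 = 1"
    and hom_add: "f (a + b) = f a + f b"
    and hom_mult: "f (a * b) = f a * f b"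
begin

lemma hom_zero: "f 0 = 0"
  using hom_add[of 0 0] by simp

lemma hom_uminus: "f (- a) = - f a"
  using hom_add[of a "- a"] hom_zero by (simp add: eq_neg_iff_add_eq_0 add.commute)

lemma hom_diff: "f (a - b) = f a - f b"
  using hom_add[of a "- b"] hom_uminus by simp

lemma hom_sum: "f (\<Sum>i\<in>A. g i) = (\<Sum>i\<in>A. f (g i))"
  by (induction A rule: infinite_finite_induct) (simp_all add: hom_zero hom_add)

lemma hom_prod: "f (\<Prod>i\<in>A. g i) = (\<Prod>i\<in>A. f (g i))"
  by (induction A rule: infinite_finite_induct) (simp_all add: hom_one hom_mult)

lemma hom_power: "f (a ^ n) = f a ^ n"
  by (induction n) (simp_all add: hom_one hom_mult)

lemmas hom_simps = hom_zero hom_one hom_add hom_mult hom_uminus hom_diff hom_sum hom_prod hom_power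

end

lemma unital_hom_comp: "unital_hom f \<Longrightarrow> unital_hom g \<Longrightarrow> unital_hom (\<lambda>x. f (g x))"
  by (simp add: unital_hom_def)

text \<open>The map on constants is a parameter so that the target may be a ring of univariate
  polynomials over polynomials. Gradings, the expansion in y and the expansion in an extra
  indeterminate are all evaluations of this kind.\<close>

definition mpoly_eval ::
  "('k \<Rightarrow> 'r) \<Rightarrow> ('x \<Rightarrow> 'r) \<Rightarrow> ('x, 'k::comm_ring_1) mpoly \<Rightarrow> 'r::comm_ring_1" where
  "mpoly_eval \<kappa> \<sigma> p = (\<Sum>m \<in> Poly_Mapping.keys p. \<kappa> (Poly_Mapping.lookup p m) *
        (\<Prod>x \<in> Poly_Mapping.keys m. \<sigma> x ^ Poly_Mapping.lookup m x))"

lemma mpoly_subst_eval: "mpoly_subst \<sigma> = mpoly_eval const \<sigma>"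
  by (simp add: fun_eq_iff mpoly_subst_def mpoly_eval_def)

lemma prod_keys_superset:
  assumes "finite A" "Poly_Mapping.keys m \<subseteq> A"
  shows "(\<Prod>x \<in> Poly_Mapping.keys m. (\<sigma> x :: 'r::comm_monoid_mult) ^ Poly_Mapping.lookup m x) =
    (\<Prod>x \<in> A. \<sigma> x ^ Poly_Mapping.lookup m x)"
  using assms by (intro prod.mono_neutral_left) (auto simp: in_keys_iff)

lemma prod_keys_add:
  "(\<Prod>x \<in> Poly_Mapping.keys (m + n). (\<sigma> x :: 'r::comm_monoid_mult) ^ Poly_Mapping.lookup (m + n) x) =
   (\<Prod>x \<in> Poly_Mapping.keys m. \<sigma> x ^ Poly_Mapping.lookup m x) *
   (\<Prod>x \<in> Poly_Mapping.keys n. \<sigma> x ^ Poly_Mapping.lookup n x)"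
proof -
  let ?A = "Poly_Mapping.keys m \<union> Poly_Mapping.keys n"
  have "Poly_Mapping.keys (m + n) \<subseteq> ?A" by (rule keys_add)
  then show ?thesis
    by (subst (1 2 3) prod_keys_superset[of ?A])
      (auto simp: lookup_add power_add prod.distrib)
qed

lemma mpoly_sum_monomials:
  "p = (\<Sum>m \<in> Poly_Mapping.keys p. Poly_Mapping.single m (Poly_Mapping.lookup p m))"
proof (rule poly_mapping_eqI)
  fix k
  show "Poly_Mapping.lookup p k = Poly_Mapping.lookup
    (\<Sum>m \<in> Poly_Mapping.keys p. Poly_Mapping.single m (Poly_Mapping.lookup p m)) k"
    by (cases "k \<in> Poly_Mapping.keys p")
      (auto simp: lookup_sum lookup_single when_def in_keys_iff)
qed

text \<open>Both sides of the product rule are biadditive, so they need only be compared on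
  monomials, where exponents add.\<close>

lemma mpoly_eval_unital_hom:
  fixes \<sigma> :: "'x \<Rightarrow> 'r::comm_ring_1" and \<kappa> :: "'k::comm_ring_1 \<Rightarrow> 'r"
  assumes "unital_hom \<kappa>"
  shows "unital_hom (mpoly_eval \<kappa> \<sigma>)"
proof -
  interpret \<kappa>: unital_hom \<kappa> by fact
  let ?M = "\<lambda>m. \<Prod>x \<in> Poly_Mapping.keys m. \<sigma> x ^ Poly_Mapping.lookup m x"
  have super: "mpoly_eval \<kappa> \<sigma> p = (\<Sum>m \<in> A. \<kappa> (Poly_Mapping.lookup p m) * ?M m)"
    if "finite A" "Poly_Mapping.keys p \<subseteq> A" for A p
    unfolding mpoly_eval_def using that
    by (intro sum.mono_neutral_left) (auto simp: in_keys_iff \<kappa>.hom_zero)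
  have add: "mpoly_eval \<kappa> \<sigma> (p + q) = mpoly_eval \<kappa> \<sigma> p + mpoly_eval \<kappa> \<sigma> q" for p q
  proof -
    let ?A = "Poly_Mapping.keys p \<union> Poly_Mapping.keys q"
    have "Poly_Mapping.keys (p + q) \<subseteq> ?A" by (rule keys_add)
    then show ?thesis
      by (simp add: super[of ?A] lookup_add \<kappa>.hom_add distrib_right sum.distrib)
  qed
  have zero: "mpoly_eval \<kappa> \<sigma> 0 = 0" by (simp add: mpoly_eval_def)
  have sums: "mpoly_eval \<kappa> \<sigma> (\<Sum>i\<in>A. g i) = (\<Sum>i\<in>A. mpoly_eval \<kappa> \<sigma> (g i))"
    for A :: "('x \<Rightarrow>\<^sub>0 nat) set" and g
    by (induction A rule: infinite_finite_induct) (simp_all add: zero add)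
  have single: "mpoly_eval \<kappa> \<sigma> (Poly_Mapping.single m c) = \<kappa> c * ?M m" for m c
    by (subst super[of "{m}"]) auto
  have mult_single: "mpoly_eval \<kappa> \<sigma> (Poly_Mapping.single m c * Poly_Mapping.single n d) =
    mpoly_eval \<kappa> \<sigma> (Poly_Mapping.single m c) * mpoly_eval \<kappa> \<sigma> (Poly_Mapping.single n d)" for m n c d
    unfolding mult_single single prod_keys_add \<kappa>.hom_mult by (simp add: ac_simps)
  have "mpoly_eval \<kappa> \<sigma> (p * q) = mpoly_eval \<kappa> \<sigma> p * mpoly_eval \<kappa> \<sigma> q" for p q
  proof -
    let ?s = "\<lambda>p m. Poly_Mapping.single m (Poly_Mapping.lookup p m)"
    let ?P = "\<Sum>m \<in> Poly_Mapping.keys p. ?s p m" and ?Q = "\<Sum>m \<in> Poly_Mapping.keys q. ?s q m"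
    have "mpoly_eval \<kappa> \<sigma> (?P * ?Q) = mpoly_eval \<kappa> \<sigma> ?P * mpoly_eval \<kappa> \<sigma> ?Q"
      by (simp add: sum_product sums mult_single)
    then show ?thesis by (simp flip: mpoly_sum_monomials)
  qed
  moreover have "mpoly_eval \<kappa> \<sigma> 1 = 1"
    using single[of 0 1] by (simp add: \<kappa>.hom_one)
  ultimately show ?thesis using add by unfold_locales
qed

lemma mpoly_eval_const: "unital_hom \<kappa> \<Longrightarrow> mpoly_eval \<kappa> \<sigma> (const c) = \<kappa> c"
  by (cases "c = 0") (auto simp: mpoly_eval_def const_def unital_hom.hom_zero)

lemma mpoly_eval_var: "unital_hom \<kappa> \<Longrightarrow> mpoly_eval \<kappa> \<sigma> (var x :: ('x, 'k::comm_ring_1) mpoly) = \<sigma> x"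
  by (auto simp: mpoly_eval_def var_def unital_hom.hom_one)

interpretation const: unital_hom const
  by unfold_locales (simp_all add: const_def single_add mult_single)

interpretation subst: unital_hom "mpoly_subst \<sigma>" for \<sigma> :: "'x \<Rightarrow> ('y, 'k::comm_ring_1) mpoly"
  unfolding mpoly_subst_eval by (rule mpoly_eval_unital_hom) unfold_locales

lemma mpoly_subst_const [simp]: "mpoly_subst \<sigma> (const c) = const c"
  by (simp add: mpoly_subst_eval mpoly_eval_const const.unital_hom_axioms)

lemma mpoly_subst_var [simp]: "mpoly_subst \<sigma> (var x) = \<sigma> x"
  by (simp add: mpoly_subst_eval mpoly_eval_var const.unital_hom_axioms)

lemma unital_hom_pconst: "unital_hom (\<lambda>c::'a::comm_ring_1. [:c:])"
  by unfold_locales (simp_all add: one_pCons)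

lemma unital_hom_const_poly: "unital_hom (\<lambda>c. [:const c:] :: ('x, 'k::comm_ring_1) mpoly poly)"
  by (rule unital_hom_comp[OF unital_hom_pconst const.unital_hom_axioms])

lemma single_eq_prod:
  "Poly_Mapping.single m (c::'k::comm_ring_1) =
    const c * (\<Prod>x \<in> Poly_Mapping.keys m. var x ^ Poly_Mapping.lookup m x)"
proof -
  have pow: "Poly_Mapping.single (Poly_Mapping.single x n) (1::'k) = var x ^ n" for x :: 'a and n
  proof (induction n)
    case (Suc n)
    have "Poly_Mapping.single x (Suc n) = Poly_Mapping.single x 1 + Poly_Mapping.single x n"
      by (simp flip: Poly_Mapping.single_add)
    then have "Poly_Mapping.single (Poly_Mapping.single x (Suc n)) (1::'k) =
        var x * Poly_Mapping.single (Poly_Mapping.single x n) 1"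
      by (simp add: var_def mult_single)
    then show ?case by (simp add: Suc)
  qed simp
  have "Poly_Mapping.single (\<Sum>x\<in>A. Poly_Mapping.single x (Poly_Mapping.lookup m x)) (1::'k) =
    (\<Prod>x \<in> A. var x ^ Poly_Mapping.lookup m x)" if "finite A" for A
    using that
  proof (induction A rule: finite_induct)
    case (insert a A)
    have "Poly_Mapping.single (u + v) (1::'k) = Poly_Mapping.single u 1 * Poly_Mapping.single v 1"
      for u v :: "'a \<Rightarrow>\<^sub>0 nat" by (simp add: mult_single)
    with insert show ?case by (simp add: pow)
  qed simp
  from this[OF finite_keys[of m]] have "Poly_Mapping.single m 1 =
     (\<Prod>x \<in> Poly_Mapping.keys m. var x ^ Poly_Mapping.lookup m x :: ('a, 'k) mpoly)"
    by (simp flip: mpoly_sum_monomials)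
  moreover have "Poly_Mapping.single m c = const c * Poly_Mapping.single m 1"
    by (simp add: const_def mult_single)
  ultimately show ?thesis by simp
qed

section \<open>Occurring indeterminates and induction over a polynomial ring\<close>

lemma indets_const: "indets (const c) = {}"
  by (auto simp: indets_def const_def)

lemma indets_var: "indets (var x) \<subseteq> {x}"
  by (auto simp: indets_def var_def split: if_splits)

lemma indets_add: "indets (p + q) \<subseteq> indets p \<union> indets q"
  using keys_add[of p q] by (auto simp: indets_def)

lemma indets_mult: "indets (p * q) \<subseteq> indets p \<union> indets q"
proof -
  have "Poly_Mapping.keys (a + b) \<subseteq> indets p \<union> indets q"
    if "a \<in> Poly_Mapping.keys p" "b \<in> Poly_Mapping.keys q" for a b
    using that keys_add[of a b] by (auto simp: indets_def)
  then show ?thesis using keys_mult[of p q] by (fastforce simp: indets_def)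
qed

text \<open>A polynomial is a finite sum of products of constants and indeterminates from
  \<open>B\<close>. The bound on \<open>indets\<close> is proved jointly with \<open>P\<close>,
  because the cases for sums and products offer it as a hypothesis.\<close>

lemma mpoly_induct [consumes 1, case_names const var add mult]:
  fixes p :: "('x, 'k::comm_ring_1) mpoly"
  assumes "indets p \<subseteq> B"
    and const: "\<And>c. P (const c)"
    and var: "\<And>x. x \<in> B \<Longrightarrow> P (var x)"
    and add: "\<And>p q. indets p \<subseteq> B \<Longrightarrow> indets q \<subseteq> B \<Longrightarrow> P p \<Longrightarrow> P q \<Longrightarrow> P (p + q)"
    and mult: "\<And>p q. indets p \<subseteq> B \<Longrightarrow> indets q \<subseteq> B \<Longrightarrow> P p \<Longrightarrow> P q \<Longrightarrow> P (p * q)"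
  shows "P p"
proof -
  let ?Q = "\<lambda>p. indets p \<subseteq> B \<and> P p"
  have Qconst: "?Q (const c)" for c using const by (simp add: indets_const)
  have Qvar: "?Q (var x)" if "x \<in> B" for x using var[OF that] indets_var[of x] that by auto
  have Qadd: "?Q (p + q)" if "?Q p" "?Q q" for p q using that add indets_add[of p q] by auto
  have Qmult: "?Q (p * q)" if "?Q p" "?Q q" for p q using that mult indets_mult[of p q] by auto
  have Qpow: "?Q (p ^ n)" if "?Q p" for p n
    using that Qmult Qconst[of 1] by (induction n) (auto simp: const.hom_one)
  have Qprod: "?Q (\<Prod>x\<in>A. f x)" if "\<And>x. x \<in> A \<Longrightarrow> ?Q (f x)" for A :: "'x set" and f
    using that
  proof (induction A rule: infinite_finite_induct)
    case (insert x F)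
    then show ?case using Qmult[of "f x" "\<Prod>x\<in>F. f x"] by auto
  qed (use Qconst[of 1] in \<open>simp_all add: const.hom_one\<close>)
  have Qsum: "?Q (\<Sum>x\<in>A. f x)" if "\<And>x. x \<in> A \<Longrightarrow> ?Q (f x)" for A :: "('x \<Rightarrow>\<^sub>0 nat) set" and f
    using that
  proof (induction A rule: infinite_finite_induct)
    case (insert x F)
    then show ?case using Qadd[of "f x" "\<Sum>x\<in>F. f x"] by auto
  qed (use Qconst[of 0] in \<open>simp_all add: const.hom_zero\<close>)
  have "?Q (Poly_Mapping.single m (Poly_Mapping.lookup p m))" if "m \<in> Poly_Mapping.keys p" for m
    unfolding single_eq_prod
    using that assms(1) by (intro Qmult Qprod Qpow Qconst Qvar) (auto simp: indets_def)
  then have "?Q (\<Sum>m \<in> Poly_Mapping.keys p. Poly_Mapping.single m (Poly_Mapping.lookup p m))"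
    by (rule Qsum)
  then show ?thesis by (simp flip: mpoly_sum_monomials)
qed

section \<open>Gradings\<close>

text \<open>The substitution of x s^(w x) for x, with s the variable of \<open>poly\<close>. As a
  ring homomorphism it turns statements about degrees into statements about coefficients of
  s.\<close>

definition grade_poly ::
  "('x \<Rightarrow> nat) \<Rightarrow> ('x, 'k::comm_ring_1) mpoly \<Rightarrow> ('x, 'k) mpoly poly" where
  "grade_poly w = mpoly_eval (\<lambda>c. [:const c:]) (\<lambda>x. monom (var x) (w x))"

interpretation grade: unital_hom "grade_poly w" for w :: "'x \<Rightarrow> nat"
  unfolding grade_poly_def by (rule mpoly_eval_unital_hom[OF unital_hom_const_poly])

lemma grade_poly_const [simp]: "grade_poly w (const c) = [:const c:]"
  by (simp add: grade_poly_def mpoly_eval_const[OF unital_hom_const_poly])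

lemma grade_poly_var [simp]: "grade_poly w (var x) = monom (var x) (w x)"
  by (simp add: grade_poly_def mpoly_eval_var[OF unital_hom_const_poly])

lemma coeff_grade_poly: "coeff (grade_poly w p) d = graded_part w d p"
proof -
  have monom_prod: "(\<Prod>x\<in>A. monom (a x) (e x)) = monom (\<Prod>x\<in>A. a x) (\<Sum>x\<in>A. e x)"
    for A :: "'a set" and a :: "'a \<Rightarrow> ('a, 'b) mpoly" and e
    by (induction A rule: infinite_finite_induct) (simp_all add: mult_monom monom_0 one_pCons)
  have "grade_poly w p =
      (\<Sum>m \<in> Poly_Mapping.keys p. monom (Poly_Mapping.single m (Poly_Mapping.lookup p m)) (weight w m))"
    by (simp add: grade_poly_def mpoly_eval_def single_eq_prod monom_power monom_prod weight_def smult_monom)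
  then show ?thesis
    by (simp add: coeff_sum graded_part_def sum.inter_filter)
qed

lemma lookup_graded_part:
  "Poly_Mapping.lookup (graded_part w d p) m = (if weight w m = d then Poly_Mapping.lookup p m else 0)"
  by (auto simp: graded_part_def lookup_sum lookup_single when_def in_keys_iff)

lemma indets_graded_part: "indets (graded_part w d p) \<subseteq> indets p"
  by (auto simp: indets_def in_keys_iff lookup_graded_part split: if_splits)

lemma graded_part_graded_part:
  "graded_part w d (graded_part w e p) = (if d = e then graded_part w e p else 0)"
  by (rule poly_mapping_eqI) (simp add: lookup_graded_part)

lemma graded_part_zero [simp]: "graded_part w d 0 = 0"
  by (simp add: graded_part_def)

lemma graded_part_add: "graded_part w d (p + q) = graded_part w d p + graded_part w d q"
  by (simp add: grade.hom_add flip: coeff_grade_poly)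

lemma graded_part_uminus: "graded_part w d (- p) = - graded_part w d p"
  by (simp add: grade.hom_uminus flip: coeff_grade_poly)

lemma graded_part_sum: "graded_part w d (\<Sum>i\<in>A. f i) = (\<Sum>i\<in>A. graded_part w d (f i))"
  by (simp add: grade.hom_sum coeff_sum flip: coeff_grade_poly)

lemma graded_part_mult:
  "graded_part w d (p * q) = (\<Sum>i\<le>d. graded_part w i p * graded_part w (d - i) q)"
  by (simp add: grade.hom_mult coeff_mult flip: coeff_grade_poly)

text \<open>Put s = 1 in \<open>grade_poly w p\<close>: this gives the sum of the coefficients and,
  checked on generators, \<open>p\<close> itself.\<close>

lemma sum_graded_parts:
  assumes "\<And>d. d > n \<Longrightarrow> graded_part w d p = 0"
  shows "(\<Sum>d\<le>n. graded_part w d p) = p"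
proof -
  have "unital_hom (\<lambda>p. poly (grade_poly w p) 1)"
    by unfold_locales (simp_all add: grade.hom_simps)
  then interpret h: unital_hom "\<lambda>p. poly (grade_poly w p) 1" .
  have "poly (grade_poly w p) 1 = p" 
    using subset_UNIV[of "indets p"]
    by (induction p rule: mpoly_induct) (simp_all add: poly_monom h.hom_add h.hom_mult)
  moreover have "degree (grade_poly w p) \<le> n"
    using assms by (intro degree_le) (simp add: coeff_grade_poly)
  then have "(\<Sum>d\<le>degree (grade_poly w p). graded_part w d p) = (\<Sum>d\<le>n. graded_part w d p)"
    by (intro sum.mono_neutral_left) (auto simp: coeff_eq_0 simp flip: coeff_grade_poly)
  ultimately show ?thesis
    by (simp add: poly_altdef coeff_grade_poly)
qed

lemma graded_parts_eventually_zero: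
  obtains n where "\<And>d. d > n \<Longrightarrow> graded_part w d p = 0"
  using coeff_eq_0[of "grade_poly w p"] by (auto simp: coeff_grade_poly)

text \<open>Homogeneity as one equation between univariate polynomials, so that products reduce to
  multiplying monomials in s. The zero polynomial has every degree.\<close>

definition graded :: "('x \<Rightarrow> nat) \<Rightarrow> nat \<Rightarrow> ('x, 'k::comm_ring_1) mpoly \<Rightarrow> bool" where
  "graded w d p \<longleftrightarrow> grade_poly w p = monom p d"

lemma graded_part_of_graded:
  assumes "graded w d p"
  shows "graded_part w e p = (if e = d then p else 0)"
proof -
  have "graded_part w e p = coeff (grade_poly w p) e" by (simp only: coeff_grade_poly)
  also have "grade_poly w p = monom p d" using assms by (simp only: graded_def)
  finally show ?thesis by auto
qed

lemma graded_iff: "graded w d p \<longleftrightarrow> graded_part w d p = p"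
proof
  assume "graded w d p"
  from graded_part_of_graded[OF this, of d] show "graded_part w d p = p" by simp
next
  assume p: "graded_part w d p = p"
  have *: "graded_part w e p = (if d = e then p else 0)" for e
    using graded_part_graded_part[of w e d p] unfolding p by (cases "e = d") simp_all
  show "graded w d p"
    unfolding graded_def by (rule poly_eqI) (simp only: coeff_grade_poly coeff_monom *)
qed

lemma graded_graded_part: "graded w d (graded_part w d p)"
  by (simp add: graded_iff graded_part_graded_part)

lemma graded_mult: "graded w d p \<Longrightarrow> graded w e q \<Longrightarrow> graded w (d + e) (p * q)"
  by (simp add: graded_def grade.hom_mult mult_monom)

lemma graded_sum: "(\<And>i. i \<in> A \<Longrightarrow> graded w d (f i)) \<Longrightarrow> graded w d (\<Sum>i\<in>A. f i)"
  by (simp add: graded_iff graded_part_sum)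

lemma graded_const: "graded w 0 (const c)"
  by (simp add: graded_def monom_0)

lemma graded_one: "graded w 0 1"
  using graded_const[of w 1] by (simp add: const.hom_one)

lemma graded_var: "graded w (w x) (var x)"
  by (simp add: graded_def)

lemma graded_power: "graded w d p \<Longrightarrow> graded w (d * n) (p ^ n)"
  by (induction n) (simp_all add: graded_one graded_mult)

text \<open>In the convolution formula only the summand matching the degree of \<open>q\<close>
  survives. The case distinction guards the truncated difference \<open>d - e\<close>.\<close>

lemma graded_part_mult_graded:
  assumes "graded w e q"
  shows "graded_part w d (p * q) = (if e \<le> d then graded_part w (d - e) p * q else 0)"
proof -
  have "graded_part w d (p * q) = (\<Sum>i\<le>d. graded_part w i p * (if d - i = e then q else 0))"
    by (simp add: graded_part_mult graded_part_of_graded[OF assms])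
  also have "\<dots> = (\<Sum>i\<le>d. if e \<le> d \<and> i = d - e then graded_part w i p * q else 0)"
    by (intro sum.cong) auto
  also have "\<dots> = (if e \<le> d then graded_part w (d - e) p * q else 0)"
    by (auto simp: sum.delta)
  finally show ?thesis .
qed

lemma graded_part_const_mult: "graded_part w d (const c * p) = const c * graded_part w d p"
  using graded_part_mult_graded[OF graded_const, of w d p c] by (simp add: mult.commute)


section \<open>Rings and ideals inside a commutative ring\<close>

text \<open>The polynomial rings, k[V/L] and the Rees algebra inherit their operations from the
  polynomial type and differ only in the carrier. This common shape reduces ideals, generated ideals
  and generated rings to closure properties of sets.\<close>

definition ring_on :: "'a::comm_ring_1 set \<Rightarrow> 'a ring" where
  "ring_on C = \<lparr>carrier = C, mult = (*), one = 1, zero = 0, add = (+)\<rparr>"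

definition subring_set :: "'a::comm_ring_1 set \<Rightarrow> bool" where
  "subring_set C \<longleftrightarrow> 1 \<in> C \<and> (\<forall>a \<in> C. - a \<in> C) \<and> (\<forall>a \<in> C. \<forall>b \<in> C. a + b \<in> C \<and> a * b \<in> C)"

lemma ring_on_simps [simp]:
  "carrier (ring_on C) = C" "mult (ring_on C) = (*)" "one (ring_on C) = 1"
  "zero (ring_on C) = 0" "add (ring_on C) = (+)"
  by (simp_all add: ring_on_def)

lemma subring_setD:
  assumes "subring_set C"
  shows "1 \<in> C" "0 \<in> C" "a \<in> C \<Longrightarrow> - a \<in> C" "a \<in> C \<Longrightarrow> b \<in> C \<Longrightarrow> a + b \<in> C"
    "a \<in> C \<Longrightarrow> b \<in> C \<Longrightarrow> a * b \<in> C" "a \<in> C \<Longrightarrow> b \<in> C \<Longrightarrow> a - b \<in> C"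
proof -
  show *: "1 \<in> C" "a \<in> C \<Longrightarrow> - a \<in> C" "a \<in> C \<Longrightarrow> b \<in> C \<Longrightarrow> a + b \<in> C"
    "a \<in> C \<Longrightarrow> b \<in> C \<Longrightarrow> a * b \<in> C" for a b
    using assms by (auto simp: subring_set_def)
  show "0 \<in> C" using *(3)[OF *(1) *(2)[OF *(1)]] by simp
  show "a \<in> C \<Longrightarrow> b \<in> C \<Longrightarrow> a - b \<in> C" using *(3)[OF _ *(2), of a b] by simp
qed

lemma subring_set_sum: "subring_set C \<Longrightarrow> (\<And>i. i \<in> A \<Longrightarrow> f i \<in> C) \<Longrightarrow> (\<Sum>i\<in>A. f i) \<in> C"
  by (induction A rule: infinite_finite_induct) (auto intro: subring_setD)

lemma subring_set_power: "subring_set C \<Longrightarrow> a \<in> C \<Longrightarrow> a ^ n \<in> C"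
  by (induction n) (auto intro: subring_setD)

lemma cring_ring_on: assumes "subring_set C" shows "cring (ring_on C)"
proof (rule cringI)
  show "abelian_group (ring_on C)"
  proof (rule abelian_groupI)
    fix x assume "x \<in> carrier (ring_on C)"
    then show "\<exists>y\<in>carrier (ring_on C). y \<oplus>\<^bsub>ring_on C\<^esub> x = \<zero>\<^bsub>ring_on C\<^esub>"
      using subring_setD(3)[OF assms] by (intro bexI[of _ "- x"]) auto
  qed (use subring_setD[OF assms] in auto)
  show "comm_monoid (ring_on C)"
    by (rule comm_monoidI) (use subring_setD[OF assms] in \<open>auto simp: ac_simps\<close>)
qed (auto simp: distrib_right)

lemma a_inv_ring_on: assumes "subring_set C" "a \<in> C" shows "\<ominus>\<^bsub>ring_on C\<^esub> a = - a"
proof -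
  interpret cring "ring_on C" by (rule cring_ring_on) fact
  show ?thesis
    using minus_equality[of "- a" a] assms subring_setD(3)[OF assms] by simp
qed

definition ideal_set :: "'a::comm_ring_1 set \<Rightarrow> 'a set \<Rightarrow> bool" where
  "ideal_set C I \<longleftrightarrow> I \<subseteq> C \<and> 0 \<in> I \<and> (\<forall>a \<in> I. \<forall>b \<in> I. a + b \<in> I) \<and> (\<forall>a \<in> I. \<forall>c \<in> C. c * a \<in> I)"

lemma ideal_setD:
  assumes "ideal_set C I"
  shows "I \<subseteq> C" "0 \<in> I" "a \<in> I \<Longrightarrow> a \<in> C" "a \<in> I \<Longrightarrow> b \<in> I \<Longrightarrow> a + b \<in> I"
    "a \<in> I \<Longrightarrow> c \<in> C \<Longrightarrow> c * a \<in> I" "a \<in> I \<Longrightarrow> c \<in> C \<Longrightarrow> a * c \<in> I"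
  using assms by (auto simp: ideal_set_def mult.commute)

lemma ideal_set_uminus: "ideal_set C I \<Longrightarrow> subring_set C \<Longrightarrow> a \<in> I \<Longrightarrow> - a \<in> I"
  using ideal_setD(5)[of C I a "- 1"] subring_setD[of C] by simp

lemma ideal_set_sum: "ideal_set C I \<Longrightarrow> (\<And>i. i \<in> A \<Longrightarrow> f i \<in> I) \<Longrightarrow> (\<Sum>i\<in>A. f i) \<in> I"
  by (induction A rule: infinite_finite_induct) (auto intro: ideal_setD)

lemma ideal_ring_on: assumes "subring_set C" shows "ideal I (ring_on C) \<longleftrightarrow> ideal_set C I"
proof
  assume "ideal I (ring_on C)"
  then interpret ideal I "ring_on C" .
  show "ideal_set C I"
    using a_subset additive_subgroup.zero_closed[OF additive_subgroup_axioms]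
      additive_subgroup.a_closed[OF additive_subgroup_axioms] I_l_closed
    by (auto simp: ideal_set_def)
next
  assume I: "ideal_set C I"
  interpret cring "ring_on C" by (rule cring_ring_on) fact
  have "subgroup I (add_monoid (ring_on C))"
  proof (rule add.subgroupI)
    fix a assume "a \<in> I"
    then show "\<ominus>\<^bsub>ring_on C\<^esub> a \<in> I"
      using ideal_set_uminus[OF I assms] ideal_setD[OF I] a_inv_ring_on[OF assms, of a]
      by simp
  qed (use ideal_setD[OF I] in auto)
  then show "ideal I (ring_on C)"
    by (rule idealI[OF ring_axioms]) (use ideal_setD[OF I] in auto)
qed

lemma genideal_ring_on:
  assumes "subring_set C" "S \<subseteq> C"
  shows "S \<subseteq> genideal (ring_on C) S" "ideal_set C (genideal (ring_on C) S)"
    "\<And>J. ideal_set C J \<Longrightarrow> S \<subseteq> J \<Longrightarrow> genideal (ring_on C) S \<subseteq> J"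
proof -
  interpret cring "ring_on C" by (rule cring_ring_on) fact
  show "S \<subseteq> genideal (ring_on C) S" "ideal_set C (genideal (ring_on C) S)"
    "\<And>J. ideal_set C J \<Longrightarrow> S \<subseteq> J \<Longrightarrow> genideal (ring_on C) S \<subseteq> J"
    using genideal_self[of S] genideal_ideal[of S] genideal_minimal[of _ S] assms
    by (simp_all add: ideal_ring_on)
qed

lemma generate_ring_on:
  assumes C: "subring_set C" and "H \<subseteq> C"
  shows "H \<subseteq> generate_ring (ring_on C) H" "subring_set (generate_ring (ring_on C) H)"
    "generate_ring (ring_on C) H \<subseteq> C"
    "\<And>D. subring_set D \<Longrightarrow> H \<subseteq> D \<Longrightarrow> generate_ring (ring_on C) H \<subseteq> D"
proof -
  interpret cring "ring_on C" by (rule cring_ring_on) fact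
  show 1: "generate_ring (ring_on C) H \<subseteq> C"
    using generate_ring_incl[of H] assms by simp
  show "H \<subseteq> generate_ring (ring_on C) H" by (auto intro: generate_ring.incl)
  have "- a \<in> generate_ring (ring_on C) H" if "a \<in> generate_ring (ring_on C) H" for a
    using generate_ring.a_inv[OF that] a_inv_ring_on[OF C, of a] 1 that by auto
  then show "subring_set (generate_ring (ring_on C) H)"
    using generate_ring.one[of "ring_on C" H] generate_ring.eng_add[of _ "ring_on C" H]
      generate_ring.eng_mult[of _ "ring_on C" H]
    by (simp add: subring_set_def)
  show "generate_ring (ring_on C) H \<subseteq> D" if D: "subring_set D" "H \<subseteq> D" for D
  proof
    fix h assume "h \<in> generate_ring (ring_on C) H"
    then show "h \<in> D"
    proof induction
      case (a_inv h)
      then show ?case using a_inv_ring_on[OF C, of h] 1 subring_setD[OF D(1)] by auto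
    qed (use D subring_setD[OF D(1)] in auto)
  qed
qed

section \<open>Polynomials in the indeterminates of a set, as a subring of the type\<close>

definition mpolys :: "'x set \<Rightarrow> ('x, 'k::comm_ring_1) mpoly set" where
  "mpolys B = {p. indets p \<subseteq> B}"

lemma poly_ring_eq: "poly_ring B = ring_on (mpolys B)"
  by (simp add: poly_ring_def ring_on_def mpolys_def)

lemma poly_ring_restrict_eq: "(poly_ring B)\<lparr>carrier := C\<rparr> = ring_on C"
  by (simp add: poly_ring_def ring_on_def)

lemma mpolys_const: "const c \<in> mpolys B"
  by (simp add: mpolys_def indets_const)

lemma mpolys_var: "x \<in> B \<Longrightarrow> var x \<in> mpolys B"
  using indets_var[of x] by (auto simp: mpolys_def)

lemma subring_mpolys: "subring_set (mpolys B)"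
proof -
  have add: "p + q \<in> mpolys B" and mult: "p * q \<in> mpolys B" if "p \<in> mpolys B" "q \<in> mpolys B" 
    for p q :: "('a, 'b) mpoly"
    using that indets_add[of p q] indets_mult[of p q] by (auto simp: mpolys_def)
  have "- p \<in> mpolys B" if "p \<in> mpolys B" for p :: "('a, 'b) mpoly"
    using that by (auto simp: mpolys_def indets_def in_keys_iff)
  with add mult show ?thesis
    using mpolys_const[of 1 B] by (auto simp: subring_set_def const.hom_one)
qed

lemma graded_part_mpolys: "p \<in> mpolys B \<Longrightarrow> graded_part w d p \<in> mpolys B"
  using indets_graded_part[of w d p] by (auto simp: mpolys_def)

lemma mpolys_minimal:
  assumes "subring_set D" "\<And>c. const c \<in> D" "\<And>x. x \<in> B \<Longrightarrow> var x \<in> D"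
  shows "mpolys B \<subseteq> (D :: ('x, 'k::comm_ring_1) mpoly set)"
proof
  fix p :: "('x, 'k) mpoly" assume "p \<in> mpolys B"
  then have "indets p \<subseteq> B" by (simp add: mpolys_def)
  then show "p \<in> D"
    by (induction p rule: mpoly_induct) (use assms subring_setD[OF assms(1)] in auto)
qed

text \<open>Equality on constants and indeterminates propagates through sums and products. Nearly
  every identity between substitutions, gradings and expansions below is checked in this
  way.\<close>

lemma unital_hom_eq_on:
  assumes "unital_hom f" "unital_hom g" "p \<in> mpolys B"
    and "\<And>c. f (const c) = g (const c)" "\<And>x. x \<in> B \<Longrightarrow> f (var x) = g (var x)"
  shows "f p = g (p :: ('x, 'k::comm_ring_1) mpoly)"
proof -
  interpret f: unital_hom f by fact
  interpret g: unital_hom g by fact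
  have "indets p \<subseteq> B" using assms(3) by (simp add: mpolys_def)
  then show ?thesis
    by (induction p rule: mpoly_induct) (simp_all add: assms(4,5) f.hom_simps g.hom_simps)
qed

lemma subring_set_vimage: "unital_hom f \<Longrightarrow> subring_set D \<Longrightarrow> subring_set {p. f p \<in> D}"
  by (auto simp: subring_set_def unital_hom.hom_one unital_hom.hom_add unital_hom.hom_mult 
      unital_hom.hom_uminus)

lemma unital_hom_mpolys:
  assumes "unital_hom f" "subring_set D" "p \<in> mpolys B"
    and "\<And>c. f (const c) \<in> D" "\<And>x. x \<in> B \<Longrightarrow> f (var x) \<in> D"
  shows "f (p :: ('x, 'k::comm_ring_1) mpoly) \<in> D"
  using mpolys_minimal[OF subring_set_vimage[OF assms(1,2)], of B] assms(3-) by blast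

text \<open>This confines the coefficients of an expansion to a smaller ring than the type provides:
  the generators are tested, and the subring property does the rest.\<close>

lemma subring_coeffs:
  assumes "subring_set C" shows "subring_set {q. \<forall>i. coeff q i \<in> C}"
  using subring_setD[OF assms]
  by (auto simp: subring_set_def coeff_mult coeff_1 intro!: subring_set_sum[OF assms])

declare One_nat_def [simp del]

section \<open>Coordinates adapted to a line\<close>

text \<open>The normalization \<open>\<phi> l = 1\<close> makes v - \<phi>(v) l the projection to
  the kernel of \<phi> along L; it also forces \<open>l\<close> to be nonzero.\<close>

locale split_line =
  fixes scale :: "'k::field \<Rightarrow> 'v::ab_group_add \<Rightarrow> 'v"
    and B L :: "'v set" and l :: 'v and \<phi> :: "'v \<Rightarrow> 'k"
  assumes V: "finite_dimensional_vector_space scale B"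
    and L: "L = range (\<lambda>c. scale c l)"
    and \<phi>: "Vector_Spaces.linear scale (*) \<phi>" and \<phi>_l: "\<phi> l = 1"
begin

sublocale V: finite_dimensional_vector_space scale B by (rule V)

abbreviation "linear_functional \<equiv> Vector_Spaces.linear scale ((*) :: 'k \<Rightarrow> 'k \<Rightarrow> 'k)"

lemma vector_space_scalars: "vector_space ((*) :: 'k \<Rightarrow> 'k \<Rightarrow> 'k)"
  by unfold_locales (simp_all add: algebra_simps)

lemma linear_functional_iff:
  "linear_functional \<psi> \<longleftrightarrow> (\<forall>v w. \<psi> (v + w) = \<psi> v + \<psi> w) \<and> (\<forall>c v. \<psi> (scale c v) = c * \<psi> v)"
  unfolding Vector_Spaces.linear_iff using V.vector_space_axioms vector_space_scalars by blast

lemma rep_basis: "b \<in> B \<Longrightarrow> V.representation B b b' = (if b' = b then 1 else 0)"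
  using V.representation_basis[OF V.independent_Basis, of b] by auto

lemma linear_functional_expand:
  assumes "linear_functional \<psi>"
  shows "\<psi> v = (\<Sum>b\<in>B. V.representation B v b * \<psi> b)"
proof -
  interpret \<psi>: Vector_Spaces.linear scale "(*)" \<psi> by fact
  have "v = (\<Sum>b\<in>B. scale (V.representation B v b) b)"
    by (rule V.sum_representation_eq[symmetric])
      (simp_all add: V.independent_Basis V.span_Basis V.finite_Basis)
  then have "\<psi> v = \<psi> (\<Sum>b\<in>B. scale (V.representation B v b) b)" by simp
  then show ?thesis by (simp add: \<psi>.sum \<psi>.scale)
qed

lemma linear_rep: "linear_functional (\<lambda>v. V.representation B v b)"
  using V.representation_add[OF V.independent_Basis] V.representation_scale[OF V.independent_Basis]
  by (simp add: linear_functional_iff V.span_Basis)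

lemma lin_form_scale: "lin_form B (\<lambda>v. c * \<psi> v) = const c * lin_form B \<psi>"
  by (simp add: lin_form_def const.hom_mult sum_distrib_left mult.assoc)

lemma lin_form_diff: "lin_form B (\<lambda>v. \<psi> v - \<chi> v) = lin_form B \<psi> - lin_form B \<chi>"
  by (simp add: lin_form_def const.hom_diff left_diff_distrib sum_subtractf)

lemma lin_form_rep: "b \<in> B \<Longrightarrow> lin_form B (\<lambda>v. V.representation B v b) = var b"
proof -
  assume b: "b \<in> B"
  have "lin_form B (\<lambda>v. V.representation B v b) = (\<Sum>b'\<in>B. if b' = b then var b else 0)"
    unfolding lin_form_def by (intro sum.cong) (auto simp: rep_basis const.hom_simps)
  then show ?thesis using b V.finite_Basis by simp
qed

lemma lin_form_mpolys: "lin_form B \<psi> \<in> mpolys B"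
  unfolding lin_form_def
  by (intro subring_set_sum[OF subring_mpolys] subring_setD[OF subring_mpolys] mpolys_const mpolys_var)

lemma graded_lin_form: "graded (\<lambda>_. 1) 1 (lin_form B \<psi>)"
  unfolding lin_form_def
  using graded_mult[OF graded_const graded_var, of "\<lambda>_. 1"] by (intro graded_sum) simp

definition y :: "('v, 'k) mpoly" where "y = lin_form B \<phi>"

text \<open>The value at \<open>l\<close> of the coordinate \<open>b\<close>. Subtracting
  \<open>comp b\<close> times y from that coordinate leaves a form vanishing on L, which is the
  constant term in the definition of \<open>\<tau>\<close>.\<close>

definition comp :: "'v \<Rightarrow> 'k" where "comp b = V.representation B l b"

lemma y_mpolys: "y \<in> mpolys B"
  by (simp add: y_def lin_form_mpolys)

lemma graded_y: "graded (\<lambda>_. 1) 1 y"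
  unfolding y_def by (rule graded_lin_form)

text \<open>Rewrites a polynomial as a polynomial in \<open>y\<close> over \<open>k[V/L]\<close>.\<close>

definition \<tau> :: "('v, 'k) mpoly \<Rightarrow> ('v, 'k) mpoly poly" where
  "\<tau> = mpoly_eval (\<lambda>c. [:const c:]) (\<lambda>b. [:var b - const (comp b) * y, const (comp b):])"

sublocale \<tau>: unital_hom \<tau>
  unfolding \<tau>_def by (rule mpoly_eval_unital_hom[OF unital_hom_const_poly])

lemma \<tau>_const [simp]: "\<tau> (const c) = [:const c:]"
  by (simp add: \<tau>_def mpoly_eval_const[OF unital_hom_const_poly])

lemma \<tau>_var: "\<tau> (var b) = [:var b - const (comp b) * y, const (comp b):]"
  by (simp add: \<tau>_def mpoly_eval_var[OF unital_hom_const_poly])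

text \<open>A functional splits as (\<psi> - \<psi>(l) \<phi>) + \<psi>(l) \<phi>, and the first
  part vanishes on L.\<close>

lemma \<tau>_lin_form:
  assumes "linear_functional \<psi>"
  shows "\<tau> (lin_form B \<psi>) = [:lin_form B \<psi> - const (\<psi> l) * y, const (\<psi> l):]"
proof -
  have l: "const (\<psi> l) = (\<Sum>b\<in>B. const (\<psi> b) * const (comp b))"
    by (simp add: linear_functional_expand[OF assms, of l] comp_def const.hom_sum const.hom_mult mult.commute)
  have sum_pCons: "(\<Sum>b\<in>B. [:f b, g b:]) = [:\<Sum>b\<in>B. f b, \<Sum>b\<in>B. g b:]" for f g :: "'v \<Rightarrow> ('v, 'k) mpoly"
    by (induction B rule: infinite_finite_induct) auto
  have "\<tau> (lin_form B \<psi>) =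
      (\<Sum>b\<in>B. [:const (\<psi> b) * var b - const (\<psi> b) * const (comp b) * y, const (\<psi> b) * const (comp b):])"
    unfolding lin_form_def by (simp add: \<tau>.hom_simps \<tau>_var algebra_simps)
  also have "\<dots> = [:lin_form B \<psi> - const (\<psi> l) * y, const (\<psi> l):]"
    unfolding sum_pCons l by (simp add: lin_form_def sum_subtractf sum_distrib_right)
  finally show ?thesis .
qed

lemma \<tau>_y: "\<tau> y = [:0, 1:]"
  using \<tau>_lin_form[OF \<phi>] by (simp add: \<phi>_l const.hom_one flip: y_def)

text \<open>Substituting y for the variable undoes \<open>\<tau>\<close>, as is seen on generators;
  hence \<open>\<tau>\<close> is injective.\<close>

lemma poly_\<tau>_y: "poly (\<tau> p) y = p"
proof -
  have 1: "unital_hom (\<lambda>p. poly (\<tau> p) y)" by unfold_locales (simp_all add: \<tau>.hom_simps)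
  have 2: "unital_hom (\<lambda>p :: ('v, 'k) mpoly. p)" by unfold_locales auto
  show ?thesis
    by (rule unital_hom_eq_on[OF 1 2, where B = UNIV]) (auto simp: mpolys_def \<tau>_var mult.commute)
qed

section \<open>The subring k[V/L] and expansion in powers of y over it\<close>

definition R :: "('v, 'k) mpoly set" where "R = carrier (quot_coord_ring scale B L)"

lemma annihilator_L:
  "annihilator_forms scale B L = {lin_form B \<psi> | \<psi>. linear_functional \<psi> \<and> \<psi> l = 0}"
proof -
  have "(\<forall>v\<in>L. \<psi> v = 0) \<longleftrightarrow> \<psi> l = 0" if "linear_functional \<psi>" for \<psi>
  proof -
    have "l \<in> L" unfolding L by (rule range_eqI[of _ _ 1]) simp
    then show ?thesis using that unfolding linear_functional_iff by (auto simp: L)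
  qed
  then show ?thesis unfolding annihilator_forms_def by blast
qed

lemma R_eq: "R = generate_ring (ring_on (mpolys B)) (range const \<union> annihilator_forms scale B L)"
  by (simp add: R_def quot_coord_ring_def poly_ring_eq)

lemma R_generators: "range const \<union> annihilator_forms scale B L \<subseteq> mpolys B"
  by (auto simp: annihilator_L mpolys_const lin_form_mpolys)

lemma R_subring: "subring_set R" and R_mpolys: "R \<subseteq> mpolys B"
  and R_const: "const c \<in> R"
  and R_ann: "annihilator_forms scale B L \<subseteq> R"
  using generate_ring_on[OF subring_mpolys R_generators] by (auto simp: R_eq)

lemma R_minimal:
  assumes "subring_set D" "\<And>c. const c \<in> D"
    "\<And>\<psi>. linear_functional \<psi> \<Longrightarrow> \<psi> l = 0 \<Longrightarrow> lin_form B \<psi> \<in> D"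
  shows "R \<subseteq> D"
  unfolding R_eq using assms
  by (intro generate_ring_on(4)[OF subring_mpolys R_generators]) (auto simp: annihilator_L)

text \<open>The elements with this property form a subring that contains the constants and, by
  \<open>\<tau>_lin_form\<close>, the linear forms vanishing on L.\<close>

lemma \<tau>_R: "r \<in> R \<Longrightarrow> \<tau> r = [:r:]"
proof -
  have "R \<subseteq> {r. \<tau> r = [:r:]}"
    by (rule R_minimal)
      (auto simp: subring_set_def \<tau>.hom_simps \<tau>_lin_form const.hom_zero one_pCons)
  then show "r \<in> R \<Longrightarrow> \<tau> r = [:r:]" by blast
qed

text \<open>The generators, constants and linear forms, are homogeneous, so the subring they
  generate is graded.\<close>

lemma hom_part_R: "r \<in> R \<Longrightarrow> hom_part d r \<in> R"
proof -
  have "R \<subseteq> {r. \<forall>d. hom_part d r \<in> R}"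
  proof (rule R_minimal)
    show "subring_set {r. \<forall>d. hom_part d r \<in> R}"
      using subring_setD[OF R_subring]
      by (auto simp: subring_set_def graded_part_add graded_part_mult graded_part_uminus
        graded_part_of_graded[OF graded_one] intro!: subring_set_sum[OF R_subring])
  qed (use R_ann R_const subring_setD[OF R_subring] in
      \<open>auto simp: graded_part_of_graded[OF graded_const] graded_part_of_graded[OF graded_lin_form] annihilator_L\<close>)
  then show "r \<in> R \<Longrightarrow> hom_part d r \<in> R" by blast
qed

lemma r_in_R: "b \<in> B \<Longrightarrow> var b - const (comp b) * y \<in> R"
proof -
  assume b: "b \<in> B"
  let ?\<psi> = "\<lambda>v. V.representation B v b - comp b * \<phi> v"
  have "linear_functional ?\<psi>"
    using linear_rep[of b] \<phi> by (simp add: linear_functional_iff algebra_simps)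
  moreover have "?\<psi> l = 0" by (simp add: comp_def \<phi>_l)
  moreover have "lin_form B ?\<psi> = var b - const (comp b) * y"
    using b by (simp add: lin_form_diff lin_form_scale lin_form_rep y_def)
  ultimately have "var b - const (comp b) * y \<in> annihilator_forms scale B L"
    unfolding annihilator_L by (intro CollectI exI[of _ ?\<psi>]) auto
  then show ?thesis using R_ann by blast
qed

text \<open>With \<open>\<tau>_expand\<close> and \<open>\<tau>_R_power\<close> this yields k[V] =
  k[V/L][y]: coefficients lie in \<open>R\<close> and are unique.\<close>

lemma coeff_\<tau>_R: "p \<in> mpolys B \<Longrightarrow> coeff (\<tau> p) i \<in> R"
proof -
  assume "p \<in> mpolys B"
  then have "\<tau> p \<in> {q. \<forall>i. coeff q i \<in> R}"
    by (rule unital_hom_mpolys[OF \<tau>.unital_hom_axioms subring_coeffs[OF R_subring]])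
      (auto simp: \<tau>_var coeff_pCons R_const r_in_R subring_setD[OF R_subring] split: nat.split)
  then show ?thesis by simp
qed

lemma \<tau>_R_power: "r \<in> R \<Longrightarrow> \<tau> (r * y ^ i) = monom r i"
  by (simp add: \<tau>.hom_mult \<tau>.hom_power \<tau>_R \<tau>_y monom_altdef)

lemma \<tau>_expand: "degree (\<tau> p) \<le> n \<Longrightarrow> p = (\<Sum>i\<le>n. coeff (\<tau> p) i * y ^ i)"
proof -
  assume n: "degree (\<tau> p) \<le> n"
  have "p = (\<Sum>i\<le>degree (\<tau> p). coeff (\<tau> p) i * y ^ i)"
    using poly_\<tau>_y[of p] by (simp add: poly_altdef)
  also have "\<dots> = (\<Sum>i\<le>n. coeff (\<tau> p) i * y ^ i)"
    using n by (intro sum.mono_neutral_left) (auto simp: coeff_eq_0)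
  finally show ?thesis .
qed

lemma coeff_\<tau>_sum:
  assumes "\<And>i. i \<le> n \<Longrightarrow> r i \<in> R"
  shows "coeff (\<tau> (\<Sum>i\<le>n. r i * y ^ i)) j = (if j \<le> n then r j else 0)"
  using assms by (auto simp: \<tau>.hom_sum \<tau>_R_power coeff_sum)

lemma R_power_mpolys: "r \<in> R \<Longrightarrow> r * y ^ i \<in> mpolys B"
  using R_mpolys by (intro subring_setD[OF subring_mpolys] subring_set_power[OF subring_mpolys] y_mpolys) auto

lemma hom_part_mult_y:
  "hom_part d (p * y ^ i) = (if i \<le> d then hom_part (d - i) p * y ^ i else 0)"
  using graded_part_mult_graded[OF graded_power[OF graded_y, of i]] by simp

text \<open>y is homogeneous of degree 1, so in total degree d the factor in front of y^i has degree
  d - i, and for i > d there is none.\<close>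

lemma coeff_\<tau>_hom_part:
  assumes "p \<in> mpolys B"
  shows "coeff (\<tau> (hom_part d p)) i = (if i \<le> d then hom_part (d - i) (coeff (\<tau> p) i) else 0)"
proof -
  let ?n = "degree (\<tau> p)"
  let ?r = "\<lambda>i. if i \<le> d then hom_part (d - i) (coeff (\<tau> p) i) else 0"
  have "hom_part d p = hom_part d (\<Sum>i\<le>?n. coeff (\<tau> p) i * y ^ i)"
    using \<tau>_expand[of p ?n] by simp
  also have "\<dots> = (\<Sum>i\<le>?n. ?r i * y ^ i)"
    unfolding graded_part_sum hom_part_mult_y by (intro sum.cong) auto
  finally have "coeff (\<tau> (hom_part d p)) i = (if i \<le> ?n then ?r i else 0)"
    using coeff_\<tau>_sum[of ?n ?r i] hom_part_R coeff_\<tau>_R[OF assms] subring_setD[OF R_subring] by auto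
  then show ?thesis by (auto simp: coeff_eq_0)
qed

end

section \<open>Polynomials with an extra indeterminate\<close>

lemma unital_hom_map_poly:
  assumes "unital_hom f" shows "unital_hom (map_poly f)"
proof -
  interpret f: unital_hom f by fact
  have c: "coeff (map_poly f p) i = f (coeff p i)" for p i
    by (simp add: coeff_map_poly f.hom_zero)
  show ?thesis
    by unfold_locales (simp_all add: poly_eq_iff c coeff_1 coeff_mult f.hom_simps)
qed

lemma unital_hom_eval_map_poly:
  assumes "unital_hom f" shows "unital_hom (\<lambda>p. poly (map_poly f p) x)"
proof -
  interpret f: unital_hom "map_poly f" by (rule unital_hom_map_poly) fact
  show ?thesis by unfold_locales (simp_all add: f.hom_simps)
qed

text \<open>Identifying the outer variable with the inner one collects the coefficients along
  antidiagonals.\<close>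

lemma coeff_poly_X: "coeff (poly Q [:0, 1:]) c = (\<Sum>a\<le>c. coeff (coeff Q a) (c - a))"
  for Q :: "'a::comm_ring_1 poly poly"
proof (induction Q arbitrary: c)
  case (pCons a Q)
  show ?case
  proof (cases c)
    case (Suc d)
    then show ?thesis by (simp add: coeff_pCons pCons.IH sum.atMost_Suc_shift del: sum.atMost_Suc)
  qed (simp add: coeff_pCons)
qed simp

text \<open>The analogue of \<open>\<tau>\<close> for the extra indeterminate t: polynomials with t
  adjoined, as univariate polynomials in t.\<close>

definition \<eta> :: "('x option, 'k::comm_ring_1) mpoly \<Rightarrow> ('x, 'k) mpoly poly" where
  "\<eta> = mpoly_eval (\<lambda>c. [:const c:]) (case_option [:0, 1:] (\<lambda>b. [:var b:]))"

interpretation \<eta>: unital_hom \<eta>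
  unfolding \<eta>_def by (rule mpoly_eval_unital_hom[OF unital_hom_const_poly])

lemma \<eta>_simps [simp]: "\<eta> (const c) = [:const c:]" "\<eta> (var None) = [:0, 1:]" "\<eta> (var (Some b)) = [:var b:]"
  by (simp_all add: \<eta>_def mpoly_eval_const[OF unital_hom_const_poly] mpoly_eval_var[OF unital_hom_const_poly])

lemma mpolys_UNIV [simp]: "p \<in> mpolys UNIV"
  by (simp add: mpolys_def)

lemma \<eta>_lift [simp]: "\<eta> (lift p) = [:p:]"
proof -
  have 1: "unital_hom (\<lambda>p :: ('a, 'b) mpoly. \<eta> (lift p))"
    by (intro unital_hom_comp[OF \<eta>.unital_hom_axioms subst.unital_hom_axioms])
  show ?thesis by (rule unital_hom_eq_on[OF 1 unital_hom_pconst, where B = UNIV]) auto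
qed

lemma \<eta>_expand: "F = (\<Sum>i\<le>degree (\<eta> F). lift (coeff (\<eta> F) i) * var None ^ i)"
proof -
  have 1: "unital_hom (\<lambda>F :: ('a option, 'b) mpoly. poly (map_poly lift (\<eta> F)) (var None))"
    by (intro unital_hom_comp[OF unital_hom_eval_map_poly \<eta>.unital_hom_axioms] subst.unital_hom_axioms)
  have 2: "unital_hom (\<lambda>F :: ('a option, 'b) mpoly. F)" by unfold_locales auto
  have z: "lift (0 :: ('a, 'b) mpoly) = 0" by (rule subst.hom_zero)
  have "poly (map_poly lift (\<eta> (var x))) (var None) = (var x :: ('a option, 'b) mpoly)" for x
    by (cases x) (simp_all add: map_poly_pCons z subst.hom_one)
  then have "poly (map_poly lift (\<eta> F)) (var None) = F"
    by - (rule unital_hom_eq_on[OF 1 2, where B = UNIV], simp_all add: map_poly_pCons z)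
  moreover have "poly (map_poly lift (\<eta> F)) (var None) = 
      (\<Sum>i\<le>degree (\<eta> F). lift (coeff (\<eta> F) i) * var None ^ i)"
  proof -
    let ?q = "map_poly lift (\<eta> F)"
    have c: "coeff ?q i = lift (coeff (\<eta> F) i)" for i by (simp add: coeff_map_poly z)
    have "degree ?q \<le> degree (\<eta> F)"
      by (rule degree_le) (simp add: c coeff_eq_0 z)
    then have "(\<Sum>i\<le>degree ?q. coeff ?q i * var None ^ i) = (\<Sum>i\<le>degree (\<eta> F). coeff ?q i * var None ^ i)"
      by (intro sum.mono_neutral_left) (auto simp: coeff_eq_0)
    then show ?thesis
      unfolding poly_altdef by (simp add: c)
  qed
  ultimately show ?thesis by simp
qed

lemma lift_mpolys: "p \<in> mpolys B \<Longrightarrow> lift p \<in> mpolys (ext_vars B)"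
  by (rule unital_hom_mpolys[OF subst.unital_hom_axioms subring_mpolys])
    (auto intro: mpolys_const mpolys_var)

lemma coeff_\<eta>_mpolys: "F \<in> mpolys (ext_vars B) \<Longrightarrow> coeff (\<eta> F) i \<in> mpolys B"
proof -
  assume F: "F \<in> mpolys (ext_vars B)"
  have "\<eta> F \<in> {q. \<forall>i. coeff q i \<in> mpolys B}"
  proof (rule unital_hom_mpolys[OF \<eta>.unital_hom_axioms _ F])
    show "subring_set {q :: ('a, 'b) mpoly poly. \<forall>i. coeff q i \<in> mpolys B}"
      by (rule subring_coeffs[OF subring_mpolys])
    have *: "[:p:] \<in> {q. \<forall>i. coeff q i \<in> mpolys B}" if "p \<in> mpolys B" for p :: "('a, 'b) mpoly"
      using that subring_setD(2)[OF subring_mpolys] by (auto simp: coeff_pCons split: nat.split)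
    show "\<eta> (const c) \<in> {q. \<forall>i. coeff q i \<in> mpolys B}" for c :: 'b
      using *[OF mpolys_const] by simp
    show "\<eta> (var x) \<in> {q. \<forall>i. coeff q i \<in> mpolys B}" if "x \<in> ext_vars B" for x
      using that
      by (auto simp: coeff_pCons mpolys_var subring_setD(1,2)[OF subring_mpolys] split: nat.split)
  qed
  then show ?thesis by simp
qed

text \<open>Multiplication by t^N shifts coefficients. Thus membership of all coefficients passes
  from t^N F to F.\<close>

lemma coeff_\<eta>_power: "coeff (\<eta> (var None ^ N * F)) (N + i) = coeff (\<eta> F) i"
proof -
  have "\<eta> (var None ^ N * F) = monom 1 N * \<eta> F"
    by (simp add: \<eta>.hom_simps monom_altdef)
  then show ?thesis by (simp add: coeff_monom_mult)
qed

text \<open>The extension of I to k[V][t] is I[t]: polynomials with coefficients in I form an ideal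
  by the convolution formula, and each is a combination of its coefficients by
  \<open>\<eta>_expand\<close>.\<close>

lemma genideal_lift:
  fixes I :: "('x, 'k::comm_ring_1) mpoly set"
  assumes I: "ideal_set (mpolys B) I"
  shows "genideal (poly_ring (ext_vars B)) (lift ` I) =
    {F \<in> mpolys (ext_vars B). \<forall>i. coeff (\<eta> F) i \<in> I}" (is "?G = ?J")
proof -
  have sub: "lift ` I \<subseteq> mpolys (ext_vars B)"
    using ideal_setD(1)[OF I] lift_mpolys by blast
  note G = genideal_ring_on[OF subring_mpolys sub, folded poly_ring_eq]
  show ?thesis
  proof
    have "ideal_set (mpolys (ext_vars B)) ?J"
      unfolding ideal_set_def
    proof (intro conjI ballI)
      show "0 \<in> ?J" by (simp add: \<eta>.hom_zero subring_setD(2)[OF subring_mpolys] ideal_setD(2)[OF I])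
      show "p + q \<in> ?J" if "p \<in> ?J" "q \<in> ?J" for p q
        using that by (simp add: \<eta>.hom_add subring_setD(4)[OF subring_mpolys] ideal_setD(4)[OF I])
      show "c * p \<in> ?J" if p: "p \<in> ?J" and c: "c \<in> mpolys (ext_vars B)" for p c
      proof -
        have "(\<Sum>j\<le>i. coeff (\<eta> c) j * coeff (\<eta> p) (i - j)) \<in> I" for i
          using p coeff_\<eta>_mpolys[OF c] by (intro ideal_set_sum[OF I] ideal_setD(5)[OF I]) auto
        then show ?thesis using p c
          by (simp add: \<eta>.hom_mult coeff_mult subring_setD(5)[OF subring_mpolys])
      qed
    qed simp
    moreover have "lift ` I \<subseteq> ?J"
      using sub ideal_setD[OF I] by (auto simp: coeff_pCons split: nat.split)
    ultimately show "?G \<subseteq> ?J" by (rule G(3))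
  next
    show "?J \<subseteq> ?G"
    proof
      fix F assume F: "F \<in> ?J"
      have "(\<Sum>i\<le>degree (\<eta> F). lift (coeff (\<eta> F) i) * var None ^ i) \<in> ?G"
        using F G(1)
        by (intro ideal_set_sum[OF G(2)] ideal_setD(6)[OF G(2)] subring_set_power[OF subring_mpolys] mpolys_var) auto
      then show "F \<in> ?G" by (simp flip: \<eta>_expand)
    qed
  qed
qed

lemma subst_zero_lift: "mpoly_subst (case_option 0 var) (lift p) = p"
proof -
  have 1: "unital_hom (\<lambda>p :: ('a, 'b) mpoly. mpoly_subst (case_option 0 var) (lift p))"
    by (intro unital_hom_comp[OF subst.unital_hom_axioms subst.unital_hom_axioms])
  have 2: "unital_hom (\<lambda>p :: ('a, 'b) mpoly. p)" by unfold_locales auto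
  show ?thesis by (rule unital_hom_eq_on[OF 1 2, where B = UNIV]) auto
qed

lemma subst_zero_eq_coeff: "mpoly_subst (case_option 0 var) F = coeff (\<eta> F) 0"
proof -
  have 1: "unital_hom (\<lambda>F :: ('a option, 'b) mpoly. coeff (\<eta> F) 0)"
    by unfold_locales (simp_all add: \<eta>.hom_simps coeff_mult_0)
  have "mpoly_subst (case_option 0 var) (var x) = coeff (\<eta> (var x :: ('a option, 'b) mpoly)) 0" for x
    by (cases x) simp_all
  then show ?thesis by - (rule unital_hom_eq_on[OF subst.unital_hom_axioms 1, where B = UNIV], auto)
qed


section \<open>Leading coefficients and the flat limit\<close>

context split_line
begin

section \<open>Ideals of leading coefficients in y\<close>

lemma ideal_set_R: "ideal_set R R"
  using subring_setD[OF R_subring] by (simp add: ideal_set_def)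

text \<open>The bound \<open>\<le> c\<close> in place of equality admits elements of lower degree,
  which contribute 0; with equality, cancellation of leading terms would lead out of the
  set.\<close>

definition leading_ideal :: "('v, 'k) mpoly set \<Rightarrow> nat \<Rightarrow> ('v, 'k) mpoly set" where
  "leading_ideal I c = {coeff (\<tau> g) c | g. g \<in> I \<and> degree (\<tau> g) \<le> c}"

definition all_leading :: "('v, 'k) mpoly set \<Rightarrow> ('v, 'k) mpoly set" where
  "all_leading I = (\<Union>c. leading_ideal I c)"

lemma leading_ideal_ideal:
  assumes I: "ideal_set (mpolys B) I"
  shows "ideal_set R (leading_ideal I c)"
  unfolding ideal_set_def
proof (intro conjI ballI)
  show "leading_ideal I c \<subseteq> R"
    using ideal_setD(3)[OF I] coeff_\<tau>_R by (auto simp: leading_ideal_def)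
  show "0 \<in> leading_ideal I c"
    using ideal_setD(2)[OF I] unfolding leading_ideal_def
    by (intro CollectI exI[of _ 0]) (simp add: \<tau>.hom_zero)
next
  fix a b assume "a \<in> leading_ideal I c" "b \<in> leading_ideal I c"
  then obtain g h where "a = coeff (\<tau> g) c" "g \<in> I" "degree (\<tau> g) \<le> c"
    "b = coeff (\<tau> h) c" "h \<in> I" "degree (\<tau> h) \<le> c" by (auto simp: leading_ideal_def)
  then show "a + b \<in> leading_ideal I c"
    unfolding leading_ideal_def using ideal_setD(4)[OF I, of g h]
    by (intro CollectI exI[of _ "g + h"]) (simp add: \<tau>.hom_add degree_add_le)
next
  fix a r assume "a \<in> leading_ideal I c" and r: "r \<in> R"
  then obtain g where "a = coeff (\<tau> g) c" "g \<in> I" "degree (\<tau> g) \<le> c" by (auto simp: leading_ideal_def)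
  moreover from this have "degree (smult r (\<tau> g)) \<le> c" using degree_smult_le le_trans by blast
  ultimately show "r * a \<in> leading_ideal I c"
    unfolding leading_ideal_def using ideal_setD(5)[OF I, of g r] r R_mpolys
    by (intro CollectI exI[of _ "r * g"]) (auto simp: \<tau>.hom_mult \<tau>_R)
qed

text \<open>Multiplication by y keeps an element in I and shifts its coefficients by one
  place.\<close>

lemma leading_ideal_Suc:
  assumes I: "ideal_set (mpolys B) I"
  shows "leading_ideal I c \<subseteq> leading_ideal I (Suc c)"
proof
  fix a assume "a \<in> leading_ideal I c"
  then obtain g where "a = coeff (\<tau> g) c" "g \<in> I" "degree (\<tau> g) \<le> c" by (auto simp: leading_ideal_def)
  moreover have "\<tau> (y * g) = pCons 0 (\<tau> g)" by (simp add: \<tau>.hom_mult \<tau>_y)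
  ultimately show "a \<in> leading_ideal I (Suc c)"
    unfolding leading_ideal_def using ideal_setD(5)[OF I, of g y] y_mpolys
    by (intro CollectI exI[of _ "y * g"]) (auto simp: degree_pCons_eq_if)
qed

lemma leading_ideal_mono: 
  assumes "ideal_set (mpolys B) I" shows "c \<le> d \<Longrightarrow> leading_ideal I c \<subseteq> leading_ideal I d"
  using leading_ideal_Suc[OF assms] by (rule lift_Suc_mono_le)

lemma all_leading_ideal:
  assumes I: "ideal_set (mpolys B) I"
  shows "ideal_set R (all_leading I)"
  unfolding ideal_set_def
proof (intro conjI ballI)
  note J = ideal_setD[OF leading_ideal_ideal[OF I]]
  show "all_leading I \<subseteq> R" "0 \<in> all_leading I" using J(1,2) by (auto simp: all_leading_def)
  fix a r assume "a \<in> all_leading I" "r \<in> R"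
  then show "r * a \<in> all_leading I" using J(5) by (auto simp: all_leading_def)
next
  fix a b assume "a \<in> all_leading I" "b \<in> all_leading I"
  then obtain c d where "a \<in> leading_ideal I c" "b \<in> leading_ideal I d" by (auto simp: all_leading_def)
  then have "a \<in> leading_ideal I (max c d)" "b \<in> leading_ideal I (max c d)"
    using leading_ideal_mono[OF I, of c "max c d"] leading_ideal_mono[OF I, of d "max c d"] by auto
  then show "a + b \<in> all_leading I"
    using ideal_setD(4)[OF leading_ideal_ideal[OF I]] unfolding all_leading_def by blast
qed

text \<open>An element of k[V] of degree 0 in y is its own constant coefficient, hence lies in
  \<open>R\<close>.\<close>

lemma Pi_ideal_eq:
  assumes I: "ideal_set (mpolys B) I"
  shows "Pi_ideal scale B L I = leading_ideal I 0"
proof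
  show "Pi_ideal scale B L I \<subseteq> leading_ideal I 0"
  proof
    fix f assume "f \<in> Pi_ideal scale B L I"
    then have "f \<in> R" "f \<in> I" by (auto simp: Pi_ideal_def R_def)
    then show "f \<in> leading_ideal I 0"
      unfolding leading_ideal_def by (intro CollectI exI[of _ f]) (simp add: \<tau>_R)
  qed
  show "leading_ideal I 0 \<subseteq> Pi_ideal scale B L I"
  proof
    fix f assume "f \<in> leading_ideal I 0"
    then obtain g where g: "f = coeff (\<tau> g) 0" "g \<in> I" "degree (\<tau> g) \<le> 0" by (auto simp: leading_ideal_def)
    then have "f = g" using \<tau>_expand[of g 0] by simp
    moreover have "f \<in> R" using g coeff_\<tau>_R ideal_setD(3)[OF I] by blast
    ultimately show "f \<in> Pi_ideal scale B L I" using g by (simp add: Pi_ideal_def R_def)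
  qed
qed

text \<open>The ideal \<open>\<Oplus>\<^sub>i K\<^sub>i y\<^sup>i\<close>.\<close>

definition layered :: "(nat \<Rightarrow> ('v, 'k) mpoly set) \<Rightarrow> ('v, 'k) mpoly set" where
  "layered K = {p \<in> mpolys B. \<forall>i. coeff (\<tau> p) i \<in> K i}"

text \<open>The coefficient of y^i in a product involves coefficients from the layers i - j only,
  and monotonicity brings these into \<open>K i\<close>.\<close>

lemma layered_ideal:
  assumes K: "\<And>i. ideal_set R (K i)" and mono: "\<And>i j. i \<le> j \<Longrightarrow> K i \<subseteq> K j"
  shows "ideal_set (mpolys B) (layered K)"
  unfolding ideal_set_def
proof (intro conjI ballI)
  fix p q :: "('v, 'k) mpoly" assume p: "p \<in> layered K" and q: "q \<in> mpolys B"
  have "coeff (\<tau> q) j * coeff (\<tau> p) (i - j) \<in> K i" for i j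
    using p q mono[of "i - j" i] ideal_setD(5)[OF K] coeff_\<tau>_R by (fastforce simp: layered_def)
  then show "q * p \<in> layered K"
    using p q subring_setD[OF subring_mpolys]
    by (auto simp: layered_def \<tau>.hom_mult coeff_mult intro!: ideal_set_sum[OF K])
qed (use ideal_setD[OF K] subring_setD[OF subring_mpolys] in \<open>auto simp: layered_def \<tau>.hom_simps\<close>)

lemma layered_monom:
  assumes "\<And>i. ideal_set R (K i)" "f \<in> K i" shows "f * y ^ i \<in> layered K"
proof -
  have "f \<in> R" using ideal_setD(3)[OF assms(1)] assms(2) by blast
  then show ?thesis
    using assms ideal_setD(2)[OF assms(1)] by (auto simp: layered_def R_power_mpolys \<tau>_R_power)
qed

lemma layered_minimal:
  assumes "ideal_set (mpolys B) M" "\<And>i f. f \<in> K i \<Longrightarrow> f * y ^ i \<in> M"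
  shows "layered K \<subseteq> M"
proof
  fix p assume "p \<in> layered K"
  then have "(\<Sum>i\<le>degree (\<tau> p). coeff (\<tau> p) i * y ^ i) \<in> M"
    by (intro ideal_set_sum[OF assms(1)] assms(2)) (auto simp: layered_def)
  then show "p \<in> M" using \<tau>_expand[of p] by simp
qed

lemma times_L_ideal_eq:
  assumes K: "ideal_set R K"
  shows "times_L_ideal B K = layered (\<lambda>_. K)"
proof -
  have sub: "K \<subseteq> mpolys B" using ideal_setD(1)[OF K] R_mpolys by blast
  note G = genideal_ring_on[OF subring_mpolys sub, folded poly_ring_eq]
  show ?thesis unfolding times_L_ideal_def
  proof
    show "genideal (poly_ring B) K \<subseteq> layered (\<lambda>_. K)"
      using K layered_monom[of "\<lambda>_. K" _ 0] by (intro G(3) layered_ideal) auto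
    show "layered (\<lambda>_. K) \<subseteq> genideal (poly_ring B) K"
      using G(1) ideal_setD(6)[OF G(2)] subring_set_power[OF subring_mpolys y_mpolys]
      by (intro layered_minimal[OF G(2)]) auto
  qed
qed

text \<open>Every v - \<phi>(v) l lies in the kernel of \<phi>, so a functional \<psi> vanishing on
  this kernel equals \<psi>(l) \<phi>.\<close>

lemma annihilator_ker: "annihilator_forms scale B {v. \<phi> v = 0} = range (\<lambda>c. const c * y)"
proof
  show "annihilator_forms scale B {v. \<phi> v = 0} \<subseteq> range (\<lambda>c. const c * y)"
  proof
    fix f assume "f \<in> annihilator_forms scale B {v. \<phi> v = 0}"
    then obtain \<psi> where f: "f = lin_form B \<psi>" and \<psi>: "linear_functional \<psi>" "\<And>v. \<phi> v = 0 \<Longrightarrow> \<psi> v = 0"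
      by (auto simp: annihilator_forms_def)
    interpret \<phi>: Vector_Spaces.linear scale "(*)" \<phi> by (rule \<phi>)
    interpret \<psi>: Vector_Spaces.linear scale "(*)" \<psi> by (rule \<psi>)
    have "\<psi> v = \<psi> l * \<phi> v" for v
      using \<psi>(2)[of "v - scale (\<phi> v) l"] by (simp add: \<phi>.diff \<phi>.scale \<psi>.diff \<psi>.scale \<phi>_l mult.commute)
    then have "\<psi> = (\<lambda>v. \<psi> l * \<phi> v)" by blast
    then have "f = const (\<psi> l) * y" unfolding f y_def by (metis lin_form_scale)
    then show "f \<in> range (\<lambda>c. const c * y)" by blast
  qed
  show "range (\<lambda>c. const c * y) \<subseteq> annihilator_forms scale B {v. \<phi> v = 0}"
  proof (clarify, unfold annihilator_forms_def, intro CollectI exI conjI)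
    fix c
    show "const c * y = lin_form B (\<lambda>v. c * \<phi> v)" by (simp add: lin_form_scale y_def)
    show "linear_functional (\<lambda>v. c * \<phi> v)" using \<phi> by (simp add: linear_functional_iff algebra_simps)
  qed auto
qed

text \<open>The kernel of \<phi> has the equation y = 0, and adjoining y to the ideal frees the
  coefficients of all positive powers of y.\<close>

lemma times_zero_ideal_eq:
  assumes K: "ideal_set R K"
  shows "times_zero_ideal scale B {v. \<phi> v = 0} K = layered (\<lambda>i. if i = 0 then K else R)"
proof -
  let ?K = "\<lambda>i::nat. if i = 0 then K else R"
  let ?S = "K \<union> annihilator_forms scale B {v. \<phi> v = 0}"
  have K': "ideal_set R (?K i)" for i using K ideal_set_R by simp
  have y: "const c * y \<in> mpolys B" for c
    by (intro subring_setD[OF subring_mpolys] mpolys_const y_mpolys)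
  have sub: "?S \<subseteq> mpolys B" using ideal_setD(1)[OF K] R_mpolys y by (auto simp: annihilator_ker)
  note G = genideal_ring_on[OF subring_mpolys sub, folded poly_ring_eq]
  show ?thesis unfolding times_zero_ideal_def
  proof
    have "K \<subseteq> layered ?K" using layered_monom[of ?K _ 0] K' by auto
    moreover have "const c * y \<in> layered ?K" for c
      using layered_monom[of ?K "const c" 1] K' R_const by auto
    ultimately show "genideal (poly_ring B) ?S \<subseteq> layered ?K"
      using K' ideal_setD(1)[OF K] by (intro G(3) layered_ideal) (auto simp: annihilator_ker split: if_splits)
    have "y \<in> ?S" unfolding annihilator_ker by (intro UnI2 range_eqI[of _ _ 1]) (simp add: const.hom_one)
    then have "y \<in> genideal (poly_ring B) ?S" using G(1) by blast
    then have "f * y ^ i \<in> genideal (poly_ring B) ?S" if "f \<in> R" "i \<noteq> 0" for f i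
      using that ideal_setD(5)[OF G(2), of y "f * y ^ (i - 1)"] R_power_mpolys[of f "i - 1"]
      by (cases i) (auto simp: ac_simps)
    moreover have "K \<subseteq> genideal (poly_ring B) ?S" using G(1) by blast
    ultimately show "layered ?K \<subseteq> genideal (poly_ring B) ?S"
      by (intro layered_minimal[OF G(2)]) (auto split: if_splits)
  qed
qed

text \<open>The components of v along H and L are v - \<phi>(v) l and \<phi>(v) l, and
  \<open>comp b\<close> is the coordinate \<open>b\<close> of \<open>l\<close>.\<close>

lemma scaling_pullback_var:
  assumes "b \<in> B"
  shows "lin_form B (\<lambda>v. V.representation B (proj {v. \<phi> v = 0} L v) b) = var b - const (comp b) * y"
    "lin_form B (\<lambda>v. V.representation B (proj L {v. \<phi> v = 0} v) b) = const (comp b) * y"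
proof -
  interpret \<phi>: Vector_Spaces.linear scale "(*)" \<phi> by (rule \<phi>)
  have 1: "proj {v. \<phi> v = 0} L v = v - scale (\<phi> v) l" for v
    unfolding proj_def
  proof (rule the_equality)
    fix h assume "h \<in> {v. \<phi> v = 0} \<and> v - h \<in> L"
    then obtain c where h: "\<phi> h = 0" "v - h = scale c l" by (auto simp: L)
    from arg_cong[OF h(2), of \<phi>] have "\<phi> v = c" using h(1) by (simp add: \<phi>.diff \<phi>.scale \<phi>_l)
    then show "h = v - scale (\<phi> v) l" using h(2) by (simp add: algebra_simps)
  qed (auto simp: \<phi>.diff \<phi>.scale \<phi>_l L)
  have 2: "proj L {v. \<phi> v = 0} v = scale (\<phi> v) l" for v
    unfolding proj_def
    by (rule the_equality) (auto simp: \<phi>.diff \<phi>.scale \<phi>_l L)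
  have rep: "V.representation B (v - w) b = V.representation B v b - V.representation B w b"
    "V.representation B (scale c v) b = c * V.representation B v b" for v w c
    by (simp_all add: V.representation_diff V.representation_scale V.independent_Basis V.span_Basis)
  show "lin_form B (\<lambda>v. V.representation B (proj {v. \<phi> v = 0} L v) b) = var b - const (comp b) * y"
    unfolding 1 rep using assms
    by (simp add: lin_form_diff lin_form_scale[of "comp b"] lin_form_rep y_def mult.commute[of "\<phi> _"] flip: comp_def)
  show "lin_form B (\<lambda>v. V.representation B (proj L {v. \<phi> v = 0} v) b) = const (comp b) * y"
    unfolding 2 rep
    by (simp add: lin_form_scale[of "comp b"] y_def mult.commute[of "\<phi> _"] flip: comp_def)
qed

abbreviation "pullback \<equiv> scaling_pullback scale B {v. \<phi> v = 0} L"

interpretation pullback: unital_hom pullback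
  unfolding scaling_pullback_def by (rule subst.unital_hom_axioms)

lemma pullback_simps:
  "pullback (const c) = const c" "pullback (var None) = var None"
  "b \<in> B \<Longrightarrow> pullback (var (Some b)) = lift (var b - const (comp b) * y) + var None * lift (const (comp b) * y)"
  by (simp_all add: scaling_pullback_def scaling_pullback_var)

text \<open>The scaling multiplies \<open>y\<close> by \<open>t\<close> and fixes \<open>k[V/L]\<close>.\<close>

lemma pullback_lift:
  assumes "p \<in> mpolys B"
  shows "pullback (lift p) = poly (map_poly lift (\<tau> p)) (var None * lift y)"
proof -
  have 1: "unital_hom (\<lambda>p. pullback (lift p))"
    by (rule unital_hom_comp[OF pullback.unital_hom_axioms subst.unital_hom_axioms])
  have 2: "unital_hom (\<lambda>p. poly (map_poly lift (\<tau> p)) (var None * lift y))"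
    by (rule unital_hom_comp[OF unital_hom_eval_map_poly[OF subst.unital_hom_axioms] \<tau>.unital_hom_axioms])
  show ?thesis
    by (rule unital_hom_eq_on[OF 1 2 assms])
      (simp_all add: pullback_simps \<tau>_var map_poly_pCons subst.hom_simps)
qed

text \<open>If F is the sum of the F_a t^a, the pullback turns a term r y^i of F_a into r y^i
  t^(a+i), so t^c receives the terms with a = c - i.\<close>

lemma coeff_\<eta>_pullback:
  assumes "F \<in> mpolys (ext_vars B)"
  shows "coeff (\<eta> (pullback F)) c = (\<Sum>i\<le>c. coeff (\<tau> (coeff (\<eta> F) (c - i))) i * y ^ i)"
proof -
  \<comment> \<open>\<open>g\<close> substitutes ty for y, with t as univariate variable. The t
    already present in F is a second, outer variable, identified with the first by evaluation at
    \<open>[:0, 1:]\<close>.\<close>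
  define g where "g p = pcompose (\<tau> p) [:0, y:]" for p
  have g: "unital_hom g"
    unfolding g_def by unfold_locales (simp_all add: \<tau>.hom_simps pcompose_add pcompose_mult pcompose_1)
  then interpret g: unital_hom g .
  have 1: "unital_hom (\<lambda>F. \<eta> (pullback F))"
    by (rule unital_hom_comp[OF \<eta>.unital_hom_axioms pullback.unital_hom_axioms])
  have 2: "unital_hom (\<lambda>F. poly (map_poly g (\<eta> F)) [:0, 1:])"
    by (rule unital_hom_comp[OF unital_hom_eval_map_poly[OF g] \<eta>.unital_hom_axioms])
  have "\<eta> (pullback F) = poly (map_poly g (\<eta> F)) [:0, 1:]"
  proof (rule unital_hom_eq_on[OF 1 2 assms])
    fix x assume "x \<in> ext_vars B"
    then show "\<eta> (pullback (var x)) = poly (map_poly g (\<eta> (var x))) [:0, 1:]"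
      by (auto simp: pullback_simps map_poly_pCons g.hom_zero g.hom_one \<eta>.hom_simps,
          simp add: g_def \<tau>_var pcompose_pCons)
  qed (simp add: pullback_simps map_poly_pCons g.hom_zero, simp add: g_def)
  moreover have "coeff (pcompose q [:0, y:]) i = coeff q i * y ^ i" for q i
  proof (induction q arbitrary: i)
    case (pCons a q)
    then show ?case by (cases i) (simp_all add: pcompose_pCons coeff_pCons)
  qed simp
  ultimately have "coeff (\<eta> (pullback F)) c =
      (\<Sum>a\<le>c. coeff (\<tau> (coeff (\<eta> F) a)) (c - a) * y ^ (c - a))"
    by (simp add: coeff_poly_X coeff_map_poly g.hom_zero) (simp add: g_def)
  also have "\<dots> = (\<Sum>i\<le>c. coeff (\<tau> (coeff (\<eta> F) (c - i))) i * y ^ i)"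
    by (rule sum.reindex_bij_witness[of _ "\<lambda>i. c - i" "\<lambda>i. c - i"]) auto
  finally show ?thesis .
qed

text \<open>In the pullback of F the coefficient of t^c has degree at most c in y, and its y^c term
  comes from F at t = 0 alone; this gives one inclusion. For the other, g in I of degree at most c
  in y yields t^c g(y/t), which has no negative powers of t and has pullback t^c g.\<close>

lemma flat_limit_ideal_eq:
  assumes I: "ideal_set (mpolys B) I"
  shows "flat_limit_ideal scale B {v. \<phi> v = 0} L I = layered (leading_ideal I)"
proof
  show "flat_limit_ideal scale B {v. \<phi> v = 0} L I \<subseteq> layered (leading_ideal I)"
  proof
    fix p assume "p \<in> flat_limit_ideal scale B {v. \<phi> v = 0} L I"
    then obtain F N where p: "p = coeff (\<eta> F) 0" and F: "F \<in> mpolys (ext_vars B)"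
      and N: "\<And>i. coeff (\<eta> (var None ^ N * pullback F)) i \<in> I"
      by (auto simp: flat_limit_ideal_def family_ideal_def genideal_lift[OF I, unfolded poly_ring_eq] subst_zero_eq_coeff poly_ring_eq)
    have pB: "p \<in> mpolys B" using p coeff_\<eta>_mpolys[OF F] by simp
    have "coeff (\<tau> p) c \<in> leading_ideal I c" for c
    proof -
      \<comment> \<open>This element of I witnesses that the coefficient of y^c in \<open>p\<close>
        is leading: the summand j = c of its expansion involves F at t = 0, that is,
        \<open>p\<close>.\<close>
      define g where "g = coeff (\<eta> (pullback F)) c"
      have "g \<in> I" using N[of "N + c"] by (simp add: coeff_\<eta>_power g_def)
      moreover have "coeff (\<tau> g) j = (if j \<le> c then coeff (\<tau> (coeff (\<eta> F) (c - j))) j else 0)" for j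
        unfolding g_def coeff_\<eta>_pullback[OF F]
        by (rule coeff_\<tau>_sum) (simp add: coeff_\<tau>_R coeff_\<eta>_mpolys[OF F])
      ultimately show ?thesis
        unfolding leading_ideal_def by (intro CollectI exI[of _ g]) (auto simp: p intro: degree_le)
    qed
    with pB show "p \<in> layered (leading_ideal I)" by (simp add: layered_def)
  qed
  show "layered (leading_ideal I) \<subseteq> flat_limit_ideal scale B {v. \<phi> v = 0} L I"
  proof
    fix p assume p: "p \<in> layered (leading_ideal I)"
    define n where "n = degree (\<tau> p)"
    have "\<exists>g. g \<in> I \<and> degree (\<tau> g) \<le> c \<and> coeff (\<tau> g) c = coeff (\<tau> p) c" for c
    proof -
      have "coeff (\<tau> p) c \<in> leading_ideal I c" using p by (simp add: layered_def)
      then show ?thesis unfolding leading_ideal_def mem_Collect_eq by metis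
    qed
    then obtain g where g: "\<And>c. g c \<in> I" "\<And>c. degree (\<tau> (g c)) \<le> c" "\<And>c. coeff (\<tau> (g c)) c = coeff (\<tau> p) c"
      by metis
    define a where "a c i = coeff (\<tau> (g c)) i" for c i
    have a: "a c i \<in> R" for c i using g(1) ideal_setD(3)[OF I] coeff_\<tau>_R by (simp add: a_def)
    have aB: "a c i \<in> mpolys B" for c i using a R_mpolys by blast
    let ?t = "var None :: ('v option, 'k) mpoly"
    \<comment> \<open>The sum over c of t^c g_c(y/t). At t = 0 only the terms with i = c remain, and
      they add up to \<open>p\<close>.\<close>
    define F where "F = (\<Sum>c\<le>n. \<Sum>i\<le>c. lift (a c i * y ^ i) * ?t ^ (c - i))"
    have F_mpolys: "F \<in> mpolys (ext_vars B)"
      unfolding F_def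
      by (intro subring_set_sum[OF subring_mpolys] subring_setD(5)[OF subring_mpolys] lift_mpolys R_power_mpolys a
          subring_set_power[OF subring_mpolys] mpolys_var) simp
    have "pullback (lift (a c i * y ^ i)) = lift (a c i * y ^ i) * ?t ^ i" for c i
      using aB a y_mpolys
      by (subst subst.hom_mult, subst pullback.hom_mult)
        (auto simp: pullback_lift subst.hom_simps pullback.hom_simps \<tau>_R \<tau>_y map_poly_pCons power_mult_distrib ac_simps)
    then have "pullback F = (\<Sum>c\<le>n. \<Sum>i\<le>c. lift (a c i * y ^ i) * ?t ^ i * ?t ^ (c - i))"
      unfolding F_def by (simp add: pullback.hom_simps pullback_simps)
    also have "\<dots> = (\<Sum>c\<le>n. lift (g c) * ?t ^ c)"
    proof (rule sum.cong[OF refl])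
      fix c
      have "(\<Sum>i\<le>c. lift (a c i * y ^ i) * ?t ^ i * ?t ^ (c - i)) = (\<Sum>i\<le>c. lift (a c i * y ^ i) * ?t ^ c)"
        by (intro sum.cong) (auto simp: mult.assoc simp flip: power_add)
      also have "\<dots> = lift (g c) * ?t ^ c"
        unfolding sum_distrib_right[symmetric] subst.hom_sum[symmetric] a_def using \<tau>_expand[OF g(2), of c] by simp
      finally show "(\<Sum>i\<le>c. lift (a c i * y ^ i) * ?t ^ i * ?t ^ (c - i)) = lift (g c) * ?t ^ c" .
    qed
    also have "\<dots> \<in> genideal (poly_ring (ext_vars B)) (lift ` I)"
    proof -
      have sub: "lift ` I \<subseteq> mpolys (ext_vars B)"
        using ideal_setD(1)[OF I] lift_mpolys by blast
      note G = genideal_ring_on[OF subring_mpolys sub, folded poly_ring_eq]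
      show ?thesis using G(1) g(1)
        by (intro ideal_set_sum[OF G(2)] ideal_setD(6)[OF G(2)] subring_set_power[OF subring_mpolys] mpolys_var) auto
    qed
    finally have "F \<in> family_ideal scale B {v. \<phi> v = 0} L I"
      using F_mpolys unfolding family_ideal_def by (auto simp: poly_ring_eq intro!: exI[of _ 0])
    moreover have "mpoly_subst (case_option 0 var) F = p"
    proof -
      have "mpoly_subst (case_option 0 var) F = (\<Sum>c\<le>n. \<Sum>i\<le>c. a c i * y ^ i * 0 ^ (c - i))"
        unfolding F_def by (subst subst.hom_sum, intro sum.cong refl, subst subst.hom_sum, intro sum.cong refl,
            subst subst.hom_mult, subst subst.hom_power) (simp add: subst_zero_lift)
      also have "\<dots> = (\<Sum>c\<le>n. \<Sum>i\<le>c. if i = c then a c i * y ^ i else 0)"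
        by (intro sum.cong) (auto simp: power_0_left)
      also have "\<dots> = p"
        using \<tau>_expand[of p n] by (simp add: n_def a_def g(3))
      finally show ?thesis .
    qed
    ultimately show "p \<in> flat_limit_ideal scale B {v. \<phi> v = 0} L I"
      unfolding flat_limit_ideal_def by blast
  qed
qed

end

section \<open>The blow-up\<close>

abbreviation "deg_S \<equiv> case_option (0::nat) (\<lambda>_. 1)"
abbreviation "deg_T \<equiv> case_option (1::nat) (\<lambda>_. 0)"

lemma graded_lift:
  assumes "\<And>x. w' (Some x) = w x" "graded w d p"
  shows "graded w' d (lift (p :: ('x, 'k::comm_ring_1) mpoly))"
proof -
  interpret m: unital_hom "map_poly lift" by (rule unital_hom_map_poly[OF subst.unital_hom_axioms])
  have z: "lift (0 :: ('x, 'k) mpoly) = 0" by (rule subst.hom_zero)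
  have m_monom: "map_poly lift (monom q e) = monom (lift q) e" for q :: "('x, 'k) mpoly" and e
    by (rule poly_eqI) (simp add: coeff_map_poly z)
  have 1: "unital_hom (\<lambda>p :: ('x, 'k) mpoly. grade_poly w' (lift p))"
    by (rule unital_hom_comp[OF grade.unital_hom_axioms subst.unital_hom_axioms])
  have 2: "unital_hom (\<lambda>p :: ('x, 'k) mpoly. map_poly lift (grade_poly w p))"
    by (rule unital_hom_comp[OF m.unital_hom_axioms grade.unital_hom_axioms])
  have "grade_poly w' (lift p) = map_poly lift (grade_poly w p)"
    by (rule unital_hom_eq_on[OF 1 2, where B = UNIV]) (auto simp: assms(1) m_monom map_poly_pCons z)
  then show ?thesis using assms(2) by (simp add: graded_def m_monom)
qed

text \<open>Supplies the degree 0 in T of every lifted polynomial.\<close>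

lemma graded_weight_zero: "graded (\<lambda>_. 0) 0 p"
proof -
  have "grade_poly (\<lambda>_. 0) p = [:p:]"
    by (rule unital_hom_eq_on[OF grade.unital_hom_axioms unital_hom_pconst, where B = UNIV])
      (auto simp: monom_0)
  then show ?thesis by (simp add: graded_def monom_0)
qed

text \<open>The first degree counts z and the coordinates of V, the second counts T; for a linear
  form p the element pT has bidegree (1, 1).\<close>

definition bigraded :: "nat \<Rightarrow> nat \<Rightarrow> ('x option, 'k::comm_ring_1) mpoly \<Rightarrow> bool" where
  "bigraded e d G \<longleftrightarrow> graded deg_S e G \<and> graded deg_T d G"

lemma bihom_part_bigraded:
  "bigraded e d G \<Longrightarrow> bihom_part e' d' G = (if e' = e \<and> d' = d then G else 0)"
  by (auto simp: bigraded_def bihom_part_def graded_part_of_graded)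

lemma bigraded_mult: "bigraded e d G \<Longrightarrow> bigraded e' d' H \<Longrightarrow> bigraded (e + e') (d + d') (G * H)"
  by (simp add: bigraded_def graded_mult)

lemma bigraded_power: "bigraded e d G \<Longrightarrow> bigraded (e * n) (d * n) (G ^ n)"
  by (simp add: bigraded_def graded_power)

lemma bigraded_sum: "(\<And>i. i \<in> A \<Longrightarrow> bigraded e d (f i)) \<Longrightarrow> bigraded e d (\<Sum>i\<in>A. f i)"
  by (simp add: bigraded_def graded_sum)

lemma bigraded_const: "bigraded 0 0 (const c)"
  by (simp add: bigraded_def graded_const)

lemma bigraded_T: "bigraded 0 1 (var None)"
  using graded_var[of deg_S None] graded_var[of deg_T None] by (simp add: bigraded_def)

lemma bigraded_lift: "graded (\<lambda>_. 1) e p \<Longrightarrow> bigraded e 0 (lift p)"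
  unfolding bigraded_def
  by (auto intro: graded_lift[of deg_S "\<lambda>_. 1"] graded_lift[of deg_T "\<lambda>_. 0"] graded_weight_zero)

lemma bigraded_lift_lift: "graded (\<lambda>_. 1) e p \<Longrightarrow> bigraded e 0 (lift (lift p))"
  by (auto intro: bigraded_lift graded_lift[of "\<lambda>_. 1" "\<lambda>_. 1"])

lemma bigraded_z: "bigraded 1 0 (lift (var None))"
  using bigraded_lift[OF graded_var[of "\<lambda>_. 1" None]] by simp

lemma bihom_part_add: "bihom_part e d (G + H) = bihom_part e d G + bihom_part e d H"
  by (simp add: bihom_part_def graded_part_add)

lemma bihom_part_uminus: "bihom_part e d (- G) = - bihom_part e d G"
  by (simp add: bihom_part_def graded_part_uminus)

lemma bihom_part_zero: "bihom_part e d 0 = 0"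
  by (simp add: bihom_part_def)

lemma bihom_part_mult:
  "bihom_part e d (G * H) = (\<Sum>j\<le>d. \<Sum>i\<le>e. bihom_part i j G * bihom_part (e - i) (d - j) H)"
  by (simp add: bihom_part_def graded_part_mult graded_part_sum)

section \<open>Restriction to the open set V\<close>

interpretation restrict: unital_hom "restrict_to_V :: ('v option option, 'k::field) mpoly \<Rightarrow> ('v, 'k) mpoly"
  unfolding restrict_to_V_def by (rule subst.unital_hom_axioms)

lemma restrict_simps [simp]:
  "restrict_to_V (const c) = const c" "restrict_to_V (var None) = 1"
  "restrict_to_V (var (Some None)) = 1" "restrict_to_V (var (Some (Some b))) = var b"
  by (simp_all add: restrict_to_V_def)

lemma restrict_lift_lift: "restrict_to_V (lift (lift p)) = p"
proof -
  have 1: "unital_hom (\<lambda>p :: ('a, 'b) mpoly. restrict_to_V (lift (lift p)))"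
    by (intro unital_hom_comp[OF restrict.unital_hom_axioms] unital_hom_comp[OF subst.unital_hom_axioms] subst.unital_hom_axioms)
  have 2: "unital_hom (\<lambda>p :: ('a, 'b) mpoly. p)" by unfold_locales auto
  show ?thesis by (rule unital_hom_eq_on[OF 1 2, where B = UNIV]) auto
qed

text \<open>Both zT and a form of degree j times T^j have equal first and second degree, and powers
  of zT fill up the missing d - j.\<close>

lemma bigraded_form_on_E: "bigraded d d (form_on_E d f)"
  unfolding form_on_E_def
proof (rule bigraded_sum)
  fix j assume "j \<in> {..d}"
  moreover have "bigraded (1 * (d - j) + (j + 0 * j)) (1 * (d - j) + (0 + 1 * j))
    ((lift (var None) * var None) ^ (d - j) * (lift (lift (hom_part j f)) * var None ^ j))"
    using bigraded_mult[OF bigraded_z bigraded_T]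
    by (intro bigraded_mult bigraded_power bigraded_lift_lift graded_graded_part bigraded_T) simp_all
  ultimately show "bigraded d d ((lift (var None) * var None) ^ (d - j) * (lift (lift (hom_part j f)) * var None ^ j))"
    by simp
qed

lemma restrict_form_on_E:
  assumes "\<And>j. j > d \<Longrightarrow> hom_part j f = 0" shows "restrict_to_V (form_on_E d f) = f"
  using sum_graded_parts[of d "\<lambda>_. 1" f] assms
  by (simp add: form_on_E_def restrict.hom_simps restrict_lift_lift)

text \<open>Used for the N-th power of a linear form \<psi> as a polynomial in y, with a =
  \<psi>(l).\<close>

lemma coeff_linear_power_top:
  "degree ([:r, a:] ^ n) \<le> n" "coeff ([:r, a::'a::comm_ring_1:] ^ n) n = a ^ n"
proof (induction n)
  case (Suc n)
  case 1
  have "degree ([:r, a:] * [:r, a:] ^ n) \<le> degree [:r, a:] + degree ([:r, a:] ^ n)"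
    by (rule degree_mult_le)
  also have "\<dots> \<le> 1 + n" using Suc(1) by (intro add_mono) (auto simp: One_nat_def)
  finally show ?case by simp
  case 2
  show ?case using Suc by (simp add: coeff_eq_0)
qed (simp_all)

context split_line
begin

section \<open>The Rees algebra and the order at the point\<close>

abbreviation S :: "('v option, 'k) mpoly set" where "S \<equiv> mpolys (ext_vars B)"
abbreviation "P \<equiv> point_ideal scale B L"
abbreviation "Rees \<equiv> carrier (rees_ring scale B L)"
abbreviation "Exc \<equiv> exceptional_ideal scale B L"

lemma point_generators: "insert (var None) (lift ` annihilator_forms scale B L) \<subseteq> S"
  using R_ann R_mpolys lift_mpolys mpolys_var[of None "ext_vars B"] by blast

lemmas P_facts = genideal_ring_on[OF subring_mpolys point_generators,
    folded poly_ring_eq, folded point_ideal_def]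

lemma lift_lin_form_P: "linear_functional \<psi> \<Longrightarrow> \<psi> l = 0 \<Longrightarrow> lift (lin_form B \<psi>) \<in> P"
  using P_facts(1) by (auto simp: annihilator_L)

abbreviation "rees_generators \<equiv> lift ` S \<union> (\<lambda>p. lift p * var None) ` P"

lemma rees_generators: "rees_generators \<subseteq> mpolys (ext_vars (ext_vars B))"
  using ideal_setD(1)[OF P_facts(2)] lift_mpolys[of _ "ext_vars B"]
  by (auto intro!: subring_setD(5)[OF subring_mpolys] mpolys_var)

lemma rees_eq: "rees_ring scale B L = ring_on Rees"
  "Rees = generate_ring (ring_on (mpolys (ext_vars (ext_vars B)))) rees_generators"
proof -
  have "rees_ring scale B L =
      ring_on (generate_ring (ring_on (mpolys (ext_vars (ext_vars B)))) rees_generators)"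
    unfolding rees_ring_def poly_ring_restrict_eq by (simp add: poly_ring_eq)
  then show "rees_ring scale B L = ring_on Rees"
    "Rees = generate_ring (ring_on (mpolys (ext_vars (ext_vars B)))) rees_generators"
    by simp_all
qed

lemmas Rees_facts = generate_ring_on[OF subring_mpolys rees_generators, folded rees_eq(2)]

lemma lift_S_Rees: "p \<in> S \<Longrightarrow> lift p \<in> Rees"
  and lift_P_Rees: "p \<in> P \<Longrightarrow> lift p * var None \<in> Rees"
  using Rees_facts(1) by auto

lemma lift_P_subset: "lift ` P \<subseteq> Rees"
  using lift_S_Rees ideal_setD(1)[OF P_facts(2)] by blast

lemmas Exc_facts = genideal_ring_on[OF Rees_facts(2) lift_P_subset,
    folded rees_eq(1), folded exceptional_ideal_def]

text \<open>
  A form of degree \<open>e\<close> in the \<open>(d + k)\<close>-th power of the ideal of the point has degree at most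
  \<open>e - d - k\<close> in \<open>y\<close>, since \<open>y\<close> is the only coordinate not vanishing at the point.
\<close>

definition order_ge :: "int \<Rightarrow> ('v option option, 'k) mpoly set" where
  "order_ge k = {G. \<forall>e d n. coeff (\<tau> (restrict_to_V (bihom_part e d G))) n \<noteq> 0 \<longrightarrow>
     int n + int d + k \<le> int e}"

lemma order_ge_mono: "k \<le> j \<Longrightarrow> G \<in> order_ge j \<Longrightarrow> G \<in> order_ge k"
  by (force simp: order_ge_def)

lemma order_ge_zero: "0 \<in> order_ge k"
  by (simp add: order_ge_def bihom_part_zero restrict.hom_zero \<tau>.hom_zero)

lemma order_ge_add:
  assumes "G \<in> order_ge k" "H \<in> order_ge k" shows "G + H \<in> order_ge k"
  unfolding order_ge_def
proof (intro CollectI allI impI)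
  fix e d n assume "coeff (\<tau> (restrict_to_V (bihom_part e d (G + H)))) n \<noteq> 0"
  then have "coeff (\<tau> (restrict_to_V (bihom_part e d G))) n \<noteq> 0 \<or>
     coeff (\<tau> (restrict_to_V (bihom_part e d H))) n \<noteq> 0"
    by (auto simp: bihom_part_add restrict.hom_add \<tau>.hom_add)
  then show "int n + int d + k \<le> int e" using assms unfolding order_ge_def by blast
qed

lemma order_ge_uminus: "G \<in> order_ge k \<Longrightarrow> - G \<in> order_ge k"
  by (simp add: order_ge_def bihom_part_uminus restrict.hom_uminus \<tau>.hom_uminus)

text \<open>Bidegrees and exponents of y add under multiplication. A nonzero coefficient of the
  product comes from nonzero coefficients of both factors, and their two inequalities add
  up.\<close>

lemma order_ge_mult:
  assumes G: "G \<in> order_ge j" and H: "H \<in> order_ge k" shows "G * H \<in> order_ge (j + k)"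
  unfolding order_ge_def
proof (intro CollectI allI impI)
  fix e d n
  let ?c = "\<lambda>G e d n. coeff (\<tau> (restrict_to_V (bihom_part e d G))) n"
  assume "?c (G * H) e d n \<noteq> 0"
  then have "(\<Sum>d'\<le>d. \<Sum>e'\<le>e. \<Sum>i\<le>n. ?c G e' d' i * ?c H (e - e') (d - d') (n - i)) \<noteq> 0"
    by (simp add: bihom_part_mult restrict.hom_simps \<tau>.hom_simps coeff_sum coeff_mult)
  then obtain d' where d': "d' \<le> d"
      "(\<Sum>e'\<le>e. \<Sum>i\<le>n. ?c G e' d' i * ?c H (e - e') (d - d') (n - i)) \<noteq> 0"
    by (meson sum.not_neutral_contains_not_neutral atMost_iff)
  then obtain e' where e': "e' \<le> e" "(\<Sum>i\<le>n. ?c G e' d' i * ?c H (e - e') (d - d') (n - i)) \<noteq> 0"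
    by (meson sum.not_neutral_contains_not_neutral atMost_iff)
  then obtain i where i: "i \<le> n" "?c G e' d' i * ?c H (e - e') (d - d') (n - i) \<noteq> 0"
    by (meson sum.not_neutral_contains_not_neutral atMost_iff)
  then have "?c G e' d' i \<noteq> 0" "?c H (e - e') (d - d') (n - i) \<noteq> 0" by auto
  then have "int i + int d' + j \<le> int e'" "int (n - i) + int (d - d') + k \<le> int (e - e')"
    using G H unfolding order_ge_def by blast+
  then show "int n + int d + (j + k) \<le> int e" using d'(1) e'(1) i(1) by linarith
qed

lemma order_ge_bigraded:
  assumes "bigraded e d G" "\<And>n. coeff (\<tau> (restrict_to_V G)) n \<noteq> 0 \<Longrightarrow> int n + int d + k \<le> int e"
  shows "G \<in> order_ge k"
  using assms(2)
  by (auto simp: order_ge_def bihom_part_bigraded[OF assms(1)] restrict.hom_zero \<tau>.hom_zero split: if_splits)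

lemma order_ge_const: "const c \<in> order_ge 0"
  by (rule order_ge_bigraded[OF bigraded_const]) (auto simp: coeff_pCons split: nat.splits)

lemma subring_order_ge: "subring_set (order_ge 0)"
  using order_ge_mult[of _ 0 _ 0] order_ge_add order_ge_uminus order_ge_const[of 1]
  by (auto simp: subring_set_def const.hom_one)

lemma order_ge_z: "lift (var None) \<in> order_ge 1"
  by (rule order_ge_bigraded[OF bigraded_z])
    (auto simp: \<tau>.hom_one one_pCons coeff_pCons split: nat.splits)

text \<open>T raises the second degree but not the first, whence the negative order and the use of
  integers. In the Rees algebra the element of P that accompanies T makes up for it.\<close>

lemma order_ge_T: "var None \<in> order_ge (- 1)"
  by (rule order_ge_bigraded[OF bigraded_T])
    (auto simp: \<tau>.hom_one one_pCons coeff_pCons split: nat.splits)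

lemma order_ge_S: "p \<in> S \<Longrightarrow> lift p \<in> order_ge 0"
proof (rule unital_hom_mpolys[OF subst.unital_hom_axioms subring_order_ge])
  fix x assume x: "x \<in> ext_vars B"
  show "lift (var x) \<in> order_ge 0"
  proof (cases x)
    case None
    then show ?thesis using order_ge_z order_ge_mono[of 0 1] by simp
  next
    case (Some b)
    have "bigraded 1 0 (lift (var (Some b) :: ('v option, 'k) mpoly))"
      using bigraded_lift[OF graded_var[of "\<lambda>_. 1" "Some b"]] .
    then show ?thesis unfolding Some
      by (rule order_ge_bigraded) (auto simp: \<tau>_var coeff_pCons split: nat.splits)
  qed
qed (simp_all add: order_ge_const)

text \<open>z and the forms vanishing on L have degree 1 and do not involve y, so their order is 1;
  factors from \<open>S\<close> have order at least 0.\<close>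

lemma order_ge_P: "p \<in> P \<Longrightarrow> lift p \<in> order_ge 1"
proof -
  have "P \<subseteq> {p \<in> S. lift p \<in> order_ge 1}"
  proof (rule P_facts(3))
    show "ideal_set S {p \<in> S. lift p \<in> order_ge 1}"
      unfolding ideal_set_def
    proof (intro conjI ballI)
      fix p c assume "p \<in> {p \<in> S. lift p \<in> order_ge 1}" "c \<in> S"
      then show "c * p \<in> {p \<in> S. lift p \<in> order_ge 1}"
        using order_ge_mult[OF order_ge_S, of c "lift p" 1]
        by (auto simp: subst.hom_mult subring_setD(5)[OF subring_mpolys])
    qed (auto simp: subst.hom_simps order_ge_zero order_ge_add subring_setD[OF subring_mpolys])
    have "lift (lift (lin_form B \<psi>)) \<in> order_ge 1" if "linear_functional \<psi>" "\<psi> l = 0" for \<psi>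
      by (rule order_ge_bigraded[OF bigraded_lift_lift[OF graded_lin_form]])
        (use that in \<open>auto simp: restrict_lift_lift \<tau>_lin_form const.hom_zero coeff_pCons split: nat.splits\<close>)
    then show "insert (var None) (lift ` annihilator_forms scale B L) \<subseteq> {p \<in> S. lift p \<in> order_ge 1}"
      using point_generators order_ge_z by (auto simp: annihilator_L)
  qed
  then show "p \<in> P \<Longrightarrow> lift p \<in> order_ge 1" by blast
qed

text \<open>For a generator pT the order of p and that of T balance: 1 - 1 = 0.\<close>

lemma order_ge_Rees: "Rees \<subseteq> order_ge 0"
  using order_ge_S order_ge_mult[OF order_ge_P order_ge_T]
  by (intro Rees_facts(4) subring_order_ge) auto

lemma order_ge_Exc: "Exc \<subseteq> order_ge 1"
proof -
  have "Exc \<subseteq> {G \<in> Rees. G \<in> order_ge 1}"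
  proof (rule Exc_facts(3))
    show "ideal_set Rees {G \<in> Rees. G \<in> order_ge 1}"
      unfolding ideal_set_def
    proof (intro conjI ballI)
      fix p c assume "p \<in> {G \<in> Rees. G \<in> order_ge 1}" "c \<in> Rees"
      then show "c * p \<in> {G \<in> Rees. G \<in> order_ge 1}"
        using order_ge_mult[of c 0 p 1] order_ge_Rees by (auto simp: subring_setD(5)[OF Rees_facts(2)])
    qed (auto simp: order_ge_zero order_ge_add subring_setD[OF Rees_facts(2)])
  qed (use lift_P_subset order_ge_P in auto)
  then show ?thesis by blast
qed

text \<open>Linear forms vanishing on L lie in P, so a form of degree j in k[V/L] lies in P^j and
  may carry T^j. The property passes to products since each summand of the convolution splits T^j
  accordingly.\<close>

lemma lift_hom_part_Rees:
  assumes "r \<in> R" shows "lift (lift (hom_part j r)) * var None ^ j \<in> Rees"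
proof -
  let ?D = "{r. \<forall>j. lift (lift (hom_part j r)) * var None ^ j \<in> Rees}"
  note Rees = subring_setD[OF Rees_facts(2)]
  have "R \<subseteq> ?D"
  proof (rule R_minimal)
    have const: "const c \<in> ?D" for c
      using lift_S_Rees[OF mpolys_const, of c] Rees(2)
      by (auto simp: graded_part_of_graded[OF graded_const] subst.hom_zero)
    then show "const c \<in> ?D" for c .
    show "subring_set ?D"
      unfolding subring_set_def
    proof (intro conjI ballI)
      show "1 \<in> ?D" using const[of 1] by (simp add: const.hom_one)
      show "- p \<in> ?D" if "p \<in> ?D" for p
        using that Rees(3) by (simp add: graded_part_uminus subst.hom_uminus)
      show "p + q \<in> ?D" if "p \<in> ?D" "q \<in> ?D" for p q
        using that Rees(4) by (simp add: graded_part_add subst.hom_add distrib_right)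
      show "p * q \<in> ?D" if "p \<in> ?D" "q \<in> ?D" for p q
      proof (intro CollectI allI)
        fix j
        have "lift (lift (hom_part j (p * q))) * var None ^ j =
          (\<Sum>i\<le>j. (lift (lift (hom_part i p)) * var None ^ i) * (lift (lift (hom_part (j - i) q)) * var None ^ (j - i)))"
          unfolding graded_part_mult subst.hom_sum subst.hom_mult sum_distrib_right
        proof (intro sum.cong refl)
          fix i assume "i \<in> {..j}"
          then have "var None ^ j = (var None ^ i * var None ^ (j - i) :: ('v option option, 'k) mpoly)"
            by (simp flip: power_add)
          then show "lift (lift (hom_part i p)) * lift (lift (hom_part (j - i) q)) * var None ^ j =
            (lift (lift (hom_part i p)) * var None ^ i) * (lift (lift (hom_part (j - i) q)) * var None ^ (j - i))"
            by (simp add: mult_ac)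
        qed
        also have "\<dots> \<in> Rees"
          by (rule subring_set_sum[OF Rees_facts(2)], rule Rees(5)) (use that in blast)+
        finally show "lift (lift (hom_part j (p * q))) * var None ^ j \<in> Rees" .
      qed
    qed
    show "lin_form B \<psi> \<in> ?D" if "linear_functional \<psi>" "\<psi> l = 0" for \<psi>
      using lift_P_Rees[OF lift_lin_form_P[OF that]] Rees(2)
      by (auto simp: graded_part_of_graded[OF graded_lin_form] subst.hom_zero)
  qed
  with assms show ?thesis by blast
qed

lemma form_on_E_Rees: "r \<in> R \<Longrightarrow> form_on_E d r \<in> Rees"
  unfolding form_on_E_def
proof (rule subring_set_sum[OF Rees_facts(2)])
  fix j assume "r \<in> R"
  have "lift (var None) * var None \<in> Rees" using P_facts(1) by (intro lift_P_Rees) blast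
  from subring_setD(5)[OF Rees_facts(2) subring_set_power[OF Rees_facts(2) this] lift_hom_part_Rees[OF \<open>r \<in> R\<close>]]
  show "(lift (var None) * var None) ^ (d - j) * (lift (lift (hom_part j r)) * var None ^ j) \<in> Rees" .
qed

section \<open>The ideal of Lambda\<close>

lemma set_add_Rees: "C <+>\<^bsub>rees_ring scale B L\<^esub> D = {a + b | a b. a \<in> C \<and> b \<in> D}"
  by (subst rees_eq(1)) (auto simp: set_add_def')

text \<open>Take the part of bidegree (N + d, d) and set z = T = 1: the equation becomes \<psi>^N f
  = g + e with g in I and e of degree less than N in y. So g has degree at most N, with coefficient
  a^N f at y^N, where a = \<psi>(l) is nonzero and can be divided out.\<close>

lemma Lambda_ideal_subset:
  assumes I: "ideal_set (mpolys B) I"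
  shows "Lambda_ideal scale B L I \<subseteq> all_leading I"
proof
  fix f assume "f \<in> Lambda_ideal scale B L I"
  then obtain \<psi> N d G E where f: "f \<in> R" and \<psi>: "linear_functional \<psi>" "\<exists>v\<in>L. \<psi> v \<noteq> 0"
    and d: "\<And>j. j > d \<Longrightarrow> hom_part j f = 0"
    and eq: "lift (lift (lin_form B \<psi>)) ^ N * form_on_E d f = G + E"
    and G: "G \<in> closure_ideal scale B L I" and E: "E \<in> Exc"
    unfolding Lambda_ideal_def set_add_Rees R_def by blast
  define a where "a = \<psi> l"
  have a: "a \<noteq> 0" using \<psi> by (auto simp: a_def L linear_functional_iff)
  let ?W = "lift (lift (lin_form B \<psi>)) ^ N * form_on_E d f"
  define g where "g = restrict_to_V (bihom_part (N + d) d G)"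
  define e where "e = restrict_to_V (bihom_part (N + d) d E)"
  have "bigraded (1 * N + d) (0 * N + d) ?W"
    by (intro bigraded_mult bigraded_power bigraded_form_on_E bigraded_lift_lift graded_lin_form)
  then have "bihom_part (N + d) d ?W = ?W" using bihom_part_bigraded[of "N + d" d ?W "N + d" d] by simp
  then have "restrict_to_V ?W = g + e"
    unfolding g_def e_def by (metis eq bihom_part_add restrict.hom_add)
  moreover have "restrict_to_V ?W = lin_form B \<psi> ^ N * f"
    using restrict_form_on_E[OF d] by (simp add: restrict.hom_simps restrict_lift_lift)
  ultimately have "\<tau> (lin_form B \<psi> ^ N * f) = \<tau> g + \<tau> e" by (simp add: \<tau>.hom_add)
  moreover have "\<tau> (lin_form B \<psi> ^ N * f) = smult f ([:lin_form B \<psi> - const a * y, const a:] ^ N)"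
    using \<tau>_lin_form[OF \<psi>(1)] by (simp add: \<tau>.hom_simps \<tau>_R[OF f] a_def)
  ultimately have g_eq: "coeff (\<tau> g) n =
      f * coeff ([:lin_form B \<psi> - const a * y, const a:] ^ N) n - coeff (\<tau> e) n" for n
    by (metis add_diff_cancel_right' coeff_diff coeff_smult)
  \<comment> \<open>Order at least 1 in bidegree (N + d, d) reads n + d + 1 \<le> N + d.\<close>
  have "coeff (\<tau> e) n = 0" if "n \<ge> N" for n
    using E order_ge_Exc that unfolding e_def order_ge_def by fastforce
  then have "coeff (\<tau> g) n = 0" if "n > N" for n
    using that coeff_linear_power_top(1)[of "lin_form B \<psi> - const a * y" "const a" N]
    by (simp add: g_eq coeff_eq_0)
  moreover have "coeff (\<tau> g) N = f * const (a ^ N)"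
    using \<open>\<And>n. n \<ge> N \<Longrightarrow> coeff (\<tau> e) n = 0\<close> by (simp add: g_eq coeff_linear_power_top(2) const.hom_power)
  moreover have "g \<in> I" using G by (simp add: g_def closure_ideal_def)
  ultimately have "f * const (a ^ N) \<in> leading_ideal I N"
    unfolding leading_ideal_def by (intro CollectI exI[of _ g]) (auto intro: degree_le)
  from ideal_setD(6)[OF leading_ideal_ideal[OF I] this R_const[of "inverse (a ^ N)"]]
  have "f \<in> leading_ideal I N" using a by (simp add: mult.assoc const.hom_one flip: const.hom_mult)
  then show "f \<in> all_leading I" by (auto simp: all_leading_def)
qed

text \<open>Homogenize g = a_0 + ... + a_N y^N to G of bidegree (D + N, D), filling up with powers
  of z. All terms but the last contain z, which lies in P, so modulo the exceptional ideal G is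
  congruent to y^N times \<open>form_on_E D f\<close>.\<close>

lemma all_leading_subset_Lambda:
  assumes I: "ideal_set (mpolys B) I"
  shows "all_leading I \<subseteq> Lambda_ideal scale B L I"
proof
  fix f assume "f \<in> all_leading I"
  then obtain N g where g: "g \<in> I" "degree (\<tau> g) \<le> N" and f: "f = coeff (\<tau> g) N"
    by (auto simp: all_leading_def leading_ideal_def)
  define a where "a i = coeff (\<tau> g) i" for i
  have a: "a i \<in> R" for i using g(1) ideal_setD(3)[OF I] coeff_\<tau>_R by (simp add: a_def)
  have "\<forall>i. \<exists>n. \<forall>j>n. hom_part j (a i) = 0" using graded_parts_eventually_zero by metis
  then obtain D' where D': "\<And>i j. j > D' i \<Longrightarrow> hom_part j (a i) = 0" by metis
  \<comment> \<open>One bound for the degrees of all a_i, so that the homogenized coefficients share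
    a bidegree; the sum of the individual bounds serves.\<close>
  define D where "D = (\<Sum>i\<le>N. D' i)"
  have D: "hom_part j (a i) = 0" if "i \<le> N" "j > D" for i j
    using D'[of i j] member_le_sum[of i "{..N}" D'] that by (simp add: D_def)
  note Rees = subring_setD[OF Rees_facts(2)]
  let ?z = "lift (var None) :: ('v option option, 'k) mpoly"
  define W where "W i = lift (lift y) ^ i * form_on_E D (a i)" for i
  have z_Rees: "?z \<in> Rees" by (intro lift_S_Rees mpolys_var) simp
  have z_Exc: "?z \<in> Exc" using Exc_facts(1) P_facts(1) by blast
  have W_Rees: "W i \<in> Rees" for i
    unfolding W_def by (intro Rees(5) subring_set_power[OF Rees_facts(2)] lift_S_Rees lift_mpolys y_mpolys form_on_E_Rees a)
  have tail: "?z ^ (N - i) * W i \<in> Exc" if "i < N" for i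
  proof -
    have "N - i = Suc (N - i - 1)" using that by simp
    then have "?z ^ (N - i) = ?z ^ (N - i - 1) * ?z" by (metis power_Suc2)
    then show ?thesis
      using ideal_setD(5)[OF Exc_facts(2) z_Exc, of "W i * ?z ^ (N - i - 1)"] W_Rees[of i] z_Rees
      by (simp add: Rees(5) subring_set_power[OF Rees_facts(2)] ac_simps)
  qed
  define G where "G = (\<Sum>i\<le>N. ?z ^ (N - i) * W i)"
  have "bigraded (D + N) D G"
    unfolding G_def
  proof (rule bigraded_sum)
    fix i assume "i \<in> {..N}"
    moreover have "bigraded (1 * (N - i) + (1 * i + D)) (0 * (N - i) + (0 * i + D)) (?z ^ (N - i) * W i)"
      unfolding W_def
      by (intro bigraded_mult bigraded_power bigraded_z bigraded_lift_lift graded_y bigraded_form_on_E)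
    ultimately show "bigraded (D + N) D (?z ^ (N - i) * W i)" by (simp add: add.commute)
  qed
  moreover have "restrict_to_V G = g"
  proof -
    have "restrict_to_V G = (\<Sum>i\<le>N. a i * y ^ i)"
      unfolding G_def W_def using D
      by (simp add: restrict.hom_simps restrict_lift_lift restrict_form_on_E mult.commute)
    then show ?thesis using \<tau>_expand[OF g(2)] by (simp add: a_def)
  qed
  moreover have "G \<in> Rees"
    unfolding G_def using W_Rees z_Rees
    by (intro subring_set_sum[OF Rees_facts(2)] Rees(5) subring_set_power[OF Rees_facts(2)]) auto
  ultimately have "G \<in> closure_ideal scale B L I"
    using g(1) ideal_setD(2)[OF I] by (simp add: closure_ideal_def bihom_part_bigraded restrict.hom_zero)
  moreover have "W N = G + (- (\<Sum>i<N. ?z ^ (N - i) * W i))"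
    unfolding G_def by (simp add: atMost_Suc lessThan_Suc_atMost[symmetric])
  moreover have "- (\<Sum>i<N. ?z ^ (N - i) * W i) \<in> Exc"
    using tail by (intro ideal_set_uminus[OF Exc_facts(2) Rees_facts(2)] ideal_set_sum[OF Exc_facts(2)]) auto
  ultimately have "W N \<in> closure_ideal scale B L I <+>\<^bsub>rees_ring scale B L\<^esub> Exc"
    unfolding set_add_Rees by blast
  then have "lift (lift (lin_form B \<phi>)) ^ N * form_on_E D f \<in> closure_ideal scale B L I <+>\<^bsub>rees_ring scale B L\<^esub> Exc"
    by (simp add: W_def y_def f a_def)
  moreover have "l \<in> L" unfolding L by (rule range_eqI[of _ _ 1]) simp
  ultimately show "f \<in> Lambda_ideal scale B L I"
    unfolding Lambda_ideal_def
    using a[of N] D[of N] \<phi> \<phi>_l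
    by (intro CollectI conjI exI[of _ \<phi>] exI[of _ N] exI[of _ D] bexI[of _ l]) (auto simp: R_def f a_def)
qed

lemma Lambda_ideal_eq: "ideal_set (mpolys B) I \<Longrightarrow> Lambda_ideal scale B L I = all_leading I"
  using Lambda_ideal_subset all_leading_subset_Lambda by blast

end

section \<open>Dimensions\<close>

text \<open>By uniqueness of representations over the union, a nonzero coefficient would belong to a
  vector of both \<open>C\<close> and \<open>E\<close>.\<close>

lemma (in vector_space) span_disjoint:
  assumes D: "independent (C \<union> E)" and "C \<inter> E = {}" and x: "x \<in> span C" "x \<in> span E"
  shows "x = 0"
proof -
  let ?D = "C \<union> E"
  have "representation ?D x = representation C x" "representation ?D x = representation E x"
    using x by (auto intro!: representation_extend[OF D])
  then have "representation ?D x b = 0" for b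
    using representation_ne_zero[of C x b] representation_ne_zero[of E x b] assms(2) by force
  moreover have "x \<in> span ?D" using x(1) span_mono[of C ?D] by blast
  ultimately show "x = 0" using sum_nonzero_representation_eq[OF D, of x] by simp
qed

text \<open>\<open>dim\<close> counts a basis by \<open>card\<close>, which is 0 on infinite sets;
  the finite spanning set \<open>F\<close> excludes this degenerate value for
  \<open>T\<close>.\<close>

lemma (in vector_space) dim_le_of_subset:
  assumes "S \<subseteq> T" "T \<subseteq> span F" "finite F" shows "dim S \<le> dim T"
proof -
  obtain D where D: "D \<subseteq> T" "independent D" "T \<subseteq> span D" "card D = dim T"
    using basis_exists[of T] by metis
  have "finite D" using independent_span_bound[OF \<open>finite F\<close> D(2)] D(1) assms(2) by blast
  then show ?thesis using dim_le_card[of S D] D(3,4) assms(1) by auto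
qed

text \<open>\<open>E\<close> is what a basis \<open>C\<close> of \<open>K\<close> lacks to be a
  basis of \<open>W\<close>. Its span serves as a complement, once of a kernel and once of the
  intersection with an ideal.\<close>

lemma (in vector_space) basis_extending:
  assumes "K \<subseteq> W" "subspace W" "W \<subseteq> span F" "finite F"
  obtains C E where "C \<subseteq> K" "K \<subseteq> span C" "E \<subseteq> W" "C \<inter> E = {}" "independent (C \<union> E)" "finite (C \<union> E)"
    "W = span (C \<union> E)" "dim W = dim K + card E"
proof -
  obtain C where C: "C \<subseteq> K" "independent C" "K \<subseteq> span C"
    using maximal_independent_subset[of K] by metis
  obtain D where D: "C \<subseteq> D" "D \<subseteq> W" "independent D" "W \<subseteq> span D"
    using maximal_independent_subset_extend[of C W] C assms(1) by (metis subset_trans)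
  have fin: "finite D" using independent_span_bound[OF \<open>finite F\<close> D(3)] D(2) assms(3) by blast
  let ?E = "D - C"
  have CE: "C \<union> ?E = D" using D(1) by blast
  have "W = span D" using D(2,4) span_minimal[OF D(2) assms(2)] by blast
  moreover have "dim K = card C" using basis_card_eq_dim[OF C(1,3,2)] by simp
  moreover have "dim W = card D" using basis_card_eq_dim[OF D(2,4,3)] by simp
  moreover have "card D = card C + card ?E"
    using fin D(1) card_Un_disjoint[of C ?E] finite_subset[of C D] unfolding CE by auto
  ultimately show ?thesis
    using that[of C ?E] C D fin unfolding CE by auto
qed

text \<open>\<open>f\<close> is injective on the span of the \<open>E\<close> that complements the
  kernel, while \<open>C\<close> contributes nothing to the image.\<close>

lemma (in vector_space_pair) rank_nullity:
  assumes f: "Vector_Spaces.linear s1 s2 f"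
    and W: "vs1.subspace W" "W \<subseteq> vs1.span F" "finite F"
  shows "vs1.dim W = vs1.dim {x \<in> W. f x = 0} + vs2.dim (f ` W)"
proof -
  interpret f: Vector_Spaces.linear s1 s2 f by fact
  let ?K = "{x \<in> W. f x = 0}"
  have "?K \<subseteq> W" by blast
  then obtain C E where CE: "C \<subseteq> ?K" "?K \<subseteq> vs1.span C" "E \<subseteq> W" "C \<inter> E = {}"
    "vs1.independent (C \<union> E)" "finite (C \<union> E)" "W = vs1.span (C \<union> E)" "vs1.dim W = vs1.dim ?K + card E"
    by (rule vs1.basis_extending[OF _ W])
  have "x = 0" if "x \<in> vs1.span E" "f x = 0" for x
  proof -
    have "x \<in> ?K" using that CE(7) vs1.span_mono[of E "C \<union> E"] by auto
    then show "x = 0" using vs1.span_disjoint[OF CE(5,4)] CE(2) that(1) by blast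
  qed
  then have inj: "inj_on f (vs1.span E)"
    by (subst f.inj_on_iff_eq_0[OF vs1.subspace_span]) blast
  have "vs1.independent E" using CE(5) vs1.independent_mono by blast
  then have ind: "vs2.independent (f ` E)" by (rule f.independent_injective_image) (rule inj)
  have "f ` W = vs2.span (f ` C \<union> f ` E)" unfolding CE(7) f.span_image[symmetric] image_Un ..
  also have "\<dots> \<subseteq> vs2.span (f ` E)"
    using CE(1) by (intro vs2.span_minimal) (auto intro: vs2.span_base simp: vs2.span_zero)
  finally have "vs2.dim (f ` W) = card (f ` E)"
    by (rule vs2.basis_card_eq_dim[OF image_mono[OF CE(3)] _ ind, symmetric])
  also have "card (f ` E) = card E"
    by (rule card_image[OF inj_on_subset[OF inj vs1.span_superset]])
  finally show ?thesis using CE(8) by simp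
qed

section \<open>Forms of a fixed degree as a vector space\<close>

interpretation mp: vector_space "\<lambda>(c::'k::field) (p::('x, 'k) mpoly). const c * p"
  by unfold_locales (simp_all add: algebra_simps const.hom_simps)

interpretation mpp: vector_space_pair "\<lambda>(c::'k::field) (p::('x, 'k) mpoly). const c * p"
    "\<lambda>(c::'k::field) (p::('y, 'k) mpoly). const c * p" ..

definition forms :: "'x set \<Rightarrow> nat \<Rightarrow> ('x, 'k::field) mpoly set" where
  "forms B n = {p \<in> mpolys B. hom_part n p = p}"

text \<open>In degree n every exponent is at most n, so only finitely many monomials in the finite
  set \<open>B\<close> occur.\<close>

lemma forms_finite_dim:
  assumes "finite B"
  obtains F where "finite F" "(forms B n :: ('x, 'k::field) mpoly set) \<subseteq> mp.span F"
proof -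
  let ?M = "{m. Poly_Mapping.keys m \<subseteq> B \<and> weight (\<lambda>_. 1) m = n}"
  let ?F = "(\<lambda>m. Poly_Mapping.single m (1::'k)) ` ?M"
  have "Poly_Mapping.lookup m x \<le> weight (\<lambda>_. 1) m" for m and x :: 'x
    using member_le_sum[of x "Poly_Mapping.keys m" "Poly_Mapping.lookup m"]
    by (cases "x \<in> Poly_Mapping.keys m") (auto simp: weight_def in_keys_iff)
  then have "Poly_Mapping.lookup ` ?M \<subseteq> {f. \<forall>x. (x \<in> B \<longrightarrow> f x \<in> {..n}) \<and> (x \<notin> B \<longrightarrow> f x = 0)}"
    by (auto simp: in_keys_iff subset_iff)
  then have "finite (Poly_Mapping.lookup ` ?M)"
    by (rule finite_subset) (intro finite_set_of_finite_funs assms finite_atMost)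
  then have "finite ?M" by (rule finite_imageD) (rule inj_onI, rule poly_mapping_eqI, simp)
  moreover have "p \<in> mp.span ?F" if p: "p \<in> forms B n" for p :: "('x, 'k) mpoly"
  proof -
    have "Poly_Mapping.single m (Poly_Mapping.lookup p m) \<in> mp.span ?F" if m: "m \<in> Poly_Mapping.keys p" for m
    proof -
      have "Poly_Mapping.lookup (hom_part n p) m \<noteq> 0" using p m by (simp add: forms_def in_keys_iff)
      then have "weight (\<lambda>_. 1) m = n" by (simp add: lookup_graded_part split: if_splits)
      moreover have "Poly_Mapping.keys m \<subseteq> B" using p m by (auto simp: forms_def mpolys_def indets_def)
      ultimately have "const (Poly_Mapping.lookup p m) * Poly_Mapping.single m 1 \<in> mp.span ?F"
        by (intro mp.span_scale mp.span_base) auto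
      then show ?thesis by (simp add: const_def mult_single)
    qed
    then have "(\<Sum>m\<in>Poly_Mapping.keys p. Poly_Mapping.single m (Poly_Mapping.lookup p m)) \<in> mp.span ?F"
      by (intro mp.span_sum)
    then show ?thesis by (simp flip: mpoly_sum_monomials)
  qed
  ultimately show ?thesis using that[of ?F] by blast
qed

lemma subspace_ideal_forms:
  assumes "0 \<in> I" "\<And>p q. p \<in> I \<Longrightarrow> q \<in> I \<Longrightarrow> p + q \<in> I" "\<And>c p. p \<in> I \<Longrightarrow> const c * p \<in> I"
  shows "mp.subspace (forms B n \<inter> I)"
  unfolding mp.subspace_def forms_def
  using assms by (auto simp: graded_part_add graded_part_const_mult subring_setD[OF subring_mpolys] mpolys_const)


section \<open>The Hilbert series as a difference of dimensions\<close>

text \<open>Dimensions over a subfield are unique, and the image of this one in a nonzero quotient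
  is again a subfield.\<close>

lemma subfield_const:
  "subfield (range const) (poly_ring B :: ('x, 'k::field) mpoly ring)"
proof -
  let ?K = "range (const :: 'k \<Rightarrow> ('x, 'k) mpoly)"
  interpret cring "poly_ring B :: ('x, 'k) mpoly ring"
    unfolding poly_ring_eq by (rule cring_ring_on[OF subring_mpolys])
  have "subring_set ?K"
    unfolding subring_set_def
    by (auto intro: range_eqI[of _ const, OF const.hom_one[symmetric]] range_eqI[of _ const, OF const.hom_uminus[symmetric]]
        range_eqI[of _ const, OF const.hom_add[symmetric]] range_eqI[of _ const, OF const.hom_mult[symmetric]])
  then interpret K: cring "ring_on ?K" by (rule cring_ring_on)
  have "Poly_Mapping.lookup (const a :: ('x, 'k) mpoly) 0 = a" for a
    by (simp add: const_def)
  then have const_eq: "const a = (0 :: ('x, 'k) mpoly) \<longleftrightarrow> a = 0" for a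
    by (metis const.hom_zero)
  have "Units (ring_on ?K) = ?K - {0}"
  proof
    show "Units (ring_on ?K) \<subseteq> ?K - {0}"
      unfolding Units_def by auto
    show "?K - {0} \<subseteq> Units (ring_on ?K)"
    proof
      fix x assume "x \<in> ?K - {0}"
      then obtain c where c: "x = const c" "c \<noteq> 0" using const_eq by auto
      then have "const (inverse c) * x = 1" by (simp add: const.hom_one flip: const.hom_mult)
      then show "x \<in> Units (ring_on ?K)"
        unfolding Units_def using c by (auto simp: mult.commute)
    qed
  qed
  then have "field ((poly_ring B)\<lparr>carrier := ?K\<rparr>)"
    unfolding poly_ring_restrict_eq by (intro K.cring_fieldI) simp
  moreover have "?K \<subseteq> carrier (poly_ring B)" by (auto simp: poly_ring_eq mpolys_const)
  ultimately show ?thesis by (rule subfield_iff(1))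
qed

context
  fixes B :: "'x set" and I :: "('x, 'k::field) mpoly set"
  assumes I: "ideal_set (mpolys B) I"
begin

private abbreviation (input) "Q \<equiv> coord_quot B I"
private abbreviation (input) "cls p \<equiv> I +>\<^bsub>poly_ring B\<^esub> p"
private abbreviation (input) "K \<equiv> cls ` range const"

lemma ideal_poly_ring: "ideal I (poly_ring B)"
  using I by (simp add: poly_ring_eq ideal_ring_on[OF subring_mpolys])

lemma cring_poly_ring: "cring (poly_ring B :: ('x, 'k) mpoly ring)"
  unfolding poly_ring_eq by (rule cring_ring_on[OF subring_mpolys])

lemma cring_quot: "cring Q"
  unfolding coord_quot_def by (rule ideal.quotient_is_cring[OF ideal_poly_ring cring_poly_ring])

lemma ring_hom_cls: "ring_hom_ring (poly_ring B) Q (\<lambda>p. cls p)"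
  unfolding coord_quot_def by (rule ideal.rcos_ring_hom_ring[OF ideal_poly_ring])

lemma cls_eq_iff: "p \<in> mpolys B \<Longrightarrow> q \<in> mpolys B \<Longrightarrow> cls p = cls q \<longleftrightarrow> p - q \<in> I"
proof -
  assume p: "p \<in> mpolys B" and q: "q \<in> mpolys B"
  interpret cring "poly_ring B :: ('x, 'k) mpoly ring" by (rule cring_poly_ring)
  have "p \<ominus>\<^bsub>poly_ring B\<^esub> q = p - q"
    using a_inv_ring_on[OF subring_mpolys q] by (simp add: a_minus_def poly_ring_eq)
  then show ?thesis
    using quotient_eq_iff_same_a_r_cos[OF ideal_poly_ring, of p q] p q by (simp add: poly_ring_eq)
qed

lemma cls_simps:
  assumes "p \<in> mpolys B" "q \<in> mpolys B"
  shows "cls p \<in> carrier Q" "cls p \<otimes>\<^bsub>Q\<^esub> cls q = cls (p * q)" "cls p \<oplus>\<^bsub>Q\<^esub> cls q = cls (p + q)"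
    "\<zero>\<^bsub>Q\<^esub> = cls 0" "\<one>\<^bsub>Q\<^esub> = cls 1"
proof -
  interpret h: ring_hom_ring "poly_ring B" Q "\<lambda>p. cls p" by (rule ring_hom_cls)
  show "cls p \<in> carrier Q" "cls p \<otimes>\<^bsub>Q\<^esub> cls q = cls (p * q)" "cls p \<oplus>\<^bsub>Q\<^esub> cls q = cls (p + q)"
    "\<zero>\<^bsub>Q\<^esub> = cls 0" "\<one>\<^bsub>Q\<^esub> = cls 1"
    using h.hom_closed[of p] h.hom_mult[of p q] h.hom_add[of p q] h.hom_zero h.hom_one assms
    by (simp_all add: poly_ring_eq)
qed

lemma cls_power: "p \<in> mpolys B \<Longrightarrow> cls p [^]\<^bsub>Q\<^esub> (n::nat) = cls (p ^ n)"
proof (induction n)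
  case (Suc n)
  interpret Q: cring Q by (rule cring_quot)
  show ?case
    using Suc cls_simps(2)[of "p ^ n" p] subring_set_power[OF subring_mpolys Suc.prems, of n]
    by (simp add: mult.commute)
qed (use cls_simps(5) in simp)

lemma cls_eq_zero_iff: "p \<in> mpolys B \<Longrightarrow> cls p = \<zero>\<^bsub>Q\<^esub> \<longleftrightarrow> p \<in> I"
  using cls_eq_iff[of p 0] cls_simps(4)[of p p] by (simp add: subring_setD(2)[OF subring_mpolys])

text \<open>\<open>dimension\<close> grows by one line extension at a time, hence the induction over
  \<open>F\<close>. The last assumption keeps the class of each new vector out of the classes of the
  previous span.\<close>

lemma dimension_cls_span:
  assumes "finite F" "mp.independent F" "F \<subseteq> mpolys B" "\<And>p. p \<in> mp.span F \<Longrightarrow> p \<in> I \<Longrightarrow> p = 0"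
  shows "ring.dimension Q (card F) K (cls ` mp.span F)"
  using assms
proof (induction F rule: finite_induct)
  interpret Q: cring Q by (rule cring_quot)
  case empty
  have "\<zero>\<^bsub>Q\<^esub> = cls 0" using cls_simps(4)[of 0 0] by (simp add: subring_setD(2)[OF subring_mpolys])
  then show ?case using Q.zero_dim[of K] by simp
next
  interpret Q: cring Q by (rule cring_quot)
  case (insert f F)
  have sub: "mp.span F \<subseteq> mpolys B"
    using insert.prems(2) by (intro mp.span_minimal)
      (auto simp: mp.subspace_def subring_setD[OF subring_mpolys] mpolys_const)
  have f: "f \<in> mpolys B" using insert.prems(2) by simp
  have spans: "mp.span F \<subseteq> mp.span (insert f F)" by (intro mp.span_mono) auto
  have "f \<notin> mp.span F"
    using insert.prems(1) insert.hyps(2) by (simp add: mp.independent_insert)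
  have "cls f \<notin> cls ` mp.span F"
  proof
    assume "cls f \<in> cls ` mp.span F"
    then obtain s where s: "s \<in> mp.span F" "cls f = cls s" by blast
    then have fs: "f - s \<in> I" using cls_eq_iff[of f s] f sub by auto
    have "f - s \<in> mp.span (insert f F)"
      using s(1) spans by (intro mp.span_diff[OF mp.span_base]) (simp, blast)
    from insert.prems(3)[OF this fs] have "f = s" by simp
    then show False using s(1) \<open>f \<notin> mp.span F\<close> by simp
  qed
  moreover have "Q.dimension (card F) K (cls ` mp.span F)"
    using insert.IH insert.prems spans mp.independent_mono[of "insert f F" F] by blast
  ultimately have "Q.dimension (Suc (card F)) K (Q.line_extension K (cls f) (cls ` mp.span F))"
    using cls_simps(1)[OF f f] by (intro Q.Suc_dim)
  moreover have "Q.line_extension K (cls f) (cls ` mp.span F) = cls ` mp.span (insert f F)"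
  proof -
    have cf: "const c * f \<in> mpolys B" for c by (intro subring_setD[OF subring_mpolys] mpolys_const f)
    have "Q.line_extension K (cls f) (cls ` mp.span F) = {cls (const c * f + s) | c s. s \<in> mp.span F}"
    proof -
      have "K #>\<^bsub>Q\<^esub> cls f = {cls (const c * f) | c. True}"
        using cls_simps(2)[OF mpolys_const f] by (auto simp: r_coset_def)
      moreover have "cls (const c * f) \<oplus>\<^bsub>Q\<^esub> cls s = cls (const c * f + s)" if "s \<in> mp.span F" for c s
        using cls_simps(3)[OF cf] sub that by blast
      ultimately show ?thesis
        unfolding Q.line_extension_def set_add_def' by (auto; metis)
    qed
    also have "\<dots> = cls ` {const c * f + s | c s. s \<in> mp.span F}" by auto
    also have "{const c * f + s | c s. s \<in> mp.span F} = mp.span (insert f F)"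
      unfolding mp.span_insert by (auto, metis add_diff_cancel_left', metis diff_add_cancel add.commute)
    finally show ?thesis .
  qed
  ultimately show ?case using insert.hyps by simp
qed

text \<open>If I is the whole ring, the scalars collapse with the quotient and are no field. Then no
  vector lies outside the zero space, so no line extension is possible and both dimensions are
  0.\<close>

lemma dimension_unique:
  assumes "ring.dimension Q n K E" "ring.dimension Q m K E" shows "n = m"
proof -
  interpret Q: cring Q by (rule cring_quot)
  interpret h: ring_hom_ring "poly_ring B" Q "\<lambda>p. cls p" by (rule ring_hom_cls)
  show ?thesis
  proof (cases "\<one>\<^bsub>Q\<^esub> = \<zero>\<^bsub>Q\<^esub>")
    case False
    have "subfield K Q" by (rule h.img_is_subfield(2)[OF subfield_const False[symmetric, THEN not_sym]])
    then show ?thesis using Q.dimension_is_inj assms by blast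
  next
    case True
    then have carr: "carrier Q = {\<zero>\<^bsub>Q\<^esub>}" using Q.one_zeroD by simp
    have "n = 0 \<and> E = {\<zero>\<^bsub>Q\<^esub>}" if "Q.dimension n K E" for n E
      using that by (induction rule: Q.dimension.induct) (auto simp: carr)
    then show ?thesis using assms by blast
  qed
qed

text \<open>Modulo I the subspace \<open>W \<inter> I\<close> disappears and a complement of it
  embeds, so the dimension sought is that of the complement. The second claim makes the truncated
  difference a genuine one.\<close>

lemma dimension_the:
  assumes W: "mp.subspace W" "W \<subseteq> mpolys B" "W \<subseteq> mp.span F" "finite F"
  shows "(THE n. ring.dimension Q n K (cls ` W)) = mp.dim W - mp.dim (W \<inter> I)"
    "mp.dim (W \<inter> I) \<le> mp.dim W"
proof -
  have "W \<inter> I \<subseteq> W" by blast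
  then obtain C E where
    CE: "C \<subseteq> W \<inter> I" "W \<inter> I \<subseteq> mp.span C" "E \<subseteq> W" "C \<inter> E = {}" "mp.independent (C \<union> E)" "finite (C \<union> E)"
    "W = mp.span (C \<union> E)" "mp.dim W = mp.dim (W \<inter> I) + card E"
    by (rule mp.basis_extending[OF _ W(1,3,4)])
  have EW: "mp.span E \<subseteq> W" unfolding CE(7) by (rule mp.span_mono) simp
  have "p = 0" if "p \<in> mp.span E" "p \<in> I" for p
    using mp.span_disjoint[OF CE(5,4)] that EW CE(2) by blast
  then have "ring.dimension Q (card E) K (cls ` mp.span E)"
    using CE W(2) mp.independent_mono[OF CE(5), of E] by (intro dimension_cls_span) auto
  moreover have "cls ` mp.span E = cls ` W"
  proof
    show "cls ` mp.span E \<subseteq> cls ` W" using EW by blast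
    have "mp.span C \<subseteq> I"
      using CE(1) by (intro mp.span_minimal) (auto simp: mp.subspace_def mpolys_const ideal_setD[OF I])
    show "cls ` W \<subseteq> cls ` mp.span E"
    proof clarify
      fix w assume w: "w \<in> W"
      then obtain c e where ce: "w = c + e" "c \<in> mp.span C" "e \<in> mp.span E"
        unfolding CE(7) mp.span_Un by blast
      then have "cls w = cls e"
        using cls_eq_iff[of w e] w W(2) EW \<open>mp.span C \<subseteq> I\<close> by auto
      then show "cls w \<in> cls ` mp.span E" using ce(3) by blast
    qed
  qed
  ultimately have "ring.dimension Q (card E) K (cls ` W)" by simp
  then have "(THE n. ring.dimension Q n K (cls ` W)) = card E"
    using dimension_unique by (intro the_equality) auto
  then show "(THE n. ring.dimension Q n K (cls ` W)) = mp.dim W - mp.dim (W \<inter> I)"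
    "mp.dim (W \<inter> I) \<le> mp.dim W" using CE(8) by simp_all
qed

lemma hilbert_series_nth:
  assumes "finite B"
  shows "fps_nth (hilbert_series B I) n = int (mp.dim (forms B n :: ('x, 'k) mpoly set)) - int (mp.dim (forms B n \<inter> I))"
proof -
  obtain F where F: "finite F" "(forms B n :: ('x, 'k) mpoly set) \<subseteq> mp.span F"
    using forms_finite_dim[OF assms] by blast
  have sub: "mp.subspace (forms B n :: ('x, 'k) mpoly set)" "forms B n \<subseteq> mpolys B"
    using subspace_ideal_forms[of UNIV B n] by (auto simp: forms_def)
  have eq: "{f \<in> carrier (poly_ring B). hom_part n f = f} = (forms B n :: ('x, 'k) mpoly set)"
    by (simp add: forms_def poly_ring_eq)
  show ?thesis
    unfolding hilbert_series_def fps_nth_Abs_fps eq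
    using dimension_the[OF sub F(2,1)] by (simp add: image_image of_nat_diff)
qed

end

section \<open>The comparison with the flat limit\<close>

context split_line
begin

text \<open>The intersection is formed layer by layer: \<open>times_zero_ideal\<close> constrains
  layer 0 only, and J_0 is contained in the union of all J_c.\<close>

lemma union_ideal_eq:
  assumes I: "ideal_set (mpolys B) I"
  shows "union_ideal scale B {v. \<phi> v = 0} L I =
    layered (\<lambda>i. if i = 0 then leading_ideal I 0 else all_leading I)"
proof -
  note J = leading_ideal_ideal[OF I, of 0] and JJ = all_leading_ideal[OF I]
  have "leading_ideal I 0 \<subseteq> all_leading I" by (auto simp: all_leading_def)
  moreover have "all_leading I \<subseteq> R" using ideal_setD(1)[OF JJ] .
  ultimately have "(if i = 0 then leading_ideal I 0 else R) \<inter> all_leading I =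
      (if i = 0 then leading_ideal I 0 else all_leading I)" for i :: nat
    by (cases "i = 0") (simp_all add: inf.absorb1 inf.absorb2)
  moreover have "layered K \<inter> layered K' = layered (\<lambda>i. K i \<inter> K' i)" for K K'
    by (auto simp: layered_def)
  ultimately show ?thesis
    by (simp only: union_ideal_def Pi_ideal_eq[OF I] Lambda_ideal_eq[OF I]
        times_zero_ideal_eq[OF J] times_L_ideal_eq[OF JJ])
qed

lemma leading_layers_subset:
  "layered (leading_ideal I) \<subseteq> layered (\<lambda>i. if i = 0 then leading_ideal I 0 else all_leading I)"
  by (auto simp: layered_def all_leading_def)

lemma leading_layers_ideal:
  assumes I: "ideal_set (mpolys B) I" shows "ideal_set (mpolys B) (layered (leading_ideal I))"
  by (rule layered_ideal[OF leading_ideal_ideal[OF I] leading_ideal_mono[OF I]])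

text \<open>With m = N + 1, f lies in J_m, so f y^m is in the limit; the factor f^(m-1) y^((i-1)m)
  turns it into (f y^i)^m.\<close>

lemma power_in_leading_layers:
  assumes I: "ideal_set (mpolys B) I" and f: "f \<in> all_leading I" and i: "i \<noteq> 0"
  obtains N where "(f * y ^ i) ^ Suc N \<in> layered (leading_ideal I)"
proof -
  note M = leading_layers_ideal[OF I]
  obtain N where "f \<in> leading_ideal I N" using f by (auto simp: all_leading_def)
  then have "f \<in> leading_ideal I (Suc N)" using leading_ideal_Suc[OF I] by blast
  then have "f * y ^ Suc N \<in> layered (leading_ideal I)"
    by (intro layered_monom leading_ideal_ideal I)
  moreover have "f ^ N * y ^ ((i - 1) * Suc N) \<in> mpolys B"
    using ideal_setD(3)[OF all_leading_ideal[OF I] f] R_mpolys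
    by (intro subring_setD(5)[OF subring_mpolys] subring_set_power[OF subring_mpolys] y_mpolys) auto
  ultimately have "f ^ N * y ^ ((i - 1) * Suc N) * (f * y ^ Suc N) \<in> layered (leading_ideal I)"
    using ideal_setD(5)[OF M] by blast
  also have "f ^ N * y ^ ((i - 1) * Suc N) * (f * y ^ Suc N) = f ^ Suc N * y ^ ((i - 1) * Suc N + Suc N)"
    by (simp only: power_add power_Suc mult_ac)
  also have "(i - 1) * Suc N + Suc N = i * Suc N" using i by (cases i) (simp_all add: One_nat_def)
  also have "f ^ Suc N * y ^ (i * Suc N) = (f * y ^ i) ^ Suc N"
    by (simp only: power_mult_distrib power_mult)
  finally show thesis by (rule that)
qed

text \<open>Layer 0 is the same in both ideals, and in the other layers a power of each f y^i lies
  in the limit. Applied with \<open>M\<close> prime for (b), and with \<open>M\<close> the limit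
  itself for (d).\<close>

lemma union_layers_subset:
  assumes I: "ideal_set (mpolys B) I" and M: "ideal_set (mpolys B) M" "layered (leading_ideal I) \<subseteq> M"
    and root: "\<And>p N. p \<in> mpolys B \<Longrightarrow> p ^ Suc N \<in> M \<Longrightarrow> p \<in> M"
  shows "layered (\<lambda>i. if i = 0 then leading_ideal I 0 else all_leading I) \<subseteq> M"
proof (rule layered_minimal[OF M(1)])
  fix i :: nat and f assume f: "f \<in> (if i = 0 then leading_ideal I 0 else all_leading I)"
  show "f * y ^ i \<in> M"
  proof (cases "i = 0")
    case True
    then have "f * y ^ i \<in> layered (leading_ideal I)"
      using f leading_ideal_ideal[OF I] by (intro layered_monom) auto
    then show ?thesis using M(2) by blast
  next
    case False
    then obtain N where "(f * y ^ i) ^ Suc N \<in> layered (leading_ideal I)"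
      using f power_in_leading_layers[OF I, of f i] by auto
    moreover have "f * y ^ i \<in> mpolys B"
      using f False ideal_setD(3)[OF all_leading_ideal[OF I]] by (intro R_power_mpolys) auto
    ultimately show ?thesis using root M(2) by blast
  qed
qed

lemma points_eq:
  assumes I: "ideal_set (mpolys B) I"
  shows "points (poly_ring B) (layered (leading_ideal I)) =
    points (poly_ring B) (layered (\<lambda>i. if i = 0 then leading_ideal I 0 else all_leading I))" (is "_ = points _ ?U")
proof
  show "points (poly_ring B) ?U \<subseteq> points (poly_ring B) (layered (leading_ideal I))"
    using leading_layers_subset[of I] by (auto simp: points_def)
  show "points (poly_ring B) (layered (leading_ideal I)) \<subseteq> points (poly_ring B) ?U"
  proof
    fix M assume "M \<in> points (poly_ring B) (layered (leading_ideal I))"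
    then have prime: "primeideal M (poly_ring B)" and sub: "layered (leading_ideal I) \<subseteq> M" by (auto simp: points_def)
    interpret M: primeideal M "poly_ring B" by (rule prime)
    have M: "ideal_set (mpolys B) M"
      using M.ideal_axioms by (simp add: poly_ring_eq ideal_ring_on[OF subring_mpolys])
    have root: "p \<in> M" if p: "p \<in> mpolys B" "p ^ Suc N \<in> M" for p N
      using p(2)
    proof (induction N)
      case (Suc N)
      then have "p \<in> M \<or> p ^ Suc N \<in> M"
        using M.I_prime[of p "p ^ Suc N"] p(1) subring_set_power[OF subring_mpolys p(1), of "Suc N"]
        by (simp add: poly_ring_eq)
      then show ?case using Suc.IH by blast
    qed simp
    have "?U \<subseteq> M" by (rule union_layers_subset[OF I M sub root])
    then show "M \<in> points (poly_ring B) ?U" using prime by (simp add: points_def)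
  qed
qed

lemma reduced_leading_layers:
  assumes I: "ideal_set (mpolys B) I"
    and red: "reduced_ring (coord_quot B (layered (leading_ideal I)))"
  shows "layered (leading_ideal I) = layered (\<lambda>i. if i = 0 then leading_ideal I 0 else all_leading I)"
proof
  note M = leading_layers_ideal[OF I]
  \<comment> \<open>A power of \<open>p\<close> in the ideal makes the class of \<open>p\<close>
    nilpotent, hence zero in a reduced quotient.\<close>
  have root: "p \<in> layered (leading_ideal I)" if "p \<in> mpolys B" "p ^ Suc N \<in> layered (leading_ideal I)" for p N
    using red that cls_power[OF M that(1), of "Suc N"] cls_simps(1)[OF M that(1) that(1)]
      cls_eq_zero_iff[OF M that(1)] cls_eq_zero_iff[OF M subring_set_power[OF subring_mpolys that(1)], of "Suc N"]
    unfolding reduced_ring_def by metis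
  show "layered (\<lambda>i. if i = 0 then leading_ideal I 0 else all_leading I) \<subseteq> layered (leading_ideal I)"
    by (rule union_layers_subset[OF I M subset_refl root])
qed (rule leading_layers_subset)


section \<open>Hilbert series\<close>

text \<open>The part of degree d of a coefficient of y^c is the coefficient of y^c in the part of
  degree d + c, which again lies in I and has no larger degree in y.\<close>

lemma homogeneous_leading:
  assumes I: "ideal_set (mpolys B) I" and hom: "homogeneous_ideal I"
  shows "homogeneous_ideal (leading_ideal I c)" "homogeneous_ideal (all_leading I)"
proof -
  have *: "hom_part d f \<in> leading_ideal I c" if f: "f \<in> leading_ideal I c" for f :: "('v, 'k) mpoly" and d c
  proof -
    obtain g where g: "f = coeff (\<tau> g) c" "g \<in> I" "degree (\<tau> g) \<le> c"
      using f by (auto simp: leading_ideal_def)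
    note coeff = coeff_\<tau>_hom_part[OF ideal_setD(3)[OF I g(2)], of "d + c"]
    have "degree (\<tau> (hom_part (d + c) g)) \<le> c"
      using g(3) by (intro degree_le) (simp add: coeff coeff_eq_0)
    then show ?thesis
      unfolding leading_ideal_def using hom g(1,2)
      by (intro CollectI exI[of _ "hom_part (d + c) g"]) (simp add: coeff homogeneous_ideal_def)
  qed
  then show "homogeneous_ideal (leading_ideal I c)" "homogeneous_ideal (all_leading I)"
    by (auto simp: homogeneous_ideal_def all_leading_def)
qed

text \<open>Filter the forms of degree n in I by their degree in y. Taking the coefficient of y^c
  maps the elements of degree at most c onto the forms of degree n - c in J_c, and the kernel is the
  previous step.\<close>

lemma dim_forms_ideal:
  assumes I: "ideal_set (mpolys B) I" and hom: "homogeneous_ideal I"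
  shows "mp.dim (forms B n \<inter> I) = (\<Sum>c\<le>n. mp.dim (forms B (n - c) \<inter> leading_ideal I c))"
proof -
  \<comment> \<open>Degree less than c in y, so that \<open>W 0\<close> is zero and
    \<open>W (Suc n)\<close> contains all forms of degree n in I.\<close>
  define W where "W c = {g \<in> forms B n \<inter> I. \<forall>i\<ge>c. coeff (\<tau> g) i = 0}" for c
  obtain F where F: "finite F" "(forms B n :: ('v, 'k) mpoly set) \<subseteq> mp.span F"
    using forms_finite_dim[OF V.finite_Basis] by blast
  have IB: "p \<in> mpolys B" if "p \<in> I" for p using ideal_setD(3)[OF I that] .
  have sub_I: "mp.subspace (forms B n \<inter> I)"
    by (intro subspace_ideal_forms ideal_setD(2,4,5)[OF I] mpolys_const)
  have sub_W: "mp.subspace (W c)" for c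
    using sub_I unfolding mp.subspace_def W_def by (auto simp: \<tau>.hom_simps)
  have lin: "Vector_Spaces.linear (\<lambda>c p. const c * p) (\<lambda>c p. const c * p) (\<lambda>p. coeff (\<tau> p) c)" for c
    unfolding Vector_Spaces.linear_iff by (simp add: mp.vector_space_axioms \<tau>.hom_simps)
  have step: "mp.dim (W (Suc c)) = mp.dim (W c) + mp.dim (forms B (n - c) \<inter> leading_ideal I c)" if "c \<le> n" for c
  proof -
    have kernel: "{g \<in> W (Suc c). coeff (\<tau> g) c = 0} = W c"
    proof -
      have "(\<forall>i\<ge>c. Q i) \<longleftrightarrow> Q c \<and> (\<forall>i\<ge>Suc c. Q i)" for Q :: "nat \<Rightarrow> bool"
        by (metis Suc_leD le_antisym not_less_eq_eq order_refl)
      then show ?thesis by (auto simp: W_def)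
    qed
    have "(\<lambda>g. coeff (\<tau> g) c) ` W (Suc c) = forms B (n - c) \<inter> leading_ideal I c"
    proof (intro equalityI subsetI)
      fix a assume "a \<in> (\<lambda>g. coeff (\<tau> g) c) ` W (Suc c)"
      then obtain g where g: "a = coeff (\<tau> g) c" "g \<in> W (Suc c)" by blast
      then have gI: "g \<in> I" "hom_part n g = g" "\<And>i. i > c \<Longrightarrow> coeff (\<tau> g) i = 0"
        by (auto simp: W_def forms_def Suc_le_eq)
      have "hom_part (n - c) a = a"
        using coeff_\<tau>_hom_part[OF IB[OF gI(1)], of n c] \<open>c \<le> n\<close> gI(2) g(1) by simp
      moreover have "a \<in> mpolys B" using g(1) coeff_\<tau>_R[OF IB[OF gI(1)]] R_mpolys by auto
      moreover have "a \<in> leading_ideal I c"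
        using g(1) gI unfolding leading_ideal_def by (auto intro!: degree_le)
      ultimately show "a \<in> forms B (n - c) \<inter> leading_ideal I c" by (simp add: forms_def)
    next
      fix a assume "a \<in> forms B (n - c) \<inter> leading_ideal I c"
      then obtain g where g: "a = coeff (\<tau> g) c" "g \<in> I" "degree (\<tau> g) \<le> c" "hom_part (n - c) a = a"
        by (auto simp: leading_ideal_def forms_def)
      note coeff = coeff_\<tau>_hom_part[OF IB[OF g(2)], of n]
      \<comment> \<open>The part of degree n of \<open>g\<close> is the preimage of
        \<open>a\<close>: its coefficient of y^c is the part of degree n - c of \<open>a\<close>,
        which is \<open>a\<close>.\<close>
      have "hom_part n g \<in> W (Suc c)"
        using hom g(2,3) IB[OF g(2)] coeff
        by (auto simp: W_def forms_def homogeneous_ideal_def graded_part_graded_part graded_part_mpolys coeff_eq_0)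
      moreover have "a = coeff (\<tau> (hom_part n g)) c" using coeff g(1,4) \<open>c \<le> n\<close> by simp
      ultimately show "a \<in> (\<lambda>g. coeff (\<tau> g) c) ` W (Suc c)" by blast
    qed
    moreover have "W (Suc c) \<subseteq> mp.span F" using F(2) by (auto simp: W_def)
    ultimately show ?thesis
      using mpp.rank_nullity[OF lin sub_W _ F(1), of "Suc c" c] by (simp add: kernel)
  qed
  have "mp.dim (W c) = (\<Sum>i<c. mp.dim (forms B (n - i) \<inter> leading_ideal I i))" if "c \<le> Suc n" for c
    using that
  proof (induction c)
    case 0
    have "p = 0" if "\<forall>i. coeff (\<tau> p) i = 0" for p
      using that \<tau>_expand[of p "degree (\<tau> p)"] by simp
    then have "W 0 = {0}"
      using ideal_setD(2)[OF I]
      by (auto simp: W_def \<tau>.hom_zero forms_def subring_setD(2)[OF subring_mpolys])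
    then show ?case
      using mp.basis_card_eq_dim[of "{}" "{0 :: ('v, 'k) mpoly}"] by (simp add: mp.independent_empty)
  next
    case (Suc c)
    then show ?case using step[of c] by simp
  qed
  from this[of "Suc n"] have "mp.dim (W (Suc n)) = (\<Sum>c\<le>n. mp.dim (forms B (n - c) \<inter> leading_ideal I c))"
    by (simp add: lessThan_Suc_atMost)
  moreover have "W (Suc n) = forms B n \<inter> I"
  proof -
    have "coeff (\<tau> g) i = 0" if "g \<in> forms B n" "i > n" for g i
      using coeff_\<tau>_hom_part[of g n i] that by (auto simp: forms_def)
    then show ?thesis by (auto simp: W_def Suc_le_eq)
  qed
  ultimately show ?thesis by simp
qed

lemma leading_ideal_layered:
  assumes K: "ideal_set R K" shows "leading_ideal (layered (\<lambda>_. K)) c = K"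
proof (intro equalityI subsetI)
  fix f assume "f \<in> K"
  then have "f * y ^ c \<in> layered (\<lambda>_. K)" "\<tau> (f * y ^ c) = monom f c"
    using K ideal_setD(3)[OF K] by (auto intro: layered_monom \<tau>_R_power)
  then show "f \<in> leading_ideal (layered (\<lambda>_. K)) c"
    unfolding leading_ideal_def by (intro CollectI exI[of _ "f * y ^ c"]) (simp add: degree_monom_le)
qed (auto simp: leading_ideal_def layered_def)

lemma layered_R: "layered (\<lambda>_. R) = mpolys B"
  by (auto simp: layered_def coeff_\<tau>_R)

lemma homogeneous_layered:
  assumes "ideal_set R K" "homogeneous_ideal K" shows "homogeneous_ideal (layered (\<lambda>_. K))"
  using assms(2) ideal_setD(2)[OF assms(1)]
  by (auto simp: homogeneous_ideal_def layered_def graded_part_mpolys coeff_\<tau>_hom_part)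

text \<open>For a homogeneous ideal K of k[V/L] this is the Hilbert function of k[V/L]/K.\<close>

definition codim :: "('v, 'k) mpoly set \<Rightarrow> nat \<Rightarrow> int" where
  "codim K m = int (mp.dim (forms B m \<inter> R)) - int (mp.dim (forms B m \<inter> K))"

lemma codim_antimono: "K \<subseteq> K' \<Longrightarrow> codim K' m \<le> codim K m"
proof -
  assume "K \<subseteq> K'"
  obtain F where F: "finite F" "(forms B m :: ('v, 'k) mpoly set) \<subseteq> mp.span F"
    using forms_finite_dim[OF V.finite_Basis] by blast
  have "mp.dim (forms B m \<inter> K) \<le> mp.dim (forms B m \<inter> K')"
    using \<open>K \<subseteq> K'\<close> F by (intro mp.dim_le_of_subset[OF _ _ F(1)]) auto
  then show ?thesis by (simp add: codim_def)
qed

text \<open>\<open>dim_forms_ideal\<close> applies both to I and to the whole ring, whose leading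
  ideals all equal \<open>R\<close>; subtract and substitute m = n - c.\<close>

lemma hilbert_series_leading:
  assumes I: "ideal_set (mpolys B) I" and hom: "homogeneous_ideal I"
  shows "fps_nth (hilbert_series B I) n = (\<Sum>m\<le>n. codim (leading_ideal I (n - m)) m)"
proof -
  have A: "ideal_set (mpolys B) (mpolys B)" "homogeneous_ideal (mpolys B)"
    using subring_setD[OF subring_mpolys[of B]]
    by (auto simp: ideal_set_def homogeneous_ideal_def graded_part_mpolys)
  have "leading_ideal (mpolys B) c = R" for c
    using leading_ideal_layered[OF ideal_set_R] by (simp add: layered_R)
  moreover have "forms B n \<inter> mpolys B = (forms B n :: ('v, 'k) mpoly set)" by (auto simp: forms_def)
  ultimately have "mp.dim (forms B n :: ('v, 'k) mpoly set) = (\<Sum>c\<le>n. mp.dim (forms B (n - c) \<inter> R))"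
    using dim_forms_ideal[OF A, of n] by simp
  then have "fps_nth (hilbert_series B I) n = (\<Sum>c\<le>n. codim (leading_ideal I c) (n - c))"
    by (simp add: hilbert_series_nth[OF I V.finite_Basis] dim_forms_ideal[OF I hom] codim_def sum_subtractf)
  also have "\<dots> = (\<Sum>m\<le>n. codim (leading_ideal I (n - m)) m)"
    by (rule sum.reindex_bij_witness[of _ "\<lambda>c. n - c" "\<lambda>c. n - c"]) auto
  finally show ?thesis .
qed

text \<open>All layers equal \<open>K\<close>, so partial sums of a Hilbert function arise: the
  factor L divides the series by 1 - s.\<close>

lemma hilbert_series_times_L:
  assumes K: "ideal_set R K" and hom: "homogeneous_ideal K"
  shows "fps_nth (hilbert_series B (times_L_ideal B K)) n = (\<Sum>m\<le>n. codim K m)"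
proof -
  have "ideal_set (mpolys B) (layered (\<lambda>_. K))" using K by (intro layered_ideal) auto
  from hilbert_series_leading[OF this homogeneous_layered[OF K hom], of n] show ?thesis
    by (simp add: times_L_ideal_eq[OF K] leading_ideal_layered[OF K])
qed

text \<open>The factor 1 - s undoes the partial sums for Pi, while the factor s shifts those for
  Lambda, which therefore stop before n.\<close>

lemma hilbert_series_bound_nth:
  assumes I: "ideal_set (mpolys B) I" and hom: "homogeneous_ideal I"
  shows "fps_nth ((1 - fps_X) * hilbert_series B (times_L_ideal B (Pi_ideal scale B L I)) +
     fps_X * hilbert_series B (times_L_ideal B (Lambda_ideal scale B L I))) n =
     codim (leading_ideal I 0) n + (\<Sum>m<n. codim (all_leading I) m)"
proof -
  note h = hilbert_series_times_L[OF leading_ideal_ideal[OF I] homogeneous_leading(1)[OF I hom]]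
    hilbert_series_times_L[OF all_leading_ideal[OF I] homogeneous_leading(2)[OF I hom]]
  show ?thesis
    unfolding Pi_ideal_eq[OF I] Lambda_ideal_eq[OF I]
    by (cases n) (simp_all add: left_diff_distrib h lessThan_Suc_atMost)
qed

text \<open>The term m = n belongs to J_0; all others have a positive index n - m and are compared
  with Lambda.\<close>

lemma hilbert_series_split:
  assumes I: "ideal_set (mpolys B) I" and hom: "homogeneous_ideal I"
  shows "fps_nth (hilbert_series B I) n = 
     codim (leading_ideal I 0) n + (\<Sum>m<n. codim (leading_ideal I (n - m)) m)"
proof -
  have "{..n} = insert n {..<n}" by auto
  then show ?thesis by (simp add: hilbert_series_leading[OF I hom])
qed

text \<open>The Pi terms agree, and elsewhere J_(n-m) is contained in the union of all J_c, which
  has the smaller codimension.\<close>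

lemma hilbert_series_ge:
  assumes I: "ideal_set (mpolys B) I" and hom: "homogeneous_ideal I"
  shows "fps_nth (hilbert_series B I) n \<ge> 
    fps_nth ((1 - fps_X) * hilbert_series B (times_L_ideal B (Pi_ideal scale B L I)) +
     fps_X * hilbert_series B (times_L_ideal B (Lambda_ideal scale B L I))) n"
  unfolding hilbert_series_bound_nth[OF I hom] hilbert_series_split[OF I hom]
  by (intro add_left_mono sum_mono codim_antimono) (auto simp: all_leading_def)

text \<open>Test the equality of ideals on f y^c: for c > 0 every f in the union of the J_m then
  lies in J_c, so the two sums agree term by term.\<close>

lemma hilbert_series_eq:
  assumes I: "ideal_set (mpolys B) I" and hom: "homogeneous_ideal I"
    and eq: "layered (leading_ideal I) = layered (\<lambda>i. if i = 0 then leading_ideal I 0 else all_leading I)"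
  shows "hilbert_series B I =
    (1 - fps_X) * hilbert_series B (times_L_ideal B (Pi_ideal scale B L I)) +
     fps_X * hilbert_series B (times_L_ideal B (Lambda_ideal scale B L I))"
proof (rule fps_ext)
  fix n
  have "leading_ideal I c = all_leading I" if "c \<noteq> 0" for c
  proof
    show "leading_ideal I c \<subseteq> all_leading I" by (auto simp: all_leading_def)
    show "all_leading I \<subseteq> leading_ideal I c"
    proof
      fix f assume f: "f \<in> all_leading I"
      then have "f * y ^ c \<in> layered (leading_ideal I)"
        unfolding eq using that leading_ideal_ideal[OF I] all_leading_ideal[OF I] by (intro layered_monom) auto
      then show "f \<in> leading_ideal I c"
        using \<tau>_R_power[OF ideal_setD(3)[OF all_leading_ideal[OF I] f], of c] by (auto simp: layered_def dest: spec[of _ c])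
    qed
  qed
  then have "(\<Sum>m<n. codim (leading_ideal I (n - m)) m) = (\<Sum>m<n. codim (all_leading I) m)"
    by (intro sum.cong) auto
  then show "fps_nth (hilbert_series B I) n =
    fps_nth ((1 - fps_X) * hilbert_series B (times_L_ideal B (Pi_ideal scale B L I)) +
     fps_X * hilbert_series B (times_L_ideal B (Lambda_ideal scale B L I))) n"
    unfolding hilbert_series_bound_nth[OF I hom] hilbert_series_split[OF I hom] by simp
qed

end


section \<open>Choice of coordinates\<close>

lemma (in vector_space) line_spanned:
  assumes "subspace L" "dim L = 1"
  obtains l where "L = range (\<lambda>c. scale c l)" "l \<noteq> 0"
proof -
  obtain C where C: "C \<subseteq> L" "independent C" "L \<subseteq> span C" "card C = dim L"
    using basis_exists[of L] by metis
  then obtain l where l: "C = {l}" using assms(2) by (auto simp: card_1_singleton_iff One_nat_def)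
  have "L = span {l}" using C l span_minimal[OF C(1) assms(1)] by auto
  moreover have "l \<noteq> 0" using C(2) l by auto
  ultimately show thesis using that[of l] by (simp add: span_singleton)
qed

text \<open>Some coordinate of a nonzero vector \<open>l\<close> is nonzero; dividing that
  coordinate by its value at \<open>l\<close> gives \<phi>.\<close>

lemma split_line_of_line:
  assumes V: "finite_dimensional_vector_space scale B" and L: "module.subspace scale L" "vector_space.dim scale L = 1"
  obtains l \<phi> where "split_line scale B L l \<phi>"
proof -
  interpret V: finite_dimensional_vector_space scale B by (rule V)
  obtain l where l: "L = range (\<lambda>c. scale c l)" "l \<noteq> 0" using V.line_spanned[OF L] .
  have vs: "vector_space ((*) :: 'a \<Rightarrow> 'a \<Rightarrow> 'a)" by unfold_locales (simp_all add: algebra_simps)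
  have "\<exists>b. V.representation B l b \<noteq> 0"
  proof (rule ccontr)
    assume "\<nexists>b. V.representation B l b \<noteq> 0"
    then show False
      using V.sum_nonzero_representation_eq[OF V.independent_Basis, of l] l(2) by (simp add: V.span_Basis)
  qed
  then obtain b where b: "V.representation B l b \<noteq> 0" by blast
  let ?\<phi> = "\<lambda>v. V.representation B v b / V.representation B l b"
  have "Vector_Spaces.linear scale (*) ?\<phi>"
    unfolding Vector_Spaces.linear_iff using vs V.vector_space_axioms
    by (simp add: V.representation_add V.representation_scale V.independent_Basis V.span_Basis add_divide_distrib)
  then have "split_line scale B L l ?\<phi>"
    using V l b by (intro split_line.intro) auto
  then show thesis by (rule that)
qed

text \<open>\<phi>(v) is the scalar c with v - c l in H. It exists because H + L is everything and
  is unique because H \<inter> L is zero; linearity follows from uniqueness.\<close>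

lemma split_line_of_complement:
  assumes V: "finite_dimensional_vector_space scale B" and L: "module.subspace scale L" "vector_space.dim scale L = 1"
    and H: "complementary scale H L"
  obtains l \<phi> where "split_line scale B L l \<phi>" "H = {v. \<phi> v = 0}"
proof -
  interpret V: finite_dimensional_vector_space scale B by (rule V)
  obtain l where l: "L = range (\<lambda>c. scale c l)" "l \<noteq> 0" using V.line_spanned[OF L] .
  have sub: "V.subspace H" and int: "H \<inter> L = {0}" and sum: "{h + l | h l. h \<in> H \<and> l \<in> L} = UNIV"
    using H by (auto simp: complementary_def)
  have vs: "vector_space ((*) :: 'a \<Rightarrow> 'a \<Rightarrow> 'a)" by unfold_locales (simp_all add: algebra_simps)
  have unique: "c = d" if "v - scale c l \<in> H" "v - scale d l \<in> H" for v c d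
  proof -
    have "scale (d - c) l \<in> H"
      using V.subspace_diff[OF sub that] by (simp add: V.scale_left_diff_distrib)
    then have "scale (d - c) l = 0" using int l(1) by blast
    then show "c = d" using l(2) by simp
  qed
  have exists: "\<exists>c. v - scale c l \<in> H" for v
  proof -
    have "v \<in> {h + l | h l. h \<in> H \<and> l \<in> L}" using sum by simp
    then obtain h c where "v = h + scale c l" "h \<in> H" using l(1) by blast
    then show ?thesis by (intro exI[of _ c]) simp
  qed
  then obtain \<phi> where \<phi>: "\<And>v. v - scale (\<phi> v) l \<in> H" by metis
  have \<phi>_eq: "\<phi> v = c" if "v - scale c l \<in> H" for v c using unique[OF \<phi> that] .
  have "\<phi> (v + w) = \<phi> v + \<phi> w" for v w
    using V.subspace_add[OF sub \<phi>[of v] \<phi>[of w]]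
    by (intro \<phi>_eq) (simp add: V.scale_left_distrib algebra_simps)
  moreover have "\<phi> (scale c v) = c * \<phi> v" for c v
    using V.subspace_scale[OF sub \<phi>[of v], of c]
    by (intro \<phi>_eq) (simp add: V.scale_right_diff_distrib)
  ultimately have "Vector_Spaces.linear scale (*) \<phi>"
    unfolding Vector_Spaces.linear_iff using vs V.vector_space_axioms by simp
  moreover have "\<phi> l = 1" using V.subspace_0[OF sub] by (intro \<phi>_eq) simp
  ultimately have "split_line scale B L l \<phi>"
    using V l by (intro split_line.intro) auto
  moreover have "H = {v. \<phi> v = 0}"
    using \<phi>_eq[of _ 0] \<phi> by (auto, metis V.scale_zero_left diff_zero)
  ultimately show thesis by (rule that)
qed

theorem theorem2p2:
  fixes scale :: "'k::field \<Rightarrow> 'v::ab_group_add \<Rightarrow> 'v"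
    and B L :: "'v set"
    and I :: "('v, 'k) mpoly set"
  assumes V: "finite_dimensional_vector_space scale B"
    and X: "ideal I (poly_ring B)"
    and L: "module.subspace scale L" "vector_space.dim scale L = 1"
  shows
    "(\<forall>H. complementary scale H L \<longrightarrow>
        flat_limit_ideal scale B H L I \<subseteq> union_ideal scale B H L I)
     \<and>
     (\<forall>H. complementary scale H L \<longrightarrow>
        points (poly_ring B) (flat_limit_ideal scale B H L I) =
        points (poly_ring B) (union_ideal scale B H L I))
     \<and>
     (homogeneous_ideal I \<longrightarrow>
        homogeneous_ideal (Pi_ideal scale B L I) \<and>
        homogeneous_ideal (Lambda_ideal scale B L I) \<and>
        (\<forall>n. fps_nth (hilbert_series B I) n \<ge>
          fps_nth
            ((1 - fps_X) * hilbert_series B (times_L_ideal B (Pi_ideal scale B L I)) +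
             fps_X * hilbert_series B (times_L_ideal B (Lambda_ideal scale B L I))) n))
     \<and>
     (\<forall>H. complementary scale H L \<longrightarrow>
        reduced_ring (coord_quot B (flat_limit_ideal scale B H L I)) \<longrightarrow>
          flat_limit_ideal scale B H L I = union_ideal scale B H L I \<and>
          (homogeneous_ideal I \<longrightarrow> hilbert_series B I =
             (1 - fps_X) * hilbert_series B (times_L_ideal B (Pi_ideal scale B L I)) +
             fps_X * hilbert_series B (times_L_ideal B (Lambda_ideal scale B L I))))"
proof (intro conjI allI impI)
  have I: "ideal_set (mpolys B) I"
    using X by (simp add: poly_ring_eq ideal_ring_on[OF subring_mpolys])
  {
    fix H assume H: "complementary scale H L"
    obtain l \<phi> where s: "split_line scale B L l \<phi>" and H_eq: "H = {v. \<phi> v = 0}"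
      using split_line_of_complement[OF V L H] .
    interpret split_line scale B L l \<phi> by (rule s)
    note eqs = flat_limit_ideal_eq[OF I, folded H_eq] union_ideal_eq[OF I, folded H_eq]
    show "flat_limit_ideal scale B H L I \<subseteq> union_ideal scale B H L I"
      unfolding eqs by (rule leading_layers_subset)
    show "points (poly_ring B) (flat_limit_ideal scale B H L I) =
        points (poly_ring B) (union_ideal scale B H L I)"
      unfolding eqs by (rule points_eq[OF I])
    assume "reduced_ring (coord_quot B (flat_limit_ideal scale B H L I))"
    note eq = reduced_leading_layers[OF I this[unfolded eqs]]
    show "flat_limit_ideal scale B H L I = union_ideal scale B H L I"
      unfolding eqs by (rule eq)
    assume "homogeneous_ideal I"
    from hilbert_series_eq[OF I this eq] show "hilbert_series B I =
             (1 - fps_X) * hilbert_series B (times_L_ideal B (Pi_ideal scale B L I)) +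
             fps_X * hilbert_series B (times_L_ideal B (Lambda_ideal scale B L I))" .
  }
  assume hom: "homogeneous_ideal I"
  \<comment> \<open>Part (c) refers to no complement, so \<phi> is chosen from L alone.\<close>
  obtain l \<phi> where s: "split_line scale B L l \<phi>" using split_line_of_line[OF V L] .
  interpret split_line scale B L l \<phi> by (rule s)
  show "homogeneous_ideal (Pi_ideal scale B L I)"
    unfolding Pi_ideal_eq[OF I] by (rule homogeneous_leading(1)[OF I hom])
  show "homogeneous_ideal (Lambda_ideal scale B L I)"
    unfolding Lambda_ideal_eq[OF I] by (rule homogeneous_leading(2)[OF I hom])
  show "fps_nth (hilbert_series B I) n \<ge>
          fps_nth
            ((1 - fps_X) * hilbert_series B (times_L_ideal B (Pi_ideal scale B L I)) +
             fps_X * hilbert_series B (times_L_ideal B (Lambda_ideal scale B L I))) n" for n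
    by (rule hilbert_series_ge[OF I hom])
qed

end
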